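(* There exist absolute constants $1<C_1<14$ and $1<C_2<e^{10}$ such that the following holds. Let $q\ge1$ and let $p/q=p_n/q_n=[a_1,a_2,\dots,a_n]$ (in lowest terms), where $a_1$ is odd and $a_k$ is even for $2\le k\le n$. Then the derivative of the discriminant $\sigma$ of $S(p/q)$ at zero satisfies $$|\sigma'(0)|<C_2q^{C_1},$$ and half the width $w_0$ of the centermost band of $S(p/q)$ satisfies $$w_0\ge\frac{4}{|\sigma'(0)|}>4C_2^{-1}q^{-C_1}.$$ Moreover, for any $\nu>1$ and any $\varepsilon>0$ there exists $Q=Q(\varepsilon,\nu)$ such that if $p/q=p_n/q_n=[a_1,a_2,\dots,a_n]$ (in lowest terms), where $a_1$ is odd and $a_k$ is even for $2\le k\le n$, and if, in addition, $q_{k+1}\ge q_k^{\nu}$ for all $1\le k\le n-1$ (where $p_k/q_k=[a_1,\dots,a_k]$ in lowest terms) and $q>Q$, then $$|\sigma'(0)|<q^{5+\gamma_0+\varepsilon},\qquad w_0>4q^{-(5+\gamma_0+\varepsilon)},$$ where $\gamma_0$ is Euler's constant.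
   Context: Continued fractions: for positive integers $a_j$, $[a_1,a_2,\dots,a_n]=\cfrac{1}{a_1+\cfrac{1}{a_2+\cdots+\cfrac1{a_n}}}$. The parity conditions on the $a_k$ in the claim imply that $q$ is odd. For $\alpha,\theta\in(0,1]$ let $H_{\alpha,\theta}$ be the self-adjoint operator on $l^2(\mathbb{Z})$ given by $(H_{\alpha,\theta}\phi)(n)=\phi(n-1)+\phi(n+1)+2\cos(2\pi(\alpha n+\theta))\,\phi(n)$. Let $S(\alpha)$ be the union over all $\theta\in(0,1]$ of the spectra of $H_{\alpha,\theta}$. For $\alpha=p/q$ with $(p,q)=1$, the discriminant is the polynomial of degree $q$ $$\sigma(E)=-\operatorname{tr}\left\{\begin{pmatrix}E-2\cos(2\pi p/q+\frac{\pi}{2q})&-1\\1&0\end{pmatrix}\begin{pmatrix}E-2\cos(2\pi\cdot 2p/q+\frac{\pi}{2q})&-1\\1&0\end{pmatrix}\cdots\begin{pmatrix}E-2\cos(2\pi qp/q+\frac{\pi}{2q})&-1\\1&0\end{pmatrix}\right\},$$ and $S(p/q)=\sigma^{-1}([-4,4])$. One has $\sigma(E)=(-1)^q\sigma(-E)$, so $S(p/q)$ is symmetric about $0$. For $q$ odd, $S(p/q)$ consists of $q$ disjoint closed intervals (bands), each containing exactly one zero of $\sigma$. The centermost band $B_0$ is the one containing $0$ (and $\sigma(0)=0$); it is symmetric about $0$ and $w_0$ denotes its right endpoint, i.e. $B_0=[-w_0,w_0]$. *)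

theory Defs
  imports "HOL-Analysis.Analysis"
begin

fun cfrac :: "nat list \<Rightarrow> real" where
  "cfrac [] = 0"
| "cfrac (a # as) = 1 / (real a + cfrac as)"

definition lowest_terms :: "nat \<Rightarrow> nat \<Rightarrow> real \<Rightarrow> bool" where
  "lowest_terms p q x \<longleftrightarrow> q \<ge> 1 \<and> coprime p q \<and> x = real p / real q"

(* The partial quotients are a 1, ..., a n; the value a 0 is irrelevant. *)
definition parity_quotients :: "nat \<Rightarrow> (nat \<Rightarrow> nat) \<Rightarrow> bool" where
  "parity_quotients n a \<longleftrightarrow>
     n \<ge> 1 \<and> (\<forall>k\<in>{1..n}. a k > 0) \<and> odd (a 1) \<and> (\<forall>k\<in>{2..n}. even (a k))"

definition l2Z :: "(int \<Rightarrow> complex) set" where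
  "l2Z = {\<phi>. (\<lambda>n. (cmod (\<phi> n))\<^sup>2) summable_on UNIV}"

definition norm_l2Z :: "(int \<Rightarrow> complex) \<Rightarrow> real" where
  "norm_l2Z \<phi> = sqrt (\<Sum>\<^sub>\<infinity>n. (cmod (\<phi> n))\<^sup>2)"

(* Operators on the Hilbert space are functions on all sequences, of which only
   the behaviour on the carrier l2Z matters. *)
definition bounded_op_l2Z :: "((int \<Rightarrow> complex) \<Rightarrow> (int \<Rightarrow> complex)) \<Rightarrow> bool" where
  "bounded_op_l2Z T \<longleftrightarrow>
     (\<forall>\<phi>\<in>l2Z. T \<phi> \<in> l2Z) \<and>
     (\<forall>\<phi>\<in>l2Z. \<forall>\<psi>\<in>l2Z. T (\<lambda>n. \<phi> n + \<psi> n) = (\<lambda>n. T \<phi> n + T \<psi> n)) \<and>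
     (\<forall>c. \<forall>\<phi>\<in>l2Z. T (\<lambda>n. c * \<phi> n) = (\<lambda>n. c * T \<phi> n)) \<and>
     (\<exists>C. \<forall>\<phi>\<in>l2Z. norm_l2Z (T \<phi>) \<le> C * norm_l2Z \<phi>)"

definition spectrum_l2Z :: "((int \<Rightarrow> complex) \<Rightarrow> (int \<Rightarrow> complex)) \<Rightarrow> complex set" where
  "spectrum_l2Z T = {z. \<not> (\<exists>R. bounded_op_l2Z R \<and>
     (\<forall>\<phi>\<in>l2Z. R (\<lambda>n. T \<phi> n - z * \<phi> n) = \<phi>) \<and>
     (\<forall>\<phi>\<in>l2Z. (\<lambda>n. T (R \<phi>) n - z * R \<phi> n) = \<phi>))}"

definition H_op :: "real \<Rightarrow> real \<Rightarrow> (int \<Rightarrow> complex) \<Rightarrow> (int \<Rightarrow> complex)" where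
  "H_op \<alpha> \<theta> \<phi> = (\<lambda>n. \<phi> (n - 1) + \<phi> (n + 1)
     + complex_of_real (2 * cos (2 * pi * (\<alpha> * real_of_int n + \<theta>))) * \<phi> n)"

(* The operators are self-adjoint, so their spectra are real and passing to the
   preimage under the embedding of the reals loses nothing. *)
definition S_set :: "real \<Rightarrow> real set" where
  "S_set \<alpha> = complex_of_real -` (\<Union>\<theta>\<in>{0<..1}. spectrum_l2Z (H_op \<alpha> \<theta>))"

definition step_matrix :: "nat \<Rightarrow> nat \<Rightarrow> real \<Rightarrow> nat \<Rightarrow> real^2^2" where
  "step_matrix p q E j =
     vector [vector [E - 2 * cos (2 * pi * real j * real p / real q + pi / (2 * real q)), - 1],
             vector [1, 0]]"

definition discriminant :: "nat \<Rightarrow> nat \<Rightarrow> real \<Rightarrow> real" where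
  "discriminant p q E =
     - trace (foldr (**) (map (step_matrix p q E) [1..<Suc q]) (mat 1))"

(* The bands are the connected components of the spectral set. *)
definition central_band :: "nat \<Rightarrow> nat \<Rightarrow> real set" where
  "central_band p q = connected_component_set (S_set (real p / real q)) 0"

(* For odd q the central band is a compact interval symmetric about 0; this is
   its right endpoint, that is, half its width. *)
definition w0 :: "nat \<Rightarrow> nat \<Rightarrow> real" where
  "w0 p q = Sup (central_band p q)"

end

theory Submission
  imports Defs
    "HOL-Real_Asymp.Real_Asymp"
    "HOL-Computational_Algebra.Fundamental_Theorem_Algebra"
begin

text \<open>
  By the formula of Chambers, the trace of the transfer matrix at quasi-momentum $\theta$ is
  $-\sigma(E) - 2\cos(2\pi q\theta)$, so $\sigma - v$ is real-rooted for all $|v| \le 4$ and its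
  critical values have modulus at least $4$; as $\sigma$ is odd, the central band therefore reaches at
  least up to $4/|\sigma'(0)|$. A quadratic-phase Fourier transform maps Bloch waves at a zero of
  $\sigma$ to a Jacobi matrix with vanishing diagonal and squared hopping terms
  $b_t = 4\sin^2(\pi p t/q)$, which yields
  $|\sigma'(0)| = q \sum_{r} \exp(-2 L_{2r})$ with $L_N = \sum_{j \le N} (-1)^j \ln|2\sin(\pi j p/q)|$.

  The sums $L_N$ are renormalized exactly along the continued fraction. With
  $t(x) = \ln|\tan(\pi x/2)|$ and $\beta = 1/\alpha$ there is a function $\Psi$ with
  $\Psi(x+\frac12) + \Psi(x-\frac12) = t(\frac12 + x/\beta)$ and
  $\Psi(x+\frac\beta2) + \Psi(x-\frac\beta2) = t(\frac12 + x)$, so that telescoping along the unit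
  squares met by the line $y = \alpha x$ gives
  $\sum_{j\le N} (-1)^j t(j\alpha) = \sum_{i\le M} (-1)^i t(i\beta) + O(1 + \ln\beta)$ with
  $M \approx N\alpha$. Because the partial quotients $a_k$, $k \ge 2$, are even, $t(i\beta)$ depends only
  on the fractional part of $\beta$ and the step can be iterated; an analogous function accounts for the
  first step, where $a_1$ is odd.
\<close>

section \<open>Gamma quotients and the boundary functions\<close>

text \<open>The summands \<open>exp (- 2 * L)\<close> in the formula for the derivative are
  positive, so everything comes down to bounding log-sine sums of even length from below. The
  obstacle is that such a sum changes its kind under renormalization: sines turn into tangents.
  Tangent sums reproduce themselves, so one sine step is followed by tangent steps only. The
  boundary functions are built from a function \<open>g\<close> with
  \<open>g z + g (z + 1) = ln z\<close>, a quotient of Gamma functions, whose monotonicity and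
  concavity give convergence and bound the boundary terms. A tangent step costs \<open>ln 8\<close>
  plus the logarithm of a ratio of consecutive denominators. The logarithms telescope; the terms
  \<open>ln 8\<close> accumulate to a factor \<open>64 ^ (n - 1)\<close> in the derivative. As
  \<open>2 ^ (n - 1) \<le> p \<le> q\<close>, it is at most \<open>q ^ 6\<close>, and
  superexponential growth absorbs it into one power of \<open>q\<close>. The discriminant is
  identified with the chiral polynomial, up to sign, by comparing zeros; this needs them to be real
  and simple beforehand.\<close>

definition half_log :: "real \<Rightarrow> real" where
  "half_log z = ln_Gamma ((z + 1) / 2) - ln_Gamma (z / 2) + ln 2 / 2"

text \<open>The constant \<open>ln 2 / 2\<close> enters twice and cancels the \<open>ln 2\<close> of
  \<open>ln (z / 2)\<close> in the functional equation of Gamma.\<close>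

lemma half_log_plus1:
  assumes "z > 0"
  shows "half_log z + half_log (z + 1) = ln z"
proof -
  have "ln_Gamma (z / 2 + 1) = ln (z / 2) + ln_Gamma (z / 2)"
  proof -
    have "z / 2 \<notin> \<int>\<^sub>\<le>\<^sub>0" using assms by (auto elim!: nonpos_Ints_cases)
    then have "Gamma (z / 2 + 1) = z / 2 * Gamma (z / 2)" by (rule Gamma_plus1)
    moreover have "Gamma (z / 2) > 0" using assms by (intro Gamma_real_pos) auto
    ultimately have "ln (Gamma (z / 2 + 1)) = ln (z / 2) + ln (Gamma (z / 2))"
      using assms by (metis half_gt_zero ln_mult_pos)
    then show ?thesis using assms by (simp add: ln_Gamma_real_pos)
  qed
  moreover have "half_log (z + 1) = ln_Gamma (z / 2 + 1) - ln_Gamma ((z + 1) / 2) + ln 2 / 2"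
  proof -
    have "(z + 1 + 1) / 2 = z / 2 + 1" by simp
    then show ?thesis unfolding half_log_def by (simp only:)
  qed
  ultimately show ?thesis
    using assms by (simp add: half_log_def ln_div)
qed

lemma Gamma_reflection_real: "Gamma x * Gamma (1 - x) = pi / sin (pi * (x::real))"
proof -
  have "complex_of_real (Gamma x * Gamma (1 - x)) = Gamma (of_real x) * Gamma (1 - of_real x)"
    by (metis Gamma_complex_of_real of_real_1 of_real_diff of_real_mult)
  also have "\<dots> = of_real pi / sin (of_real pi * of_real x)"
    by (rule Gamma_reflection_complex)
  also have "\<dots> = complex_of_real (pi / sin (pi * x))"
    by (metis of_real_divide of_real_mult sin_of_real)
  finally show ?thesis using of_real_eq_iff by blast
qed

text \<open>Euler's reflection formula at \<open>(1 + x) / 2\<close> gives \<open>pi / cos\<close>,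
  at \<open>x / 2\<close> it gives \<open>pi / sin\<close>; their quotient is the tangent.\<close>

lemma half_log_reflect:
  assumes "0 < x" "x < 1"
  shows "half_log x - half_log (1 - x) = ln (tan (pi * x / 2))"
proof -
  have pos: "Gamma ((1 + x) / 2) > 0" "Gamma ((1 - x) / 2) > 0" "Gamma (x / 2) > 0" "Gamma (1 - x / 2) > 0"
    using assms by (auto intro!: Gamma_real_pos)
  have 1: "Gamma ((1 + x) / 2) * Gamma ((1 - x) / 2) = pi / cos (pi * x / 2)"
  proof -
    have "1 - (1 + x) / 2 = (1 - x) / 2" by (simp add: field_simps)
    moreover have "sin (pi * ((1 + x) / 2)) = cos (pi * x / 2)"
      using sin_cos_eq[of "pi * ((1 + x) / 2)"] cos_minus[of "pi * x / 2"]
      by (simp add: field_simps)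
    ultimately show ?thesis using Gamma_reflection_real[of "(1 + x) / 2"] by metis
  qed
  have 2: "Gamma (x / 2) * Gamma (1 - x / 2) = pi / sin (pi * x / 2)"
    using Gamma_reflection_real[of "x / 2"] by simp
  have c: "cos (pi * x / 2) > 0" "sin (pi * x / 2) > 0"
  proof -
    have "pi * x / 2 > 0" "pi * x / 2 < pi / 2" using assms by (auto simp: field_simps)
    then show "cos (pi * x / 2) > 0" "sin (pi * x / 2) > 0"
      by (auto intro!: cos_gt_zero sin_gt_zero)
  qed
  have "half_log x - half_log (1 - x) = (ln (Gamma ((1 + x) / 2)) + ln (Gamma ((1 - x) / 2)))
      - (ln (Gamma (x / 2)) + ln (Gamma (1 - x / 2)))"
  proof -
    have "(1 - x + 1) / 2 = 1 - x / 2" by (simp add: field_simps)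
    then have "half_log (1 - x) = ln (Gamma (1 - x / 2)) - ln (Gamma ((1 - x) / 2)) + ln 2 / 2"
      using assms unfolding half_log_def by (simp only:) (subst (1 2) ln_Gamma_real_pos, auto)
    moreover have "half_log x = ln (Gamma ((1 + x) / 2)) - ln (Gamma (x / 2)) + ln 2 / 2"
      using assms by (simp add: half_log_def ln_Gamma_real_pos add.commute)
    ultimately show ?thesis by simp
  qed
  also have "\<dots> = ln (pi / cos (pi * x / 2)) - ln (pi / sin (pi * x / 2))"
    using pos 1 2 by (metis ln_mult_pos)
  also have "\<dots> = ln (tan (pi * x / 2))"
    using c by (simp add: ln_div tan_def)
  finally show ?thesis .
qed

definition half_log_deriv :: "real \<Rightarrow> real" where
  "half_log_deriv u = (Digamma ((u + 1) / 2) - Digamma (u / 2)) / 2"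

lemma half_log_has_deriv:
  assumes "u > 0"
  shows "(half_log has_real_derivative half_log_deriv u) (at u)"
proof -
  have "u / 2 \<notin> \<int>\<^sub>\<le>\<^sub>0" "(u + 1) / 2 \<notin> \<int>\<^sub>\<le>\<^sub>0"
    using assms by (auto elim!: nonpos_Ints_cases)
  then show ?thesis unfolding half_log_def [abs_def] half_log_deriv_def using assms
    by (auto intro!: derivative_eq_intros simp: field_simps)
qed

lemma half_log_deriv_nonneg: "u > 0 \<Longrightarrow> half_log_deriv u \<ge> 0"
  unfolding half_log_deriv_def using Digamma_real_mono[of "u/2" "(u+1)/2"] by simp

text \<open>Concavity of \<open>half_log\<close>: its second derivative is a difference of trigamma
  values, and trigamma is decreasing.\<close>

lemma half_log_deriv_antimono:
  assumes "0 < u" "u \<le> v"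
  shows "half_log_deriv v \<le> half_log_deriv u"
proof (rule DERIV_nonpos_imp_nonincreasing[OF assms(2)])
  fix x assume x: "u \<le> x" "x \<le> v"
  have ni: "x / 2 \<notin> \<int>\<^sub>\<le>\<^sub>0" "(x + 1) / 2 \<notin> \<int>\<^sub>\<le>\<^sub>0"
    using assms x by (auto elim!: nonpos_Ints_cases)
  have "(half_log_deriv has_real_derivative (Polygamma 1 ((x + 1) / 2) - Polygamma 1 (x / 2)) / 4) (at x)"
    unfolding half_log_deriv_def [abs_def] using ni
    by (auto intro!: derivative_eq_intros simp: field_simps)
  moreover have "(Polygamma 1 ((x + 1) / 2) - Polygamma 1 (x / 2)) / 4 \<le> 0"
    using Polygamma_real_strict_antimono[of "x/2" "(x+1)/2" 1] assms x by simp
  ultimately show "\<exists>y. DERIV half_log_deriv x :> y \<and> y \<le> 0" by blast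
qed

lemma half_log_mono:
  assumes "0 < u" "u \<le> v"
  shows "half_log u \<le> half_log v"
  by (rule DERIV_nonneg_imp_nondecreasing[OF assms(2)])
     (use assms half_log_has_deriv half_log_deriv_nonneg in \<open>meson less_le_trans\<close>)

lemma half_log_diff_antimono:
  assumes "0 < y" "y \<le> z" "h \<ge> 0"
  shows "half_log (z + h) - half_log z \<le> half_log (y + h) - half_log y"
proof (rule DERIV_nonpos_imp_nonincreasing[OF assms(2), where f = "\<lambda>u. half_log (u + h) - half_log u"])
  fix x assume x: "y \<le> x" "x \<le> z"
  have "((\<lambda>u. half_log (u + h) - half_log u) has_real_derivative (half_log_deriv (x + h) - half_log_deriv x)) (at x)"
    using assms x
    by (intro DERIV_diff half_log_has_deriv DERIV_shift[THEN iffD1]) auto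
  moreover have "half_log_deriv (x + h) - half_log_deriv x \<le> 0"
    using half_log_deriv_antimono[of x "x + h"] assms x by simp
  ultimately show "\<exists>d. ((\<lambda>u. half_log (u + h) - half_log u) has_real_derivative d) (at x) \<and> d \<le> 0" by blast
qed

text \<open>At most \<open>n\<close> unit increments cover the increment by \<open>h\<close>. By
  concavity and monotonicity each is dominated by
  \<open>half_log (z + 1) - half_log (z - 1)\<close>, which the functional equation turns into
  \<open>ln z - ln (z - 1)\<close>.\<close>

lemma half_log_diff_tendsto_0: "((\<lambda>z. half_log (z + h) - half_log z) \<longlongrightarrow> 0) at_top" if "h \<ge> 0"
proof -
  obtain n :: nat where n: "h \<le> real n" using real_arch_simple by blast
  have le: "half_log (z + real n) - half_log z \<le> real n * (ln z - ln (z - 1))" if z: "z > 1" for z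
  proof -
    have "half_log (z + real m) - half_log z \<le> real m * (ln z - ln (z - 1))" for m
    proof (induction m)
      case (Suc m)
      have "half_log (z + real m + 1) - half_log (z + real m) \<le> half_log (z + 1) - half_log z"
        using z by (intro half_log_diff_antimono) auto
      also have "\<dots> \<le> half_log (z + 1) - half_log (z - 1)" using z half_log_mono[of "z - 1" z] by simp
      also have "\<dots> = ln z - ln (z - 1)" using half_log_plus1[of z] half_log_plus1[of "z - 1"] z by simp
      finally show ?case using Suc by (simp add: algebra_simps)
    qed simp
    then show ?thesis .
  qed
  show ?thesis
  proof (rule tendsto_sandwich)
    show "\<forall>\<^sub>F z in at_top. 0 \<le> half_log (z + h) - half_log z"
      using eventually_gt_at_top[of 0] by eventually_elim (use that half_log_mono in auto)
    show "\<forall>\<^sub>F z in at_top. half_log (z + h) - half_log z \<le> real n * (ln z - ln (z - 1))"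
      using eventually_gt_at_top[of 1]
    proof eventually_elim
      case (elim z)
      have "half_log (z + h) \<le> half_log (z + real n)" using elim n that by (intro half_log_mono) auto
      then show ?case using le[OF elim] by linarith
    qed
    show "((\<lambda>z. real n * (ln z - ln (z - 1))) \<longlongrightarrow> 0) at_top" by real_asymp
  qed auto
qed

lemma half_log_diff_seq_tendsto_0:
  assumes "be > 0" "h \<ge> 0"
  shows "(\<lambda>i. half_log (c + real i * be + h) - half_log (c + real i * be)) \<longlonglongrightarrow> 0"
proof (rule filterlim_compose[OF half_log_diff_tendsto_0[OF assms(2)]])
  show "filterlim (\<lambda>i. c + real i * be) at_top sequentially"
    using assms by real_asymp
qed

lemma half_log_diff_seq_tendsto_0':
  assumes "be > 0"
  shows "(\<lambda>i. half_log (c + real i * be + x) - half_log (c + real i * be - x)) \<longlonglongrightarrow> 0"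
proof (cases "x \<ge> 0")
  case True
  then show ?thesis using half_log_diff_seq_tendsto_0[of be "2 * x" "c - x"] assms
    by (simp add: algebra_simps)
next
  case False
  then show ?thesis using tendsto_minus[OF half_log_diff_seq_tendsto_0[of be "- 2 * x" "c + x"]] assms
    by (simp add: algebra_simps)
qed

lemma alternating_telescope_sums:
  fixes d :: "nat \<Rightarrow> real"
  assumes "d \<longlonglongrightarrow> 0"
  shows "(\<lambda>i. (-1) ^ i * (d i + d (Suc i))) sums d 0"
proof -
  have "(\<Sum>i<n. (-1) ^ i * (d i + d (Suc i))) = d 0 - (-1) ^ n * d n" for n
    by (induction n) (simp_all add: algebra_simps)
  moreover have "(\<lambda>n. (-1) ^ n * d n) \<longlonglongrightarrow> 0"
    by (rule tendsto_rabs_zero_cancel) (use assms tendsto_rabs_zero in \<open>simp add: abs_mult power_abs\<close>)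
  ultimately show ?thesis unfolding sums_def
    using tendsto_diff[OF tendsto_const[of "d 0"]] by fastforce
qed

text \<open>At integers the tangent is 0 or has the default value 0, so \<open>ltan\<close> is 0
  there and the symmetries below hold without exceptional points.\<close>

definition ltan :: "real \<Rightarrow> real" where
  "ltan x = ln \<bar>tan (pi * x / 2)\<bar>"

lemma ltan_half_log:
  assumes "\<bar>v\<bar> < 1 / 2"
  shows "ltan (1 / 2 + v) = half_log (1 / 2 + v) - half_log (1 / 2 - v)"
proof -
  have "tan (pi * (1 / 2 + v) / 2) > 0"
  proof (rule tan_gt_zero)
    show "0 < pi * (1 / 2 + v) / 2" using assms by auto
    have "pi * (1 / 2 + v) < pi * 1" using assms by (intro mult_strict_left_mono) auto
    then show "pi * (1 / 2 + v) / 2 < pi / 2" by simp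
  qed
  then show ?thesis using half_log_reflect[of "1 / 2 + v"] assms by (auto simp: ltan_def)
qed

text \<open>The product expansion of the tangent in logarithmic form: neighbouring values of
  \<open>d\<close> add up to logarithms by the functional equation of \<open>half_log\<close>, and
  the alternating series telescopes to \<open>d 0\<close>.\<close>

lemma ltan_sums:
  assumes "\<bar>v\<bar> < 1 / 2"
  shows "(\<lambda>i. (-1) ^ i * (ln (real i + 1 / 2 + v) - ln (real i + 1 / 2 - v))) sums ltan (1 / 2 + v)"
proof -
  define d where "d i = half_log (1 / 2 + real i * 1 + v) - half_log (1 / 2 + real i * 1 - v)" for i
  have "d \<longlonglongrightarrow> 0" unfolding d_def by (rule half_log_diff_seq_tendsto_0') simp
  moreover have "d i + d (Suc i) = ln (real i + 1 / 2 + v) - ln (real i + 1 / 2 - v)" for i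
    using half_log_plus1[of "real i + 1 / 2 + v"] half_log_plus1[of "real i + 1 / 2 - v"] assms
    by (simp add: d_def algebra_simps)
  ultimately show ?thesis
    using alternating_telescope_sums[of d] ltan_half_log[OF assms] by (simp add: d_def)
qed

text \<open>Convexity of \<open>ln_Gamma\<close>: the derivative in the offset is a difference of
  Digamma values.\<close>

lemma ln_Gamma_symm_mono:
  assumes "0 \<le> x" "x \<le> y" "y < (c::real)"
  shows "ln_Gamma (c + x) + ln_Gamma (c - x) \<le> ln_Gamma (c + y) + ln_Gamma (c - y)"
proof (rule DERIV_nonneg_imp_nondecreasing[OF assms(2), where f = "\<lambda>h. ln_Gamma (c + h) + ln_Gamma (c - h)"])
  fix h assume h: "x \<le> h" "h \<le> y"
  have "((\<lambda>h. ln_Gamma (c + h) + ln_Gamma (c - h)) has_real_derivative Digamma (c + h) - Digamma (c - h)) (at h)"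
    using h assms by (auto intro!: derivative_eq_intros elim!: nonpos_Ints_cases)
  moreover have "Digamma (c + h) - Digamma (c - h) \<ge> 0"
    using h assms Digamma_real_mono[of "c - h" "c + h"] by simp
  ultimately show "\<exists>d. ((\<lambda>h. ln_Gamma (c + h) + ln_Gamma (c - h)) has_real_derivative d) (at h) \<and> d \<ge> 0"
    by blast
qed

lemma ln_Gamma_plus1_real: "x > 0 \<Longrightarrow> ln_Gamma (x + 1) = ln x + ln_Gamma (x :: real)"
proof -
  assume x: "x > 0"
  then have "x \<notin> \<int>\<^sub>\<le>\<^sub>0" by (auto elim!: nonpos_Ints_cases)
  then have "Gamma (x + 1) = x * Gamma x" by (rule Gamma_plus1)
  moreover have "Gamma x > 0" using x by (rule Gamma_real_pos)
  ultimately show ?thesis using x by (metis add_pos_pos less_numeral_extra(1) ln_Gamma_real_pos ln_mult_pos)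
qed

lemma cos_pi_pos:
  assumes "\<bar>v\<bar> < (1 / 2 :: real)"
  shows "cos (pi * v) > 0"
proof (rule cos_gt_zero_pi)
  show "pi * v < pi / 2" using mult_strict_left_mono[of v "1 / 2" pi] assms by simp
  show "- (pi / 2) < pi * v" using mult_strict_left_mono[of "- 1 / 2" v pi] assms by simp
qed

lemma ltan_3_4: "ltan (1 / 2 + 1 / 4) = ln (1 + sqrt 2)"
proof -
  have e: "2 * (pi * (1 / 2 + 1 / 4) / 2) = pi / 4 + pi / 2" by simp
  have "sin (pi / 4 + pi / 2) = sqrt 2 / 2" "cos (pi / 4 + pi / 2) = - (sqrt 2 / 2)"
    unfolding sin_add cos_add by (simp_all add: sin_45 cos_45)
  then have "tan (pi * (1 / 2 + 1 / 4) / 2) = (sqrt 2 / 2) / (- (sqrt 2 / 2) + 1)"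
    using tan_half[of "pi * (1 / 2 + 1 / 4) / 2"] unfolding e by (simp only:)
  also have "\<dots> = 1 + sqrt 2"
  proof -
    have "sqrt 2 < 2" by (rule real_less_lsqrt) auto
    then show ?thesis by (simp add: field_simps)
  qed
  finally show ?thesis by (simp add: ltan_def)
qed

text \<open>Euler's product for the cosine. The partial sums telescope through \<open>G\<close>,
  convexity squeezes \<open>G\<close> to 0, and the reflection formula evaluates
  \<open>G 0\<close>.\<close>

lemma ln_cos_sums:
  assumes "\<bar>v\<bar> < (1 / 2 :: real)"
  shows "(\<lambda>i. ln (real i + 1 / 2 + v) + ln (real i + 1 / 2 - v) - 2 * ln (real i + 1 / 2)) sums ln (cos (pi * v))"
proof -
  define G where "G n = ln_Gamma (1 / 2 + v + real n) + ln_Gamma (1 / 2 - v + real n) - 2 * ln_Gamma (1 / 2 + real n)" for n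
  have step: "G (Suc i) - G i = ln (real i + 1 / 2 + v) + ln (real i + 1 / 2 - v) - 2 * ln (real i + 1 / 2)" for i
    using ln_Gamma_plus1_real[of "1 / 2 + v + real i"] ln_Gamma_plus1_real[of "1 / 2 - v + real i"]
      ln_Gamma_plus1_real[of "1 / 2 + real i"] assms
    by (simp add: G_def algebra_simps abs_less_iff)
  have bnd: "0 \<le> G (Suc n)" "G (Suc n) \<le> ln (real n + 3 / 2) - ln (real n + 1 / 2)" for n
  proof -
    have e: "ln_Gamma (1 / 2 + v + real (Suc n)) + ln_Gamma (1 / 2 - v + real (Suc n)) =
         ln_Gamma (3 / 2 + real n + \<bar>v\<bar>) + ln_Gamma (3 / 2 + real n - \<bar>v\<bar>)"
      by (cases "v \<ge> 0") (simp_all add: algebra_simps)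
    show "0 \<le> G (Suc n)"
      using ln_Gamma_symm_mono[of 0 "\<bar>v\<bar>" "3 / 2 + real n"] assms e
      by (simp add: G_def algebra_simps)
    \<comment> \<open>With offset 1 in place of \<open>\<bar>v\<bar>\<close> the functional equation
      of Gamma makes the bound a difference of two logarithms.\<close>
    have "ln_Gamma (3 / 2 + real n + \<bar>v\<bar>) + ln_Gamma (3 / 2 + real n - \<bar>v\<bar>) \<le>
          ln_Gamma (3 / 2 + real n + 1) + ln_Gamma (3 / 2 + real n - 1)"
      by (rule ln_Gamma_symm_mono) (use assms in auto)
    then show "G (Suc n) \<le> ln (real n + 3 / 2) - ln (real n + 1 / 2)"
      using e ln_Gamma_plus1_real[of "3 / 2 + real n"] ln_Gamma_plus1_real[of "1 / 2 + real n"]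
      by (simp add: G_def algebra_simps)
  qed
  have "(\<lambda>n. G (Suc n)) \<longlonglongrightarrow> 0"
  proof (rule tendsto_sandwich[where f = "\<lambda>_. 0" and h = "\<lambda>n. ln (real n + 3 / 2) - ln (real n + 1 / 2)"])
    show "(\<lambda>n. ln (real n + 3 / 2) - ln (real n + 1 / 2)) \<longlonglongrightarrow> 0" by real_asymp
  qed (use bnd in auto)
  then have "G \<longlonglongrightarrow> 0" by (rule LIMSEQ_imp_Suc)
  then have "(\<lambda>i. G (Suc i) - G i) sums (0 - G 0)" by (rule telescope_sums)
  moreover have "- G 0 = ln (cos (pi * v))"
  proof -
    have c: "cos (pi * v) > 0" using assms by (rule cos_pi_pos)
    have pos: "Gamma (1 / 2 + v) > 0" "Gamma (1 / 2 - v) > 0" "Gamma (1 / 2 :: real) > 0"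
      using assms by (auto intro!: Gamma_real_pos)
    have "Gamma (1 / 2 + v) * Gamma (1 / 2 - v) = pi / cos (pi * v)"
      using Gamma_reflection_real[of "1 / 2 + v"] by (simp add: sin_add distrib_left)
    moreover have "Gamma (1 / 2 :: real) * Gamma (1 / 2) = pi"
      using Gamma_reflection_real[of "1 / 2"] by simp
    ultimately have "ln (Gamma (1 / 2 + v)) + ln (Gamma (1 / 2 - v)) = ln pi - ln (cos (pi * v))"
      "2 * ln (Gamma (1 / 2 :: real)) = ln pi"
      using pos c pi_gt_zero by (metis ln_div less_numeral_extra(3) ln_mult_pos, metis mult_2 ln_mult_pos)
    then show ?thesis using assms by (simp add: G_def ln_Gamma_real_pos abs_less_iff)
  qed
  ultimately show ?thesis by (simp add: step)
qed

text \<open>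
  \<open>Psi_tan\<close> is the function $\Psi$ of the introduction and \<open>Psi_sin\<close> its counterpart for
  $\ln|2\sin(\pi x)|$; both are assembled from one logarithmic singularity at each
  \<open>\<plusminus> pole be i\<close>. The subtracted terms in \<open>Psi_sin_term\<close> make the series converge and fix the
  additive constant by $\Psi_{\sin}(\frac12) = \frac12\ln 2$.
\<close>

definition pole :: "real \<Rightarrow> nat \<Rightarrow> real" where
  "pole be i = (1 + be) / 2 + real i * be"

definition Psi_tan :: "real \<Rightarrow> real \<Rightarrow> real" where
  "Psi_tan be x = (\<Sum>i. (-1) ^ i * (half_log (pole be i + x) - half_log (pole be i - x)))"

definition Psi_sin_term :: "real \<Rightarrow> real \<Rightarrow> nat \<Rightarrow> real" where
  "Psi_sin_term be x i = half_log (pole be i + x) + half_log (pole be i - x) - half_log (pole be i + 1 / 2) - half_log (pole be i - 1 / 2)"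

definition Psi_sin :: "real \<Rightarrow> real \<Rightarrow> real" where
  "Psi_sin be x = ln 2 / 2 + (\<Sum>i. Psi_sin_term be x i)"

lemma Psi_sin_minus: "Psi_sin be (- x) = Psi_sin be x"
  by (simp add: Psi_sin_def Psi_sin_term_def add.commute)

section \<open>Convergence, monotonicity and shift equations of the boundary functions\<close>

context
  fixes be :: real
  assumes be: "be \<ge> 1"
begin

lemma pole_less: "\<bar>x\<bar> < (1 + be) / 2 \<Longrightarrow> \<bar>x\<bar> < pole be i"
  unfolding pole_def using be by (smt (verit) mult_nonneg_nonneg of_nat_0_le_iff)

lemma pole_mono: "i \<le> j \<Longrightarrow> pole be i \<le> pole be j"
  unfolding pole_def using be by (simp add: mult_right_mono)

lemma pole_Suc: "pole be (Suc i) = pole be i + be"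
  unfolding pole_def by (simp add: algebra_simps)

lemma pole_half: "pole be i = be * (real i + 1 / 2) + 1 / 2" "pole be i \<ge> be / 2 + 1 / 2"
  unfolding pole_def using be by (simp_all add: field_simps)

lemma half_shift:
  assumes "\<bar>x\<bar> < be / 2"
  shows "\<bar>x + 1 / 2\<bar> < (1 + be) / 2" "\<bar>x - 1 / 2\<bar> < (1 + be) / 2"
  using assms unfolding abs_less_iff by (auto simp: field_simps)

lemma leibniz_nonneg:
  fixes c :: "nat \<Rightarrow> real"
  assumes "c \<longlonglongrightarrow> 0" "\<And>i. c i \<ge> 0" "\<And>i. c (Suc i) \<le> c i"
  shows "summable (\<lambda>i. (-1) ^ i * c i)" "(\<Sum>i. (-1) ^ i * c i) \<ge> 0"
  using summable_Leibniz'(1)[OF assms] summable_Leibniz'(2)[OF assms, of 0] by simp_all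

text \<open>Leibniz criterion: for nonnegative arguments the terms are nonnegative by monotonicity
  and decreasing by concavity of \<open>half_log\<close>; negative arguments follow because the
  terms are odd in \<open>x\<close>.\<close>

lemma Psi_tan_summable:
  assumes "\<bar>x\<bar> < (1 + be) / 2"
  shows "summable (\<lambda>i. (-1) ^ i * (half_log (pole be i + x) - half_log (pole be i - x)))"
proof -
  have lim: "(\<lambda>i. half_log (pole be i + y) - half_log (pole be i - y)) \<longlonglongrightarrow> 0" for y
    unfolding pole_def using half_log_diff_seq_tendsto_0'[of be] be by simp
  have *: "summable (\<lambda>i. (-1) ^ i * (half_log (pole be i + y) - half_log (pole be i - y)))"
    if y: "y \<ge> 0" "y < (1 + be) / 2" for y
  proof (rule leibniz_nonneg(1)[OF lim])
    fix i
    have less: "y < pole be i" using pole_less[of y i] y by simp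
    show "half_log (pole be i + y) - half_log (pole be i - y) \<ge> 0"
      using less half_log_mono[of "pole be i - y" "pole be i + y"] y by simp
    show "half_log (pole be (Suc i) + y) - half_log (pole be (Suc i) - y) \<le> half_log (pole be i + y) - half_log (pole be i - y)"
      using half_log_diff_antimono[of "pole be i - y" "pole be (Suc i) - y" "2 * y"] less y pole_mono[of i "Suc i"]
      by (simp add: algebra_simps)
  qed
  show ?thesis
  proof (cases "x \<ge> 0")
    case True
    then show ?thesis using * assms by simp
  next
    case False
    then show ?thesis using summable_minus[OF *[of "- x"]] assms by (simp add: algebra_simps)
  qed
qed

lemma Psi_tan_sums:
  assumes "\<bar>x\<bar> < (1 + be) / 2"
  shows "(\<lambda>i. (-1) ^ i * (half_log (pole be i + x) - half_log (pole be i - x))) sums Psi_tan be x"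
  unfolding Psi_tan_def using Psi_tan_summable[OF assms] by (rule summable_sums)

lemma Psi_tan_minus:
  assumes "\<bar>x\<bar> < (1 + be) / 2"
  shows "Psi_tan be (- x) = - Psi_tan be x"
proof -
  have "Psi_tan be (- x) = (\<Sum>i. - ((-1) ^ i * (half_log (pole be i + x) - half_log (pole be i - x))))"
    unfolding Psi_tan_def by (intro suminf_cong) (simp add: algebra_simps)
  also have "\<dots> = - Psi_tan be x"
    unfolding Psi_tan_def by (rule suminf_minus[OF Psi_tan_summable[OF assms]])
  finally show ?thesis .
qed

text \<open>The difference of the two values is again an alternating series with nonnegative
  decreasing terms.\<close>

lemma Psi_tan_mono:
  assumes "\<bar>x\<bar> < (1 + be) / 2" "\<bar>y\<bar> < (1 + be) / 2" "x \<le> y"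
  shows "Psi_tan be x \<le> Psi_tan be y"
proof -
  define c where "c i = (half_log (pole be i + y) - half_log (pole be i + x)) + (half_log (pole be i - x) - half_log (pole be i - y))" for i
  have "(\<lambda>i. half_log (pole be i + x + (y - x)) - half_log (pole be i + x)) \<longlonglongrightarrow> 0"
    "(\<lambda>i. half_log (pole be i - y + (y - x)) - half_log (pole be i - y)) \<longlonglongrightarrow> 0"
    using half_log_diff_seq_tendsto_0[of be "y - x" "(1 + be) / 2 + x"]
      half_log_diff_seq_tendsto_0[of be "y - x" "(1 + be) / 2 - y"] assms be
    unfolding pole_def by (simp_all add: algebra_simps)
  from tendsto_add[OF this] have lim: "c \<longlonglongrightarrow> 0"
    unfolding c_def by (simp add: algebra_simps)
  have "(\<Sum>i. (-1) ^ i * c i) \<ge> 0"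
  proof (rule leibniz_nonneg(2)[OF lim])
    fix i
    have less: "\<bar>y\<bar> < pole be i" "\<bar>x\<bar> < pole be i" using pole_less[of y i] pole_less[of x i] assms by auto
    show "c i \<ge> 0" unfolding c_def
      using less half_log_mono[of "pole be i + x" "pole be i + y"] half_log_mono[of "pole be i - y" "pole be i - x"] assms
      by simp
    have "\<bar>x\<bar> + x \<ge> 0" "\<bar>y\<bar> - y \<ge> 0" by auto
    then have pos: "pole be i + x > 0" "pole be i - y > 0" using less by linarith+
    show "c (Suc i) \<le> c i" unfolding c_def
      using pos half_log_diff_antimono[of "pole be i + x" "pole be (Suc i) + x" "y - x"]
        half_log_diff_antimono[of "pole be i - y" "pole be (Suc i) - y" "y - x"] less pole_mono[of i "Suc i"] assms
      by (simp add: algebra_simps)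
  qed
  moreover have "(\<lambda>i. (-1) ^ i * c i) sums (Psi_tan be y - Psi_tan be x)"
    using sums_diff[OF Psi_tan_sums[OF assms(2)] Psi_tan_sums[OF assms(1)]]
    by (rule sums_cong[THEN iffD1, rotated]) (simp add: c_def algebra_simps)
  ultimately show ?thesis by (simp add: sums_iff)
qed

text \<open>Shifts by \<open>be / 2\<close> align the singularities of neighbouring indices: the
  terms become \<open>d i + d (Suc i)\<close> and only the innermost value survives.\<close>

lemma Psi_tan_shift_be:
  assumes "\<bar>x\<bar> < 1 / 2"
  shows "Psi_tan be (x + be / 2) + Psi_tan be (x - be / 2) = ltan (1 / 2 + x)"
proof -
  define d where "d i = half_log (1 / 2 + real i * be + x) - half_log (1 / 2 + real i * be - x)" for i
  have "d \<longlonglongrightarrow> 0" unfolding d_def using be by (intro half_log_diff_seq_tendsto_0') simp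
  then have "(\<lambda>i. (-1) ^ i * (d i + d (Suc i))) sums d 0" by (rule alternating_telescope_sums)
  moreover have "(\<lambda>i. (-1) ^ i * (d i + d (Suc i))) sums (Psi_tan be (x + be / 2) + Psi_tan be (x - be / 2))"
  proof (rule sums_cong[THEN iffD1, rotated, OF sums_add[OF Psi_tan_sums[of "x + be / 2"] Psi_tan_sums[of "x - be / 2"]]])
    fix i
    have e: "pole be i + (x + be / 2) = 1 / 2 + real (Suc i) * be + x"
      "pole be i - (x + be / 2) = 1 / 2 + real i * be - x"
      "pole be i + (x - be / 2) = 1 / 2 + real i * be + x"
      "pole be i - (x - be / 2) = 1 / 2 + real (Suc i) * be - x"
      by (simp_all add: pole_def field_simps)
    show "(-1) ^ i * (half_log (pole be i + (x + be / 2)) - half_log (pole be i - (x + be / 2))) +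
         (-1) ^ i * (half_log (pole be i + (x - be / 2)) - half_log (pole be i - (x - be / 2))) = (-1) ^ i * (d i + d (Suc i))"
      unfolding d_def e by (simp only: distrib_left[symmetric]) simp
  qed (use assms be in auto)
  moreover have "d 0 = ltan (1 / 2 + x)"
    using ltan_half_log[OF assms] by (simp add: d_def)
  ultimately show ?thesis using sums_unique2 by metis
qed

text \<open>Shifts by \<open>1 / 2\<close> pair the values of \<open>half_log\<close> as in its
  functional equation. What remains is the series of the tangent at \<open>x / be\<close>, since the
  factors \<open>be\<close> cancel in each difference of logarithms.\<close>

lemma Psi_tan_shift_1:
  assumes "\<bar>x\<bar> < be / 2"
  shows "Psi_tan be (x + 1 / 2) + Psi_tan be (x - 1 / 2) = ltan (1 / 2 + x / be)"
proof -
  have v: "\<bar>x / be\<bar> < 1 / 2" using assms be by (simp add: field_simps abs_less_iff)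
  have "(\<lambda>i. (-1) ^ i * (ln (real i + 1 / 2 + x / be) - ln (real i + 1 / 2 - x / be)))
      sums (Psi_tan be (x + 1 / 2) + Psi_tan be (x - 1 / 2))"
  proof (rule sums_cong[THEN iffD1, rotated, OF sums_add[OF Psi_tan_sums[of "x + 1 / 2"] Psi_tan_sums[of "x - 1 / 2"]]])
    fix i
    define a where "a = pole be i"
    have a: "\<bar>x\<bar> < a - 1 / 2" "a = be * (real i + 1 / 2) + 1 / 2"
      using assms be pole_half[of i] unfolding a_def by linarith+
    have p: "real i + 1 / 2 + x / be > 0" "real i + 1 / 2 - x / be > 0" using v by linarith+
    have "half_log (a + (x + 1 / 2)) + half_log (a + (x - 1 / 2)) = ln (be * (real i + 1 / 2 + x / be))"
    proof -
      have "be * (real i + 1 / 2 + x / be) = a + (x - 1 / 2)" using a be by (simp add: distrib_left)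
      moreover have "a + (x + 1 / 2) = a + (x - 1 / 2) + 1" by simp
      moreover have "a + (x - 1 / 2) > 0" using a by linarith
      ultimately show ?thesis using half_log_plus1[of "a + (x - 1 / 2)"] by (simp only: add.commute)
    qed
    moreover have "half_log (a - (x + 1 / 2)) + half_log (a - (x - 1 / 2)) = ln (be * (real i + 1 / 2 - x / be))"
    proof -
      have "be * (real i + 1 / 2 - x / be) = a - (x + 1 / 2)" using a be by (simp add: distrib_left right_diff_distrib)
      moreover have "a - (x - 1 / 2) = a - (x + 1 / 2) + 1" by simp
      moreover have "a - (x + 1 / 2) > 0" using a by linarith
      ultimately show ?thesis using half_log_plus1[of "a - (x + 1 / 2)"] by (simp only: add.commute)
    qed
    ultimately show "(-1) ^ i * (half_log (pole be i + (x + 1 / 2)) - half_log (pole be i - (x + 1 / 2))) +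
         (-1) ^ i * (half_log (pole be i + (x - 1 / 2)) - half_log (pole be i - (x - 1 / 2))) =
         (-1) ^ i * (ln (real i + 1 / 2 + x / be) - ln (real i + 1 / 2 - x / be))"
      using p be by (simp add: a_def[symmetric] distrib_left[symmetric] ln_mult)
  qed (fact half_shift[OF assms])+
  then show ?thesis using ltan_sums[OF v] by (rule sums_unique2)
qed

text \<open>Each term is a difference of two centred second differences of \<open>half_log\<close>,
  with steps \<open>1 / 2\<close> and \<open>\<bar>x\<bar>\<close>. Such second differences are
  dominated by a telescoping series of first differences.\<close>

lemma Psi_sin_summable:
  assumes "\<bar>x\<bar> < (1 + be) / 2"
  shows "summable (Psi_sin_term be x)"
proof -
  have *: "summable (\<lambda>i. 2 * half_log (pole be i) - half_log (pole be i + h) - half_log (pole be i - h))"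
    if h: "h \<ge> 0" "h < (1 + be) / 2" for h
  proof (rule summable_comparison_test')
    have "(\<lambda>i. half_log (pole be i - h + h) - half_log (pole be i - h)) \<longlonglongrightarrow> 0"
      using half_log_diff_seq_tendsto_0[of be h "(1 + be) / 2 - h"] h be unfolding pole_def
      by (simp add: algebra_simps)
    from telescope_summable'[OF this]
    show "summable (\<lambda>i. (half_log (pole be i - h + h) - half_log (pole be i - h)) - (half_log (pole be (Suc i) - h + h) - half_log (pole be (Suc i) - h)))" .
    fix i :: nat
    have less: "h < pole be i" using pole_less[of h i] h by simp
    have "half_log (pole be i + h) - half_log (pole be i) \<le> half_log (pole be i - h + h) - half_log (pole be i - h)"
      by (rule half_log_diff_antimono) (use less h in auto)
    \<comment> \<open>Here \<open>be \<ge> 1\<close> enters: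
      \<open>h < (1 + be) / 2 \<le> be\<close>, so the next pole minus \<open>h\<close> still lies
      to the right of the present pole.\<close>
    moreover have "half_log (pole be (Suc i) - h + h) - half_log (pole be (Suc i) - h) \<le> half_log (pole be i + h) - half_log (pole be i)"
      by (rule half_log_diff_antimono) (use less h be pole_Suc in auto)
    ultimately show "norm (2 * half_log (pole be i) - half_log (pole be i + h) - half_log (pole be i - h))
      \<le> (half_log (pole be i - h + h) - half_log (pole be i - h)) - (half_log (pole be (Suc i) - h + h) - half_log (pole be (Suc i) - h))"
      by simp
  qed
  have "summable (\<lambda>i. (2 * half_log (pole be i) - half_log (pole be i + 1 / 2) - half_log (pole be i - 1 / 2))
     - (2 * half_log (pole be i) - half_log (pole be i + \<bar>x\<bar>) - half_log (pole be i - \<bar>x\<bar>)))"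
    using assms be by (intro summable_diff *) auto
  also have "(\<lambda>i. (2 * half_log (pole be i) - half_log (pole be i + 1 / 2) - half_log (pole be i - 1 / 2))
     - (2 * half_log (pole be i) - half_log (pole be i + \<bar>x\<bar>) - half_log (pole be i - \<bar>x\<bar>))) = Psi_sin_term be x"
    by (auto simp: Psi_sin_term_def abs_if)
  finally show ?thesis .
qed

text \<open>Without alternating signs it is the difference of the shifted series, not their sum,
  that telescopes.\<close>

lemma Psi_sin_shift_be:
  assumes "\<bar>x\<bar> < 1 / 2"
  shows "Psi_sin be (x + be / 2) - Psi_sin be (x - be / 2) = - ltan (1 / 2 + x)"
proof -
  define d where "d i = half_log (1 / 2 + real i * be + x) - half_log (1 / 2 + real i * be - x)" for i
  have s: "summable (Psi_sin_term be (x + be / 2))" "summable (Psi_sin_term be (x - be / 2))"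
    using assms be by (auto intro!: Psi_sin_summable)
  have "d \<longlonglongrightarrow> 0" unfolding d_def using be by (intro half_log_diff_seq_tendsto_0') simp
  then have "(\<lambda>i. d (Suc i) - d i) sums (0 - d 0)" by (rule telescope_sums)
  moreover have "(\<lambda>i. d (Suc i) - d i) = (\<lambda>i. Psi_sin_term be (x + be / 2) i - Psi_sin_term be (x - be / 2) i)"
  proof
    fix i
    have e: "pole be i + (x + be / 2) = 1 / 2 + real (Suc i) * be + x"
      "pole be i - (x + be / 2) = 1 / 2 + real i * be - x"
      "pole be i + (x - be / 2) = 1 / 2 + real i * be + x"
      "pole be i - (x - be / 2) = 1 / 2 + real (Suc i) * be - x"
      by (simp_all add: pole_def field_simps)
    show "d (Suc i) - d i = Psi_sin_term be (x + be / 2) i - Psi_sin_term be (x - be / 2) i"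
      unfolding d_def Psi_sin_term_def e by simp
  qed
  moreover have "d 0 = ltan (1 / 2 + x)"
    using ltan_half_log[OF assms] by (simp add: d_def)
  ultimately show ?thesis using suminf_diff[OF s] by (simp add: Psi_sin_def sums_iff)
qed

text \<open>The functional equation leaves Euler's product for the cosine. The normalizing terms
  contribute \<open>- 2 * ln (be * (i + 1 / 2))\<close>, which removes \<open>be\<close>, and the
  constant \<open>ln 2 / 2\<close>, counted twice, gives the factor 2 of the cosine.\<close>

lemma Psi_sin_shift_1:
  assumes "\<bar>x\<bar> < be / 2"
  shows "Psi_sin be (x + 1 / 2) + Psi_sin be (x - 1 / 2) = ln (2 * cos (pi * (x / be)))"
proof -
  have v: "\<bar>x / be\<bar> < 1 / 2" using assms be by (simp add: field_simps abs_less_iff)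
  have s: "summable (Psi_sin_term be (x + 1 / 2))" "summable (Psi_sin_term be (x - 1 / 2))"
    by (fact Psi_sin_summable[OF half_shift(1)[OF assms]] Psi_sin_summable[OF half_shift(2)[OF assms]])+
  have "(\<lambda>i. Psi_sin_term be (x + 1 / 2) i + Psi_sin_term be (x - 1 / 2) i) =
        (\<lambda>i. ln (real i + 1 / 2 + x / be) + ln (real i + 1 / 2 - x / be) - 2 * ln (real i + 1 / 2))"
  proof
    fix i
    define a where "a = pole be i"
    have a: "\<bar>x\<bar> < a - 1 / 2" "a = be * (real i + 1 / 2) + 1 / 2" "a > 1/2"
      using assms be pole_half[of i] unfolding a_def by linarith+
    have p: "real i + 1 / 2 + x / be > 0" "real i + 1 / 2 - x / be > 0" using v by linarith+
    have "half_log (a + (x + 1 / 2)) + half_log (a + (x - 1 / 2)) = ln (be * (real i + 1 / 2 + x / be))"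
    proof -
      have "be * (real i + 1 / 2 + x / be) = a + (x - 1 / 2)" using a be by (simp add: distrib_left)
      moreover have "a + (x + 1 / 2) = a + (x - 1 / 2) + 1" by simp
      moreover have "a + (x - 1 / 2) > 0" using a by linarith
      ultimately show ?thesis using half_log_plus1[of "a + (x - 1 / 2)"] by (simp only: add.commute)
    qed
    moreover have "half_log (a - (x + 1 / 2)) + half_log (a - (x - 1 / 2)) = ln (be * (real i + 1 / 2 - x / be))"
    proof -
      have "be * (real i + 1 / 2 - x / be) = a - (x + 1 / 2)" using a be by (simp add: distrib_left right_diff_distrib)
      moreover have "a - (x - 1 / 2) = a - (x + 1 / 2) + 1" by simp
      moreover have "a - (x + 1 / 2) > 0" using a by linarith
      ultimately show ?thesis using half_log_plus1[of "a - (x + 1 / 2)"] by (simp only: add.commute)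
    qed
    moreover have "half_log (a + 1 / 2) + half_log (a - 1 / 2) = ln (be * (real i + 1 / 2))"
    proof -
      have "be * (real i + 1 / 2) = a - 1 / 2" using a by simp
      moreover have "a + 1 / 2 = a - 1 / 2 + 1" by simp
      moreover have "a - 1 / 2 > 0" using a by linarith
      ultimately show ?thesis using half_log_plus1[of "a - 1 / 2"] by (simp only: add.commute)
    qed
    ultimately show "Psi_sin_term be (x + 1 / 2) i + Psi_sin_term be (x - 1 / 2) i =
       ln (real i + 1 / 2 + x / be) + ln (real i + 1 / 2 - x / be) - 2 * ln (real i + 1 / 2)"
      using p be unfolding Psi_sin_term_def a_def[symmetric] by (simp add: ln_mult)
  qed
  then have "(\<Sum>i. Psi_sin_term be (x + 1 / 2) i) + (\<Sum>i. Psi_sin_term be (x - 1 / 2) i) = ln (cos (pi * (x / be)))"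
    using suminf_add[OF s] ln_cos_sums[OF v] by (simp add: sums_iff)
  moreover have "cos (pi * (x / be)) > 0" using v by (rule cos_pi_pos)
  ultimately show ?thesis by (simp add: Psi_sin_def ln_mult)
qed

lemma Psi_sin_antimono:
  assumes "\<bar>x\<bar> \<le> \<bar>y\<bar>" "\<bar>y\<bar> < (1 + be) / 2"
  shows "Psi_sin be y \<le> Psi_sin be x"
proof -
  have *: "Psi_sin be \<bar>y\<bar> \<le> Psi_sin be \<bar>x\<bar>"
    unfolding Psi_sin_def
  proof (intro add_left_mono suminf_le)
    fix i
    have less: "\<bar>y\<bar> < pole be i" using pole_less[of y i] assms by simp
    show "Psi_sin_term be \<bar>y\<bar> i \<le> Psi_sin_term be \<bar>x\<bar> i"
      using half_log_diff_antimono[of "pole be i - \<bar>y\<bar>" "pole be i + \<bar>x\<bar>" "\<bar>y\<bar> - \<bar>x\<bar>"] less assms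
      by (simp add: Psi_sin_term_def algebra_simps)
  qed (use assms in \<open>auto intro!: Psi_sin_summable\<close>)
  then show ?thesis by (cases "x \<ge> 0"; cases "y \<ge> 0") (auto simp: Psi_sin_minus abs_if)
qed

text \<open>
  By concavity the drop over $[\frac{\beta-1}2, \frac\beta2]$ is at most the drop over
  $[\frac\beta2-\frac14, \frac\beta2+\frac14]$, which the shift equation evaluates.
\<close>

lemma Psi_sin_drop: "Psi_sin be ((be - 1) / 2) - Psi_sin be (be / 2) \<le> ln (1 + sqrt 2)"
proof -
  have s: "summable (Psi_sin_term be ((be - 1) / 2))" "summable (Psi_sin_term be (be / 2))"
    "summable (Psi_sin_term be (be / 2 - 1 / 4))" "summable (Psi_sin_term be (be / 2 + 1 / 4))"
    using be by (auto intro!: Psi_sin_summable simp: field_simps)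
  have "Psi_sin be ((be - 1) / 2) - Psi_sin be (be / 2) = (\<Sum>i. Psi_sin_term be ((be - 1) / 2) i - Psi_sin_term be (be / 2) i)"
    using suminf_diff[OF s(1,2)] by (simp add: Psi_sin_def)
  also have "\<dots> \<le> (\<Sum>i. Psi_sin_term be (be / 2 - 1 / 4) i - Psi_sin_term be (be / 2 + 1 / 4) i)"
  proof (intro suminf_le summable_diff s)
    fix i
    define a where "a = pole be i"
    have less: "be / 2 + 1 / 4 < a" using pole_less[of "be / 2 + 1 / 4" i] be by (simp add: a_def)
    show "Psi_sin_term be ((be - 1) / 2) i - Psi_sin_term be (be / 2) i
      \<le> Psi_sin_term be (be / 2 - 1 / 4) i - Psi_sin_term be (be / 2 + 1 / 4) i"
      unfolding Psi_sin_term_def a_def[symmetric]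
      using half_log_diff_antimono[of "a - (be / 2 + 1 / 4)" "a - be / 2" "1 / 2"]
        half_log_diff_antimono[of "a + (be - 1) / 2" "a + (be / 2 - 1 / 4)" "1 / 2"] less be
      by (simp add: field_simps)
  qed
  also have "\<dots> = Psi_sin be (1 / 4 - be / 2) - Psi_sin be (1 / 4 + be / 2)"
    using suminf_diff[OF s(3,4)] Psi_sin_minus[of be "be / 2 - 1 / 4"] by (simp add: Psi_sin_def add.commute)
  also have "\<dots> = ltan (1 / 2 + 1 / 4)"
    using Psi_sin_shift_be[of "1 / 4"] by (simp add: add.commute)
  also have "\<dots> = ln (1 + sqrt 2)"
    by (rule ltan_3_4)
  finally show ?thesis .
qed

end

section \<open>Renormalization of alternating sums\<close>

text \<open>
  The squares $[j,j+1]\times[i,i+1]$ met by the line $y = \alpha x$ form a staircase; a horizontal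
  step changes \<open>h\<close> by \<open>f j\<close> and a vertical one by \<open>- g i\<close>.
\<close>

lemma lattice_path_sum:
  fixes al :: real and h :: "nat \<Rightarrow> nat \<Rightarrow> real" and f g :: "nat \<Rightarrow> real"
  assumes al: "0 < al" "al \<le> 1"
    and nonsing: "\<And>j. 1 \<le> j \<Longrightarrow> j \<le> N \<Longrightarrow> al * real j \<notin> \<int>"
    and jstep: "\<And>j i. 1 \<le> j \<Longrightarrow> real i < al * real j \<Longrightarrow> al * real j < real i + 1
                  \<Longrightarrow> h j i - h (j - 1) i = f j"
    and istep: "\<And>j i. 1 \<le> i \<Longrightarrow> al * real j < real i \<Longrightarrow> real i < al * (real j + 1)
                  \<Longrightarrow> h j i - h j (i - 1) = - g i"
    and cell: "real M < al * (real N + 1)" "al * real N < real M + 1"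
  shows "(\<Sum>j=1..N. f j) = (\<Sum>i=1..M. g i) + h N M - h 0 0"
proof -
  have "(\<Sum>j=1..j. f j) = (\<Sum>i=1..i. g i) + h j i - h 0 0"
    if "j \<le> N" "real i < al * (real j + 1)" "al * real j < real i + 1" for j i
    using that
  proof (induction "j + i" arbitrary: j i)
    case 0
    then show ?case by simp
  next
    case (Suc n)
    have jpos: "j > 0"
    proof (rule ccontr)
      assume "\<not> j > 0"
      then have "real i < 1" "j = 0" using Suc.prems(2) al by simp_all
      then show False using Suc.hyps(2) by simp
    qed
    have ne: "al * real j \<noteq> real i" using nonsing[of j] jpos Suc.prems(1)
      by (metis Ints_of_nat One_nat_def Suc_leI)
    \<comment> \<open>The line enters the square either through the left side, coming from the
      square \<open>(j - 1, i)\<close>, or through the bottom side, coming from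
      \<open>(j, i - 1)\<close>; corners are excluded by \<open>ne\<close>.\<close>
    consider "real i < al * real j" | "al * real j < real i" using ne by linarith
    then show ?case
    proof cases
      case 1
      obtain j' where j': "j = Suc j'" using jpos gr0_implies_Suc by blast
      have "(\<Sum>j=1..j'. f j) = (\<Sum>i=1..i. g i) + h j' i - h 0 0"
      proof (rule Suc.hyps(1))
        show "al * real j' < real i + 1" using Suc.prems(3) j' al by (simp add: algebra_simps)
        show "real i < al * (real j' + 1)" using 1 j' by (simp add: add.commute)
      qed (use Suc j' in auto)
      moreover have "h j i - h j' i = f j" using jstep[of j i] 1 Suc.prems(3) j' by simp
      ultimately show ?thesis using j' by simp
    next
      case 2
      have "al * real j > 0" using al jpos by simp
      then have "i > 0" using 2 by (metis gr0I of_nat_0 order_less_asym)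
      then obtain i' where i': "i = Suc i'" using gr0_implies_Suc by blast
      have "(\<Sum>j=1..j. f j) = (\<Sum>i=1..i'. g i) + h j i' - h 0 0"
      proof (rule Suc.hyps(1))
        show "real i' < al * (real j + 1)" using Suc.prems(2) i' by simp
      qed (use Suc 2 i' in auto)
      moreover have "h j i - h j i' = - g i" using istep[of i j] 2 Suc.prems(2) i' by simp
      ultimately show ?thesis using i' by simp
    qed
  qed
  then show ?thesis using cell by blast
qed

lemma ltan_minus: "ltan (- x) = ltan x"
  by (simp add: ltan_def)

lemma ltan_plus_1: "ltan (x + 1) = - ltan x"
proof -
  have "pi * (x + 1) / 2 = pi * x / 2 + pi / 2" by (simp add: field_simps)
  then have "tan (pi * (x + 1) / 2) = - inverse (tan (pi * x / 2))"
    unfolding tan_def by (simp only: sin_add cos_add) simp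
  then show ?thesis unfolding ltan_def by (simp add: ln_inverse)
qed

lemma ltan_plus_nat: "ltan (x + real j) = (-1) ^ j * ltan x"
  by (induction j) (simp_all add: ltan_plus_1[of "x + real _", simplified add.assoc] add.commute[of 1])

lemma ltan_1_minus: "ltan (1 - x) = - ltan x"
  using ltan_plus_1[of "- x"] by (simp add: ltan_minus)

text \<open>Arguments of the boundary functions are signed horizontal distances to the line
  \<open>y = al * x\<close>: from the midpoint of a left side, from the midpoint of a bottom side,
  and from the centre of a square.\<close>

lemma cell_offsets:
  assumes "0 < al"
  shows "\<lbrakk>real i < al * real j; al * real j < real i + 1\<rbrakk>
           \<Longrightarrow> \<bar>real j - (real i + 1 / 2) * (1 / al)\<bar> < (1 / al) / 2"
    and "\<lbrakk>al * real j < real i; real i < al * (real j + 1)\<rbrakk>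
           \<Longrightarrow> \<bar>real j + 1 / 2 - real i * (1 / al)\<bar> < 1 / 2"
    and "\<lbrakk>real i \<le> al * (real j + 1 / 2); al * (real j + 1 / 2) \<le> real i + 1\<rbrakk>
           \<Longrightarrow> \<bar>real j + 1 / 2 - (real i + 1 / 2) * (1 / al)\<bar> \<le> (1 / al) / 2"
  using assms by (simp_all add: abs_less_iff abs_le_iff field_simps)

text \<open>\<open>M\<close> is read off from the height of the line at \<open>N + 1 / 2\<close>,
  which keeps the centre of the last square within \<open>be / 2\<close> of the line. As
  \<open>N\<close> is even, the last boundary term carries the sign plus and is at least
  \<open>Psi_sin be (be / 2)\<close>.\<close>

lemma renormalize_sin:
  assumes al: "0 < al" "al \<le> 1"
    and nonsing: "\<And>j. 1 \<le> j \<Longrightarrow> j \<le> N \<Longrightarrow> al * real j \<notin> \<int>"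
    and M: "real M \<le> al * (real N + 1 / 2)" "al * (real N + 1 / 2) \<le> real M + 1"
    and N: "even N"
  shows "(\<Sum>j=1..N. (-1) ^ j * ln \<bar>2 * sin (pi * (al * real j))\<bar>) \<ge>
         (\<Sum>i=1..M. ltan (real i * (1 / al))) - ln (1 + sqrt 2)"
proof -
  define be where "be = 1 / al"
  have be: "be \<ge> 1" using al by (simp add: be_def)
  \<comment> \<open>A horizontal step flips the sign, as required by the sum in the shift by
    \<open>1 / 2\<close>; a vertical step keeps it, as required by the difference in the shift by
    \<open>be / 2\<close>.\<close>
  define h where "h j i = (-1) ^ j * Psi_sin be (real j + 1 / 2 - (real i + 1 / 2) * be)" for j i :: nat
  have "(\<Sum>j=1..N. (-1) ^ j * ln \<bar>2 * sin (pi * (al * real j))\<bar>) =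
      (\<Sum>i=1..M. ltan (real i * be)) + h N M - h 0 0"
  proof (rule lattice_path_sum[OF al nonsing])
    fix j i :: nat
    assume j: "1 \<le> j" and c: "real i < al * real j" "al * real j < real i + 1"
    define x where "x = real j - (real i + 1 / 2) * be"
    have x: "\<bar>x\<bar> < be / 2" unfolding x_def be_def by (rule cell_offsets(1)[OF al(1) c])
    have "h j i - h (j - 1) i = (-1) ^ j * (Psi_sin be (x + 1 / 2) + Psi_sin be (x - 1 / 2))"
    proof -
      obtain j' where j': "j = Suc j'" using j by (cases j) auto
      have e: "real (Suc j') + 1 / 2 - (real i + 1 / 2) * be = x + 1 / 2"
        "real j' + 1 / 2 - (real i + 1 / 2) * be = x - 1 / 2" by (simp_all add: x_def j')
      show ?thesis unfolding h_def j' diff_Suc_1 e by (simp add: algebra_simps)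
    qed
    also have "\<dots> = (-1) ^ j * ln (2 * cos (pi * (x / be)))"
      by (simp only: Psi_sin_shift_1[OF be x])
    also have "2 * cos (pi * (x / be)) = \<bar>2 * sin (pi * (al * real j))\<bar>"
    proof -
      have v: "\<bar>x / be\<bar> < 1 / 2" using x be by (simp add: abs_less_iff field_simps)
      have e: "pi * (al * real j) = pi * (x / be) + pi / 2 + real i * pi"
        using al by (simp add: x_def be_def field_simps)
      have "sin (pi * (al * real j)) = (-1) ^ i * cos (pi * (x / be))"
        unfolding e by (simp add: sin_add[of _ "real i * pi"]) (simp add: sin_add)
      then show ?thesis using cos_pi_pos[OF v] by (simp add: abs_mult)
    qed
    finally show "h j i - h (j - 1) i = (-1) ^ j * ln \<bar>2 * sin (pi * (al * real j))\<bar>" .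
  next
    fix j i :: nat
    assume i: "1 \<le> i" and c: "al * real j < real i" "real i < al * (real j + 1)"
    define x where "x = real j + 1 / 2 - real i * be"
    have x: "\<bar>x\<bar> < 1 / 2" unfolding x_def be_def by (rule cell_offsets(2)[OF al(1) c])
    have "h j i - h j (i - 1) = - ((-1) ^ j * (Psi_sin be (x + be / 2) - Psi_sin be (x - be / 2)))"
    proof -
      obtain i' where i': "i = Suc i'" using i by (cases i) auto
      have e: "real j + 1 / 2 - (real (Suc i') + 1 / 2) * be = x - be / 2"
        "real j + 1 / 2 - (real i' + 1 / 2) * be = x + be / 2" by (simp_all add: x_def i' algebra_simps)
      show ?thesis unfolding h_def i' diff_Suc_1 e by (simp add: algebra_simps)
    qed
    also have "\<dots> = (-1) ^ j * ltan (1 - (real i * be - real j))"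
      by (simp only: Psi_sin_shift_be[OF be x]) (simp add: x_def algebra_simps)
    also have "\<dots> = - ((-1) ^ j * ltan (real i * be - real j))"
      by (simp only: ltan_1_minus mult_minus_right)
    also have "\<dots> = - ltan (real i * be)"
      using ltan_plus_nat[of "real i * be - real j" j] by simp
    finally show "h j i - h j (i - 1) = - ltan (real i * be)" .
  qed (use M al in \<open>auto simp: algebra_simps\<close>)
  moreover have "h N M \<ge> Psi_sin be (be / 2)"
  proof -
    have "\<bar>real N + 1 / 2 - (real M + 1 / 2) * be\<bar> \<le> be / 2"
      unfolding be_def by (rule cell_offsets(3)[OF al(1) M])
    then show ?thesis unfolding h_def using N be by (auto intro!: Psi_sin_antimono)
  qed
  moreover have "h 0 0 = Psi_sin be ((be - 1) / 2)"
  proof -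
    have "real 0 + 1 / 2 - (real 0 + 1 / 2) * be = - ((be - 1) / 2)" by (simp add: field_simps)
    then show ?thesis unfolding h_def by (simp only: Psi_sin_minus) simp
  qed
  ultimately show ?thesis using Psi_sin_drop[OF be] be_def by simp
qed

lemma Psi_tan_abs_le:
  assumes "be \<ge> 1" "\<bar>x\<bar> \<le> y" "y < (1 + be) / 2"
  shows "\<bar>Psi_tan be x\<bar> \<le> Psi_tan be y"
  using Psi_tan_mono[OF assms(1), of x y] Psi_tan_mono[OF assms(1), of "- y" x] Psi_tan_minus[OF assms(1), of y] assms
  by (auto simp: abs_le_iff)

lemma le_tan:
  assumes "0 \<le> t" "t < pi / 2"
  shows "t \<le> tan (t :: real)"
proof -
  have "tan 0 - 0 \<le> tan t - t"
  proof (rule DERIV_nonneg_imp_nondecreasing[OF assms(1)])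
    fix x assume x: "0 \<le> x" "x \<le> t"
    have c: "cos x > 0" using x assms by (intro cos_gt_zero_pi) auto
    have "((\<lambda>x. tan x - x) has_real_derivative inverse ((cos x)\<^sup>2) - 1) (at x)"
      using c by (auto intro!: derivative_eq_intros)
    moreover have "inverse ((cos x)\<^sup>2) \<ge> 1"
      using c power_le_one[of "cos x" 2] by (intro one_le_inverse) auto
    ultimately show "\<exists>y. ((\<lambda>x. tan x - x) has_real_derivative y) (at x) \<and> 0 \<le> y"
      by (intro exI[of _ "inverse ((cos x)\<^sup>2) - 1"]) simp
  qed
  then show ?thesis by simp
qed

text \<open>With \<open>c = cos (2 * t)\<close> the quotient \<open>tan (3 * t) / tan t\<close> is
  \<open>(2 * c + 1) / (2 * c - 1)\<close>. It decreases in \<open>c\<close> and equals 6 at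
  \<open>c = 7 / 10\<close>, which lies just below \<open>cos (pi / 4)\<close>.\<close>

lemma tan_3_le:
  assumes "0 < t" "t \<le> pi / 8"
  shows "tan (3 * t) \<le> 6 * tan t"
proof -
  have "cos (pi / 4) \<le> cos (2 * t)" using assms by (intro cos_monotone_0_pi_le) auto
  moreover have "7 / 5 \<le> sqrt (2 :: real)" by (rule real_le_rsqrt) (simp add: power2_eq_square)
  ultimately have C: "cos (2 * t) \<ge> 7 / 10" by (simp add: cos_45)
  have c2: "cos (2 * t) = 2 * (cos t)\<^sup>2 - 1" by (rule cos_double_cos)
  have ct: "cos t > 0" "sin t > 0" using assms by (auto intro!: cos_gt_zero sin_gt_zero)
  have c3: "cos (3 * t) = cos t * (2 * cos (2 * t) - 1)"
    unfolding cos_treble_cos c2 by (simp add: power3_eq_cube power2_eq_square algebra_simps)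
  have "sin (3 * t) = sin (2 * t + t)" by simp
  also have "\<dots> = sin t * (2 * cos (2 * t) + 1)"
    unfolding sin_add sin_double c2 by (simp add: power2_eq_square algebra_simps)
  finally have s3: "sin (3 * t) = sin t * (2 * cos (2 * t) + 1)" .
  have "tan (3 * t) = tan t * ((2 * cos (2 * t) + 1) / (2 * cos (2 * t) - 1))"
    unfolding tan_def s3 c3 by simp
  also have "\<dots> \<le> tan t * 6"
    using C ct by (intro mult_left_mono) (auto simp: field_simps tan_def)
  finally show ?thesis by simp
qed

text \<open>The shift equation evaluates only sums of values at distance 1. Two such equations at
  the edge, linked by monotonicity, bound the sum by tangents at \<open>t\<close> and
  \<open>3 * t\<close>. The 8 comes from \<open>6 / t = 24 * be / pi\<close> and
  \<open>pi > 3\<close>.\<close>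

lemma Psi_tan_boundary_bound:
  assumes be: "be \<ge> 2"
  shows "Psi_tan be (be / 2) + Psi_tan be (be / 2 - 1 / 2) \<le> ln (8 * be)"
proof -
  have be1: "be \<ge> 1" using be by simp
  define t where "t = pi / (4 * be)"
  have t: "0 < t" "t \<le> pi / 8" using be by (auto simp: t_def field_simps)
  have "t < pi / 2" "3 * t < pi / 2" using t pi_gt_zero by linarith+
  then have tt: "tan t > 0" "tan (3 * t) > 0" using t by (auto intro!: tan_gt_zero)
  have 1: "Psi_tan be (be / 2) + Psi_tan be (be / 2 - 1) = - ln (tan t)"
  proof -
    have "Psi_tan be ((be - 1) / 2 + 1 / 2) + Psi_tan be ((be - 1) / 2 - 1 / 2) = ltan (1 / 2 + (be - 1) / 2 / be)"
      by (rule Psi_tan_shift_1[OF be1]) (use be in \<open>auto simp: abs_less_iff field_simps\<close>)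
    moreover have "(be - 1) / 2 + 1 / 2 = be / 2" "(be - 1) / 2 - 1 / 2 = be / 2 - 1" by (simp_all add: field_simps)
    moreover have "1 / 2 + (be - 1) / 2 / be = 1 - 1 / (2 * be)" using be by (simp add: field_simps)
    ultimately show ?thesis using tt by (simp add: ltan_1_minus) (simp add: ltan_def t_def)
  qed
  have 2: "Psi_tan be (be / 2 - 1) + Psi_tan be (be / 2 - 2) = - ln (tan (3 * t))"
  proof -
    have "Psi_tan be ((be - 3) / 2 + 1 / 2) + Psi_tan be ((be - 3) / 2 - 1 / 2) = ltan (1 / 2 + (be - 3) / 2 / be)"
      by (rule Psi_tan_shift_1[OF be1]) (use be in \<open>auto simp: abs_less_iff field_simps\<close>)
    moreover have "(be - 3) / 2 + 1 / 2 = be / 2 - 1" "(be - 3) / 2 - 1 / 2 = be / 2 - 2" by (simp_all add: field_simps)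
    moreover have "1 / 2 + (be - 3) / 2 / be = 1 - 3 / (2 * be)" using be by (simp add: field_simps)
    moreover have "pi * (3 / (2 * be)) / 2 = 3 * t" by (simp add: t_def)
    ultimately show ?thesis using tt by (simp add: ltan_1_minus) (simp add: ltan_def)
  qed
  have "Psi_tan be (be / 2 - 1 / 2) \<le> Psi_tan be (be / 2)" "Psi_tan be (be / 2 - 2) \<le> Psi_tan be (be / 2 - 1)"
    by (rule Psi_tan_mono[OF be1]; use be in \<open>auto simp: abs_less_iff field_simps\<close>)+
  then have "Psi_tan be (be / 2) + Psi_tan be (be / 2 - 1 / 2) \<le> - ln (tan t) + (ln (tan (3 * t)) - ln (tan t))"
    using 1 2 by linarith
  also have "ln (tan (3 * t)) \<le> ln 6 + ln (tan t)"
    using tan_3_le[OF t] tt by (metis ln_le_cancel_iff ln_mult_pos mult_pos_pos zero_less_numeral)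
  also have "- ln (tan t) + (ln 6 + ln (tan t) - ln (tan t)) = ln 6 - ln (tan t)" by simp
  also have "\<dots> \<le> ln 6 - ln t"
  proof -
    have "t \<le> tan t" using t \<open>t < pi / 2\<close> by (intro le_tan) auto
    then show ?thesis using t tt by simp
  qed
  also have "\<dots> = ln (6 / t)" using t by (simp add: ln_div)
  also have "\<dots> \<le> ln (8 * be)"
  proof -
    have "6 / t = 24 * be / pi" by (simp add: t_def)
    also have "\<dots> \<le> 24 * be / 3" using be pi_gt3 by (intro divide_left_mono) auto
    finally show ?thesis using t be by simp
  qed
  finally show ?thesis by simp
qed

text \<open>The condition \<open>al \<le> 1 / 2\<close> means \<open>be \<ge> 2\<close>, the range
  of the edge bound. Both boundary terms are controlled in absolute value, so the estimate is
  two-sided and can be iterated.\<close>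

lemma renormalize_tan:
  assumes al: "0 < al" "al \<le> 1 / 2"
    and nonsing: "\<And>j. 1 \<le> j \<Longrightarrow> j \<le> N \<Longrightarrow> al * real j \<notin> \<int>"
    and M: "real M \<le> al * (real N + 1 / 2)" "al * (real N + 1 / 2) \<le> real M + 1"
  shows "\<bar>\<Sum>j=1..N. (-1) ^ j * ltan (al * real j)\<bar> \<le>
         \<bar>\<Sum>i=1..M. (-1) ^ i * ltan (real i * (1 / al))\<bar> + ln (8 / al)"
proof -
  define be where "be = 1 / al"
  have be: "be \<ge> 1" "be \<ge> 2" using al by (simp_all add: be_def field_simps)
  \<comment> \<open>Both shift equations of \<open>Psi_tan\<close> are sums, so both kinds of step
    must flip the sign.\<close>
  define h where "h j i = (-1) ^ (i + j) * Psi_tan be (real j + 1 / 2 - (real i + 1 / 2) * be)" for j i :: nat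
  have al1: "al \<le> 1" using al by simp
  have "(\<Sum>j=1..N. (-1) ^ j * ltan (al * real j)) =
      (\<Sum>i=1..M. (-1) ^ i * ltan (real i * be)) + h N M - h 0 0"
  proof (rule lattice_path_sum[OF al(1) al1 nonsing])
    fix j i :: nat
    assume j: "1 \<le> j" and c: "real i < al * real j" "al * real j < real i + 1"
    define x where "x = real j - (real i + 1 / 2) * be"
    have x: "\<bar>x\<bar> < be / 2" unfolding x_def be_def by (rule cell_offsets(1)[OF al(1) c])
    have "h j i - h (j - 1) i = (-1) ^ (i + j) * (Psi_tan be (x + 1 / 2) + Psi_tan be (x - 1 / 2))"
    proof -
      obtain j' where j': "j = Suc j'" using j by (cases j) auto
      have e: "real (Suc j') + 1 / 2 - (real i + 1 / 2) * be = x + 1 / 2"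
        "real j' + 1 / 2 - (real i + 1 / 2) * be = x - 1 / 2" by (simp_all add: x_def j')
      show ?thesis unfolding h_def j' diff_Suc_1 e by (simp add: algebra_simps)
    qed
    also have "\<dots> = (-1) ^ (i + j) * ltan (1 / 2 + x / be)"
      by (simp only: Psi_tan_shift_1[OF be(1) x])
    also have "1 / 2 + x / be = al * real j - real i"
      using al by (simp add: x_def be_def field_simps)
    also have "(-1) ^ (i + j) * ltan (al * real j - real i) = (-1) ^ j * ltan (al * real j)"
      using ltan_plus_nat[of "al * real j - real i" i] by (simp add: power_add)
    finally show "h j i - h (j - 1) i = (-1) ^ j * ltan (al * real j)" .
  next
    fix j i :: nat
    assume i: "1 \<le> i" and c: "al * real j < real i" "real i < al * (real j + 1)"
    define x where "x = real j + 1 / 2 - real i * be"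
    have x: "\<bar>x\<bar> < 1 / 2" unfolding x_def be_def by (rule cell_offsets(2)[OF al(1) c])
    have "h j i - h j (i - 1) = (-1) ^ (i + j) * (Psi_tan be (x + be / 2) + Psi_tan be (x - be / 2))"
    proof -
      obtain i' where i': "i = Suc i'" using i by (cases i) auto
      have e: "real j + 1 / 2 - (real (Suc i') + 1 / 2) * be = x - be / 2"
        "real j + 1 / 2 - (real i' + 1 / 2) * be = x + be / 2" by (simp_all add: x_def i' algebra_simps)
      show ?thesis unfolding h_def i' diff_Suc_1 e by (simp add: algebra_simps)
    qed
    also have "\<dots> = (-1) ^ (i + j) * ltan (1 - (real i * be - real j))"
      by (simp only: Psi_tan_shift_be[OF be(1) x]) (simp add: x_def algebra_simps)
    also have "\<dots> = - ((-1) ^ (i + j) * ltan (real i * be - real j))"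
      by (simp only: ltan_1_minus mult_minus_right)
    also have "\<dots> = - ((-1) ^ i * ltan (real i * be))"
      using ltan_plus_nat[of "real i * be - real j" j] by (simp add: power_add)
    finally show "h j i - h j (i - 1) = - ((-1) ^ i * ltan (real i * be))" .
  qed (use M al in \<open>auto simp: algebra_simps\<close>)
  moreover have "\<bar>h N M\<bar> \<le> Psi_tan be (be / 2)"
  proof -
    have "\<bar>real N + 1 / 2 - (real M + 1 / 2) * be\<bar> \<le> be / 2"
      unfolding be_def by (rule cell_offsets(3)[OF al(1) M])
    then show ?thesis unfolding h_def using be by (auto simp: abs_mult intro!: Psi_tan_abs_le)
  qed
  moreover have "\<bar>h 0 0\<bar> \<le> Psi_tan be (be / 2 - 1 / 2)"
  proof -
    have "\<bar>Psi_tan be (real 0 + 1 / 2 - (real 0 + 1 / 2) * be)\<bar> \<le> Psi_tan be (be / 2 - 1 / 2)"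
      by (rule Psi_tan_abs_le) (use be in \<open>auto simp: abs_le_iff\<close>)
    then show ?thesis by (simp add: h_def)
  qed
  moreover have "ln (8 / al) = ln (8 * be)" by (simp add: be_def)
  ultimately show ?thesis using Psi_tan_boundary_bound[OF be(2)] unfolding be_def[symmetric] by linarith
qed

section \<open>Continued fractions and iteration of the renormalization\<close>

lemma not_Ints_below_denominator:
  assumes "coprime p q" "1 \<le> j" "j < q"
  shows "real p / real q * real j \<notin> \<int>"
proof
  assume "real p / real q * real j \<in> \<int>"
  then obtain k :: int where "real p / real q * real j = of_int k" by (rule Ints_cases)
  then have "real p * real j = of_int k * real q" using assms by (simp add: field_simps)
  then have "int p * int j = k * int q"
    by (metis of_int_eq_iff of_int_mult of_int_of_nat_eq)
  then have "int q dvd int p * int j" by simp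
  then have "q dvd p * j" by (metis of_nat_dvd_iff of_nat_mult)
  then have "q dvd j" using assms(1) by (metis coprime_commute coprime_dvd_mult_right_iff)
  then show False using assms dvd_imp_le by fastforce
qed

text \<open>Continuants evaluated from the front: the numerator of \<open>a # as\<close> is the
  denominator of \<open>as\<close>. Removing the head is thus exactly one renormalization step, in
  which \<open>p\<close> becomes the new denominator.\<close>

fun cf_num :: "nat list \<Rightarrow> nat" and cf_den :: "nat list \<Rightarrow> nat" where
  "cf_num [] = 0"
| "cf_num (a # as) = cf_den as"
| "cf_den [] = 1"
| "cf_den (a # as) = a * cf_den as + cf_num as"

lemma cf_pos: "(\<And>a. a \<in> set as \<Longrightarrow> a > 0) \<Longrightarrow> cf_den as > 0"
  by (induction as) auto

lemma cf_coprime: "coprime (cf_num as) (cf_den as)"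
proof (induction as)
  case (Cons a as)
  have "gcd (cf_den as) (a * cf_den as + cf_num as) = gcd (cf_den as) (cf_num as)"
    by (metis add.commute gcd_add_mult mult.commute)
  then show ?case using Cons by (simp add: coprime_iff_gcd_eq_1 gcd.commute)
qed simp

lemma cfrac_cf:
  assumes "\<And>a. a \<in> set as \<Longrightarrow> a > 0"
  shows "cfrac as = real (cf_num as) / real (cf_den as)"
  using assms
proof (induction as)
  case (Cons a as)
  have "cf_den as > 0" using Cons.prems by (intro cf_pos) auto
  then have "real a + real (cf_num as) / real (cf_den as) = real (cf_den (a # as)) / real (cf_den as)"
    by (simp add: field_simps)
  then show ?case using Cons by simp
qed simp

lemma cf_den_ge_power:
  assumes "\<And>a. a \<in> set as \<Longrightarrow> a \<ge> 2"
  shows "cf_den as \<ge> 2 ^ length as"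
  using assms
proof (induction as)
  case (Cons a as)
  have "2 * 2 ^ length as \<le> a * cf_den as" using Cons by (intro mult_mono) auto
  then show ?case by simp
qed simp

lemma cf_num_le_den:
  assumes "\<And>a. a \<in> set as \<Longrightarrow> a > 0"
  shows "cf_num as \<le> cf_den as"
proof (cases as)
  case (Cons a bs)
  then have "1 * cf_den bs \<le> a * cf_den bs" using assms[of a] by (intro mult_right_mono) auto
  then show ?thesis unfolding Cons cf_num.simps cf_den.simps by linarith
qed simp

lemma lowest_terms_cf:
  assumes "lowest_terms p q (cfrac as)" "\<And>a. a \<in> set as \<Longrightarrow> a > 0"
  shows "p = cf_num as" "q = cf_den as"
proof -
  have q: "q > 0" "coprime p q" "cfrac as = real p / real q"
    using assms(1) by (auto simp: lowest_terms_def)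
  have d: "cf_den as > 0" using assms(2) by (rule cf_pos)
  have "real p * real (cf_den as) = real (cf_num as) * real q"
    using q d cfrac_cf[OF assms(2)] by (simp add: field_simps)
  then have eq: "p * cf_den as = cf_num as * q" by (metis of_nat_eq_iff of_nat_mult)
  have "q dvd cf_den as" using eq q(2)
    by (metis coprime_commute coprime_dvd_mult_right_iff dvd_triv_right)
  moreover have "cf_den as dvd q" using eq cf_coprime[of as]
    by (metis coprime_commute coprime_dvd_mult_right_iff dvd_triv_right)
  ultimately show "q = cf_den as" by (rule dvd_antisym)
  with eq d show "p = cf_num as" by simp
qed

text \<open>The witness is the floor of the height at \<open>N + 1 / 2\<close>. Because
  \<open>N + 1 / 2 < q\<close>, it is below the new denominator \<open>p\<close>, which keeps the
  iteration going.\<close>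

lemma renormalized_length:
  assumes "p > 0" "q > 0" "N < q" "p \<le> q"
  obtains M :: nat where "real M \<le> real p / real q * (real N + 1 / 2)"
    "real p / real q * (real N + 1 / 2) \<le> real M + 1" "M < p"
proof
  define x where "x = real p / real q * (real N + 1 / 2)"
  have x0: "x \<ge> 0" by (simp add: x_def)
  then show 1: "real (nat \<lfloor>x\<rfloor>) \<le> real p / real q * (real N + 1 / 2)"
    "real p / real q * (real N + 1 / 2) \<le> real (nat \<lfloor>x\<rfloor>) + 1"
    unfolding x_def[symmetric] by simp_all
  have "x < real p"
    using assms unfolding x_def by (simp add: divide_less_eq)
  then show "nat \<lfloor>x\<rfloor> < p" using x0 by (simp add: nat_less_iff floor_less_iff)
qed

lemma ltan_even_shift:
  assumes "even a"
  shows "ltan (real i * (real a + y)) = ltan (y * real i)"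
  using ltan_plus_nat[of "real i * y" "i * a"] assms by (simp add: algebra_simps)

lemma ltan_odd_shift:
  assumes "odd a"
  shows "ltan (real i * (real a + y)) = (-1) ^ i * ltan (y * real i)"
proof -
  have "(-1 :: real) ^ (i * a) = (-1) ^ i" using assms
    by (metis minus_one_power_iff even_mult_iff)
  then show ?thesis using ltan_plus_nat[of "real i * y" "i * a"] by (simp add: algebra_simps)
qed

text \<open>A step contributes \<open>ln 8 + ln q - ln p\<close> for consecutive denominators: the
  logarithms telescope, while \<open>ln 8\<close> is paid once per partial quotient.\<close>

lemma ltan_sum_bound:
  assumes "\<And>a. a \<in> set as \<Longrightarrow> a > 0 \<and> even a" "N < cf_den as"
  shows "\<bar>\<Sum>j=1..N. (-1) ^ j * ltan (cfrac as * real j)\<bar> \<le> real (length as) * ln 8 + ln (real (cf_den as))"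
  using assms
proof (induction as arbitrary: N)
  case (Cons a as)
  define p q where "p = cf_den as" and "q = cf_den (a # as)"
  have pos: "p > 0" "q > 0" using Cons.prems unfolding p_def q_def by (auto intro!: cf_pos simp del: cf_den.simps)
  have al: "cfrac (a # as) = real p / real q"
    using cfrac_cf[of "a # as"] Cons.prems by (simp add: p_def q_def)
  have a2: "a \<ge> 2" using Cons.prems(1)[of a] by (auto elim!: evenE)
  have "2 * p \<le> a * p" using a2 by simp
  then have pq: "2 * p \<le> q" unfolding p_def q_def cf_den.simps by linarith
  have be: "1 / cfrac (a # as) = real a + cfrac as" by simp
  have cop: "coprime p q" using cf_coprime[of "a # as"] by (simp add: p_def q_def)
  obtain M where M: "real M \<le> real p / real q * (real N + 1 / 2)"
    "real p / real q * (real N + 1 / 2) \<le> real M + 1" "M < p"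
    using renormalized_length[of p q N] pos pq Cons.prems(2) by (auto simp: q_def)
  have "\<bar>\<Sum>j=1..N. (-1) ^ j * ltan (real p / real q * real j)\<bar>
      \<le> \<bar>\<Sum>i=1..M. (-1) ^ i * ltan (real i * (1 / (real p / real q)))\<bar> + ln (8 / (real p / real q))"
  proof (rule renormalize_tan)
    show "real p / real q * real j \<notin> \<int>" if "1 \<le> j" "j \<le> N" for j
      using that Cons.prems(2) by (intro not_Ints_below_denominator[OF cop]) (auto simp: q_def)
    show "real p / real q \<le> 1 / 2"
    proof -
      have "real (2 * p) \<le> real q" using pq by (rule of_nat_mono)
      then show ?thesis using pos by (simp add: field_simps)
    qed
  qed (use M pos in auto)
  also have "(\<Sum>i=1..M. (-1) ^ i * ltan (real i * (1 / (real p / real q)))) =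
      (\<Sum>i=1..M. (-1) ^ i * ltan (cfrac as * real i))"
    unfolding al[symmetric] be using Cons.prems(1)[of a] by (intro sum.cong) (auto simp: ltan_even_shift)
  also have "\<bar>\<dots>\<bar> \<le> real (length as) * ln 8 + ln (real p)"
    using Cons.IH[of M] Cons.prems(1) M(3) by (auto simp: p_def)
  also have "ln (8 / (real p / real q)) = ln 8 + ln (real q) - ln (real p)"
    using pos by (simp add: ln_div ln_mult)
  finally show ?case unfolding al q_def[symmetric] by (simp add: algebra_simps)
qed simp

text \<open>The odd head restores the alternating sign that the sine step removed, so the tangent
  bound applies to the tail. Its denominator \<open>cf_den as\<close> is the numerator of the whole
  fraction.\<close>

lemma sin_sum_lower_bound:
  assumes "odd a" "\<And>b. b \<in> set as \<Longrightarrow> b > 0 \<and> even b" "even N" "N < cf_den (a # as)"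
  shows "(\<Sum>j=1..N. (-1) ^ j * ln \<bar>2 * sin (pi * (cfrac (a # as) * real j))\<bar>) \<ge>
     - (ln (1 + sqrt 2) + real (length as) * ln 8 + ln (real (cf_den as)))"
proof -
  define p q where "p = cf_den as" and "q = cf_den (a # as)"
  have a: "a > 0" using assms(1) by (rule odd_pos)
  have pos: "p > 0" "q > 0" using assms a unfolding p_def q_def by (auto intro!: cf_pos simp del: cf_den.simps)
  have al: "cfrac (a # as) = real p / real q"
    unfolding p_def q_def cf_num.simps(2)[of a as, symmetric]
    by (rule cfrac_cf) (use assms a in \<open>auto simp del: cf_num.simps cf_den.simps\<close>)
  have pq: "p \<le> q" unfolding p_def q_def cf_num.simps(2)[of a as, symmetric]
    by (rule cf_num_le_den) (use assms a in \<open>auto simp del: cf_num.simps cf_den.simps\<close>)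
  have be: "1 / cfrac (a # as) = real a + cfrac as" by simp
  have cop: "coprime p q" using cf_coprime[of "a # as"] by (simp add: p_def q_def)
  obtain M where M: "real M \<le> real p / real q * (real N + 1 / 2)"
    "real p / real q * (real N + 1 / 2) \<le> real M + 1" "M < p"
    using renormalized_length[of p q N] pos pq assms(4) by (auto simp: q_def)
  have "(\<Sum>j=1..N. (-1) ^ j * ln \<bar>2 * sin (pi * (real p / real q * real j))\<bar>) \<ge>
      (\<Sum>i=1..M. ltan (real i * (1 / (real p / real q)))) - ln (1 + sqrt 2)"
  proof (rule renormalize_sin)
    show "real p / real q * real j \<notin> \<int>" if "1 \<le> j" "j \<le> N" for j
      using that assms(4) by (intro not_Ints_below_denominator[OF cop]) (auto simp: q_def)
  qed (use M pos pq assms in auto)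
  moreover have "(\<Sum>i=1..M. ltan (real i * (1 / (real p / real q)))) =
      (\<Sum>i=1..M. (-1) ^ i * ltan (cfrac as * real i))"
    unfolding al[symmetric] be using assms(1) by (intro sum.cong) (auto simp: ltan_odd_shift)
  moreover have "\<bar>\<Sum>i=1..M. (-1) ^ i * ltan (cfrac as * real i)\<bar> \<le> real (length as) * ln 8 + ln (real p)"
    using ltan_sum_bound[of as M] assms(2) M(3) by (auto simp: p_def)
  ultimately show ?thesis unfolding al p_def[symmetric] by linarith
qed

section \<open>Transfer matrices and the Chambers formula\<close>

text \<open>Two by two matrices as quadruples over any commutative ring, so that numbers and
  polynomials in the energy or in the phase are treated alike.\<close>

fun mult2 :: "'a::comm_ring_1 \<times> 'a \<times> 'a \<times> 'a \<Rightarrow> 'a \<times> 'a \<times> 'a \<times> 'a \<Rightarrow> 'a \<times> 'a \<times> 'a \<times> 'a" where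
  "mult2 (a, b, c, d) (e, f, g, h) = (a * e + b * g, a * f + b * h, c * e + d * g, c * f + d * h)"

fun trace2 :: "'a::comm_ring_1 \<times> 'a \<times> 'a \<times> 'a \<Rightarrow> 'a" where
  "trace2 (a, b, c, d) = a + d"

fun det2 :: "'a::comm_ring_1 \<times> 'a \<times> 'a \<times> 'a \<Rightarrow> 'a" where
  "det2 (a, b, c, d) = a * d - b * c"

text \<open>Genuine transfer matrices have \<open>y = 1\<close>. The component is carried along so
  that a factor can be multiplied by a scalar, which clears denominators in the phase.\<close>

fun transfer :: "('a::comm_ring_1 \<times> 'a) list \<Rightarrow> 'a \<times> 'a \<times> 'a \<times> 'a" where
  "transfer [] = (1, 0, 0, 1)"
| "transfer ((x, y) # l) = mult2 (x, - y, y, 0) (transfer l)"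

lemma mult2_assoc: "mult2 (mult2 A B) C = mult2 A (mult2 B C)"
  by (cases A; cases B; cases C) (simp add: algebra_simps)

lemma mult2_one: "mult2 (1, 0, 0, 1) A = A"
  by (cases A) simp

lemma trace2_commute: "trace2 (mult2 A B) = trace2 (mult2 B A)"
  by (cases A; cases B) (simp add: algebra_simps)

lemma det2_mult2: "det2 (mult2 A B) = det2 A * det2 B"
  by (cases A; cases B) (simp add: algebra_simps)

lemma transfer_append: "transfer (l @ m) = mult2 (transfer l) (transfer m)"
  by (induction l rule: transfer.induct) (simp_all only: append_Nil append_Cons transfer.simps mult2_one mult2_assoc)

lemma det2_transfer: "det2 (transfer (map (\<lambda>j. (f j, 1)) js)) = 1"
  by (induction js) (simp_all only: list.map transfer.simps det2_mult2, simp_all)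

lemma transfer_hom:
  assumes "\<And>a b. f (a + b) = f a + f b" "\<And>a b. f (a * b) = f a * f b" "f 1 = 1" "f 0 = 0" "\<And>a. f (- a) = - f a"
    and "transfer l = (a, b, c, d)"
  shows "transfer (map (\<lambda>(x, y). (f x, f y)) l) = (f a, f b, f c, f d)"
  using assms(6)
proof (induction l arbitrary: a b c d rule: transfer.induct)
  case (2 x y l)
  obtain a' b' c' d' where t: "transfer l = (a', b', c', d')" by (metis prod.exhaust)
  have fd: "f (u - v) = f u - f v" for u v using assms(1)[of u "- v"] assms(5) by simp
  have "a = x * a' - y * c'" "b = x * b' - y * d'" "c = y * a'" "d = y * b'" using 2(2) t by auto
  then show ?case using 2(1)[OF t] assms(2,4,5) by (simp add: fd)
qed (use assms in auto)

lemma trace2_transfer_hom: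
  assumes "\<And>a b. f (a + b) = f a + f b" "\<And>a b. f (a * b) = f a * f b" "f 1 = 1" "f 0 = 0" "\<And>a. f (- a) = - f a"
  shows "trace2 (transfer (map (\<lambda>(x, y). (f x, f y)) l)) = f (trace2 (transfer l))"
proof -
  obtain a b c d where t: "transfer l = (a, b, c, d)" by (metis prod.exhaust)
  show ?thesis using transfer_hom[of f l, OF assms t] t assms(1) by simp
qed

lemma transfer_scale:
  assumes "transfer l = (a, b, c, d)"
  shows "transfer (map (\<lambda>(x, y). (w * x, w * y)) l) =
      (w ^ length l * a, w ^ length l * b, w ^ length l * c, w ^ length l * d)"
  using assms
proof (induction l arbitrary: a b c d rule: transfer.induct)
  case (2 x y l)
  obtain a' b' c' d' where t: "transfer l = (a', b', c', d')" by (metis prod.exhaust)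
  have e: "a = x * a' - y * c'" "b = x * b' - y * d'" "c = y * a'" "d = y * b'" using 2(2) t by auto
  show ?case unfolding e using 2(1)[OF t] by (simp add: algebra_simps)
qed auto

lemma trace2_transfer_scale:
  "trace2 (transfer (map (\<lambda>(x, y). (w * x, w * y)) l)) = w ^ length l * trace2 (transfer l)"
proof -
  obtain a b c d where t: "transfer l = (a, b, c, d)" by (metis prod.exhaust)
  show ?thesis using transfer_scale[OF t, of w] t by (simp add: algebra_simps)
qed

lemma transfer_degree:
  assumes "\<And>x y. (x, y) \<in> set l \<Longrightarrow> degree x \<le> 2 \<and> degree y \<le> 2" "transfer l = (a, b, c, d)"
  shows "degree a \<le> 2 * length l \<and> degree b \<le> 2 * length l \<and> degree c \<le> 2 * length l \<and> degree d \<le> 2 * length l"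
  using assms
proof (induction l arbitrary: a b c d rule: transfer.induct)
  case (2 x y l)
  obtain a' b' c' d' where t: "transfer l = (a', b', c', d')" by (metis prod.exhaust)
  have IH: "degree a' \<le> 2 * length l" "degree b' \<le> 2 * length l" "degree c' \<le> 2 * length l" "degree d' \<le> 2 * length l"
    using 2(1)[OF 2(2) t] by auto
  have xy: "degree x \<le> 2" "degree y \<le> 2" using 2(2) by auto
  have *: "degree (u * v) \<le> Suc (Suc (2 * length l))" if "degree u \<le> 2" "degree v \<le> 2 * length l" for u v :: "'a poly"
    using degree_mult_le[of u v] that by simp
  show ?case using 2(3) t xy IH by (auto intro!: degree_diff_le *)
qed (use assms in auto)

text \<open>On the unit circle the potential is a cosine; \<open>w\<close> ranges over the complex
  numbers so that the dependence on the phase becomes algebraic.\<close>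

definition bloch_trace :: "complex \<Rightarrow> nat \<Rightarrow> complex \<Rightarrow> complex \<Rightarrow> complex" where
  "bloch_trace om q E w = trace2 (transfer (map (\<lambda>j. (E - (w * om ^ j + 1 / (w * om ^ j)), 1)) [1..<Suc q]))"

text \<open>Replacing \<open>w\<close> by \<open>w * om\<close> rotates the factors cyclically,
  which leaves the trace unchanged.\<close>

lemma bloch_trace_shift:
  assumes "om ^ q = 1"
  shows "bloch_trace om q E (w * om) = bloch_trace om q E w"
proof (cases q)
  case (Suc m)
  define g where "g j = (E - (w * om ^ j + 1 / (w * om ^ j)), 1 :: complex)" for j
  have "map (\<lambda>j. (E - (w * om * om ^ j + 1 / (w * om * om ^ j)), 1)) [1..<Suc q] = map (\<lambda>j. g (Suc j)) [1..<Suc q]"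
    by (simp add: g_def mult_ac)
  also have "\<dots> = map g [2..<Suc (Suc q)]"
    by (metis (no_types, lifting) Suc_1 map_Suc_upt map_map comp_apply map_eq_conv)
  also have "\<dots> = map g [2..<Suc q] @ [g 1]"
    using Suc assms by (simp add: g_def)
  finally have "bloch_trace om q E (w * om) = trace2 (mult2 (transfer (map g [2..<Suc q])) (transfer [g 1]))"
    by (simp only: bloch_trace_def transfer_append)
  also have "\<dots> = trace2 (mult2 (transfer [g 1]) (transfer (map g [2..<Suc q])))"
    by (rule trace2_commute)
  also have "\<dots> = trace2 (transfer (map g [1..<Suc q]))"
  proof -
    have "[1..<Suc q] = [1] @ [2..<Suc q]" using Suc by (simp add: upt_conv_Cons numeral_2_eq_2 del: upt_Suc)
    then show ?thesis by (simp only: transfer_append[symmetric] map_append list.map)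
  qed
  also have "\<dots> = bloch_trace om q E w" by (simp only: bloch_trace_def g_def [abs_def])
  finally show ?thesis .
qed (simp add: bloch_trace_def)

text \<open>
  Multiplying every factor by \<open>w\<close> turns the trace into a polynomial in \<open>w\<close>. It is invariant under
  \<open>w \<mapsto> w * om\<close>, so only the coefficients of $1$, $w^q$ and $w^{2q}$ survive.
\<close>

definition bloch_poly :: "complex \<Rightarrow> nat \<Rightarrow> complex \<Rightarrow> complex poly" where
  "bloch_poly om q E = trace2 (transfer (map (\<lambda>j. ([:- (1 / om ^ j), E, - (om ^ j):], [:0, 1:])) [1..<Suc q]))"

lemma poly_bloch_poly:
  assumes "w \<noteq> 0" "om \<noteq> 0"
  shows "poly (bloch_poly om q E) w = w ^ q * bloch_trace om q E w"
proof -
  have "poly (bloch_poly om q E) w =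
    trace2 (transfer (map (\<lambda>j. (poly [:- (1 / om ^ j), E, - (om ^ j):] w, poly [:0, 1:] w)) [1..<Suc q]))"
    unfolding bloch_poly_def
    by (subst trace2_transfer_hom[symmetric, where f = "\<lambda>p. poly p w"]) (simp_all add: o_def case_prod_unfold)
  also have "(\<lambda>j. (poly [:- (1 / om ^ j), E, - (om ^ j):] w, poly [:0, 1:] w)) =
      (\<lambda>j. (w * (E - (w * om ^ j + 1 / (w * om ^ j))), w * 1))"
  proof
    fix j
    have "w * (E - (w * om ^ j + 1 / (w * om ^ j))) = w * E - w * (w * om ^ j) - 1 / om ^ j"
      using assms by (simp add: right_diff_distrib distrib_left)
    then show "(poly [:- (1 / om ^ j), E, - (om ^ j):] w, poly [:0, 1:] w) =
        (w * (E - (w * om ^ j + 1 / (w * om ^ j))), w * 1)"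
      by (simp add: algebra_simps)
  qed
  also have "trace2 (transfer (map \<dots> [1..<Suc q])) = trace2 (transfer (map (\<lambda>(x, y). (w * x, w * y))
      (map (\<lambda>j. (E - (w * om ^ j + 1 / (w * om ^ j)), 1)) [1..<Suc q])))"
    by (simp add: o_def del: upt_Suc)
  also have "\<dots> = w ^ q * bloch_trace om q E w"
    unfolding trace2_transfer_scale bloch_trace_def by (simp del: upt_Suc)
  finally show ?thesis .
qed

lemma degree_bloch_poly: "degree (bloch_poly om q E) \<le> 2 * q"
proof -
  define l where "l = map (\<lambda>j. ([:- (1 / om ^ j), E, - (om ^ j):], [:0, 1:] :: complex poly)) [1..<Suc q]"
  obtain a b c d where t: "transfer l = (a, b, c, d)" by (metis prod.exhaust)
  have "degree a \<le> 2 * length l \<and> degree b \<le> 2 * length l \<and> degree c \<le> 2 * length l \<and> degree d \<le> 2 * length l"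
    by (rule transfer_degree[OF _ t]) (auto simp: l_def)
  moreover have "length l = q" by (simp add: l_def)
  ultimately show ?thesis unfolding bloch_poly_def l_def[symmetric] t by (auto intro!: degree_add_le)
qed

lemma prod_powers_root_of_unity:
  fixes om :: complex
  assumes "om ^ q = 1" "odd q"
  shows "(\<Prod>j=1..q. om ^ j) = 1"
proof -
  have "(\<Prod>j=1..q. om ^ j) = om ^ (\<Sum>j=1..q. j)" by (rule power_sum[symmetric])
  also have "(\<Sum>j=1..q. j) = q * ((q + 1) div 2)"
    using gauss_sum_from_Suc_0[of q, where 'a = nat] assms by (auto elim!: oddE)
  also have "om ^ (q * ((q + 1) div 2)) = 1" by (simp only: power_mult assms(1)) simp
  finally show ?thesis .
qed

text \<open>At \<open>w = 0\<close> every factor has a single nonzero entry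
  \<open>- (1 / om ^ j)\<close>, on the diagonal, so the trace is the product of these entries.
  Oddness of \<open>q\<close> yields the sign and makes the product of the powers of
  \<open>om\<close> equal to 1.\<close>

lemma bloch_poly_0:
  assumes "om ^ q = 1" "odd q"
  shows "poly (bloch_poly om q E) 0 = - 1"
proof -
  have "transfer (map (\<lambda>j. (f j, 0)) js) = (prod_list (map f js), 0, 0, if js = [] then 1 else 0)" for f :: "nat \<Rightarrow> complex" and js
    by (induction js) auto
  moreover have "poly (bloch_poly om q E) 0 =
    trace2 (transfer (map (\<lambda>j. (- (1 / om ^ j), 0)) [1..<Suc q]))"
    unfolding bloch_poly_def
    by (subst trace2_transfer_hom[symmetric, where f = "\<lambda>p. poly p 0"]) (simp_all add: o_def case_prod_unfold)
  ultimately have "poly (bloch_poly om q E) 0 = prod_list (map (\<lambda>j. - (1 / om ^ j)) [1..<Suc q])"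
    using assms by (auto elim!: oddE)
  also have "\<dots> = (\<Prod>j=1..q. - (1 / om ^ j))"
    by (simp add: prod.distinct_set_conv_list[symmetric] atLeastLessThanSuc_atLeastAtMost del: upt_Suc)
  also have "\<dots> = (-1) ^ q / (\<Prod>j=1..q. om ^ j)"
    by (simp only: prod_uminus prod_dividef) simp
  also have "\<dots> = - 1" using prod_powers_root_of_unity[OF assms] assms by simp
  finally show ?thesis .
qed

lemma bloch_trace_form:
  assumes om: "om ^ q = 1" "\<And>k. 0 < k \<Longrightarrow> k < q \<Longrightarrow> om ^ k \<noteq> 1" and q: "odd q"
  shows "\<exists>c d. \<forall>w. w \<noteq> 0 \<longrightarrow> bloch_trace om q E w = c - 1 / w ^ q + d * w ^ q"
proof -
  have om0: "om \<noteq> 0" using om(1) q by (metis power_0_left odd_pos zero_neq_one less_numeral_extra(3))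
  have q0: "q > 0" using q by (rule odd_pos)
  define P where "P = bloch_poly om q E"
  have "pcompose P [:0, om:] = P"
  proof (rule poly_eqI_degree)
    fix w
    show "poly (pcompose P [:0, om:]) w = poly P w"
    proof (cases "w = 0")
      case False
      then show ?thesis using poly_bloch_poly[of w om q E] poly_bloch_poly[of "w * om" om q E] om0
          bloch_trace_shift[OF om(1), of E w] om(1)
        by (simp add: P_def poly_pcompose power_mult_distrib)
    qed (simp add: poly_pcompose)
  next
    show "card (of_nat ` {..degree P + degree (pcompose P [:0, om:])} :: complex set) > degree (pcompose P [:0, om:])"
      "card (of_nat ` {..degree P + degree (pcompose P [:0, om:])} :: complex set) > degree P"
      by (simp_all add: card_image)
  qed
  then have inv: "om ^ k * coeff P k = coeff P k" for k
    by (metis coeff_pcompose_linear)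
  have zero: "coeff P k = 0" if "k \<le> 2 * q" "k \<notin> {0, q, 2 * q}" for k
  proof -
    have "om ^ k = om ^ (q * (k div q) + k mod q)" by simp
    also have "\<dots> = om ^ (k mod q)" by (simp only: power_add power_mult om(1)) simp
    finally have "om ^ k = om ^ (k mod q)" .
    moreover have "k mod q > 0"
    proof (rule ccontr)
      assume "\<not> k mod q > 0"
      then obtain m where m: "k = q * m" by (metis gr0I mod_eq_0_iff_dvd dvdE)
      then have "m \<le> 2" using that(1) q0 by (simp add: mult.commute)
      then have "m = 0 \<or> m = 1 \<or> m = 2" by linarith
      then show False using that(2) m by auto
    qed
    ultimately show ?thesis using inv[of k] om(2)[of "k mod q"] q0 by (metis mod_less_divisor mult_cancel_right1 mult.commute)
  qed
  have "bloch_trace om q E w = coeff P q - 1 / w ^ q + coeff P (2 * q) * w ^ q" if w: "w \<noteq> 0" for w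
  proof -
    have "poly P w = (\<Sum>k\<le>2 * q. coeff P k * w ^ k)"
      using degree_bloch_poly[of om q E] unfolding poly_altdef
      by (intro sum.mono_neutral_left) (auto simp: coeff_eq_0 P_def)
    also have "\<dots> = (\<Sum>k\<in>{0, q, 2 * q}. coeff P k * w ^ k)"
      by (intro sum.mono_neutral_right) (auto simp: zero)
    also have "\<dots> = coeff P 0 + coeff P q * w ^ q + coeff P (2 * q) * (w ^ q * w ^ q)"
      using q0 by (simp add: mult_2 power_add)
    also have "coeff P 0 = - 1" using bloch_poly_0[OF om(1) q, of E] by (simp add: poly_0_coeff_0 P_def)
    finally have "w ^ q * bloch_trace om q E w = - 1 + coeff P q * w ^ q + coeff P (2 * q) * (w ^ q * w ^ q)"
      using poly_bloch_poly[OF w om0, of q E] by (simp add: P_def)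
    then show ?thesis using w by (simp add: field_simps)
  qed
  then show ?thesis by blast
qed

text \<open>The coefficient of \<open>w ^ q\<close> is still open. Inverting both \<open>w\<close>
  and \<open>om\<close> preserves the potential, which links the forms for \<open>om\<close> and for
  \<open>1 / om\<close>; comparing them where \<open>w ^ q\<close> is 1, -1 and 2 forces the
  coefficient to be -1.\<close>

theorem chambers:
  assumes om: "om ^ q = 1" "\<And>k. 0 < k \<Longrightarrow> k < q \<Longrightarrow> om ^ k \<noteq> 1" and q: "odd q"
  obtains c where "\<And>w. w \<noteq> 0 \<Longrightarrow> bloch_trace om q E w = c - (w ^ q + 1 / w ^ q)"
proof -
  have om': "(1 / om) ^ q = 1" "\<And>k. 0 < k \<Longrightarrow> k < q \<Longrightarrow> (1 / om) ^ k \<noteq> 1"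
    using om by (simp_all add: power_divide)
  obtain c d where 1: "\<And>w. w \<noteq> 0 \<Longrightarrow> bloch_trace om q E w = c - 1 / w ^ q + d * w ^ q"
    using bloch_trace_form[OF om q, of E] by blast
  obtain c' d' where 2: "\<And>w. w \<noteq> 0 \<Longrightarrow> bloch_trace (1 / om) q E w = c' - 1 / w ^ q + d' * w ^ q"
    using bloch_trace_form[OF om' q, of E] by blast
  have 3: "bloch_trace om q E (1 / w) = bloch_trace (1 / om) q E w" if "w \<noteq> 0" for w
    unfolding bloch_trace_def using that by (simp add: power_divide add.commute)
  have *: "c - u + d / u = c' - 1 / u + d' * u" if "u = w ^ q" "w \<noteq> 0" for u w
    using 1[of "1 / w"] 2[of w] 3[of w] that by (simp add: power_divide)
  have "c - 1 + d = c' - 1 + d'" using *[of 1 1] by simp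
  moreover have "c + 1 - d = c' + 1 - d'" using *[of "-1" "-1"] q by simp
  moreover have "c - 2 + d / 2 = c' - 1 / 2 + d' * 2"
  proof -
    have "complex_of_real (root q 2) ^ q = 2" using q odd_pos[OF q] by (simp flip: of_real_power)
    then show ?thesis using *[of 2 "complex_of_real (root q 2)"] odd_pos[OF q] by simp
  qed
  ultimately have "d = - 1" by algebra
  then show ?thesis using 1 that by fastforce
qed

section \<open>The discriminant as a transfer trace, and Bloch waves\<close>

lemma step_matrix_product:
  assumes "transfer (map (\<lambda>j. (E - 2 * cos (2 * pi * real j * real p / real q + pi / (2 * real q)), 1)) js) = (a, b, c, d)"
  shows "foldr (**) (map (step_matrix p q E) js) (mat 1) = vector [vector [a, b], vector [c, d]]"
  using assms
proof (induction js arbitrary: a b c d)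
  case Nil
  then show ?case by (simp add: vec_eq_iff mat_def forall_2 vector_2)
next
  case (Cons j js)
  obtain a' b' c' d' where t: "transfer (map (\<lambda>j. (E - 2 * cos (2 * pi * real j * real p / real q + pi / (2 * real q)), 1)) js) = (a', b', c', d')"
    by (metis prod.exhaust)
  show ?case using Cons.prems t unfolding list.map foldr.simps comp_apply Cons.IH[OF t]
    by (auto simp: vec_eq_iff forall_2 vector_2 step_matrix_def matrix_matrix_mult_def sum_2)
qed

lemma discriminant_transfer:
  "discriminant p q E = - trace2 (transfer (map (\<lambda>j.
     (E - 2 * cos (2 * pi * real j * real p / real q + pi / (2 * real q)), 1)) [1..<Suc q]))"
proof -
  obtain a b c d where t: "transfer (map (\<lambda>j. (E - 2 * cos (2 * pi * real j * real p / real q + pi / (2 * real q)), 1)) [1..<Suc q]) = (a, b, c, d)"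
    by (metis prod.exhaust)
  show ?thesis unfolding discriminant_def step_matrix_product[OF t] t
    by (simp add: trace_def sum_2 vector_2)
qed

lemma singular2_kernel:
  fixes a b c d :: complex
  assumes "a * d - b * c = 0"
  obtains s t where "(s, t) \<noteq> (0, 0)" "a * s + b * t = 0" "c * s + d * t = 0"
proof (cases "a = 0 \<and> b = 0")
  case True
  show ?thesis
  proof (cases "c = 0 \<and> d = 0")
    case True
    then show ?thesis using that[of 1 0] \<open>a = 0 \<and> b = 0\<close> by simp
  next
    case False
    then show ?thesis using that[of d "- c"] \<open>a = 0 \<and> b = 0\<close> by (auto simp: mult.commute)
  qed
next
  case False
  then show ?thesis using that[of "- b" a] assms by (auto simp: algebra_simps)
qed

fun forward :: "(nat \<Rightarrow> complex) \<Rightarrow> complex \<Rightarrow> complex \<Rightarrow> nat \<Rightarrow> complex" where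
  "forward x s t 0 = s"
| "forward x s t (Suc 0) = t"
| "forward x s t (Suc (Suc n)) = x (Suc n) * forward x s t (Suc n) - forward x s t n"

text \<open>The factors stand in increasing order, so the product runs the recursion backwards, from
  the pair at \<open>k\<close> and \<open>Suc k\<close> to the initial pair.\<close>

lemma transfer_forward:
  assumes "transfer (map (\<lambda>j. (x j, 1)) [1..<Suc k]) = (a, b, c, d)"
  shows "a * forward x s t k + b * forward x s t (Suc k) = s \<and>
         c * forward x s t k + d * forward x s t (Suc k) = t"
  using assms
proof (induction k arbitrary: a b c d)
  case (Suc k)
  obtain a' b' c' d' where t: "transfer (map (\<lambda>j. (x j, 1)) [1..<Suc k]) = (a', b', c', d')"
    by (metis prod.exhaust)
  have "[1..<Suc (Suc k)] = [1..<Suc k] @ [Suc k]" by simp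
  then have "(a, b, c, d) = mult2 (a', b', c', d') (x (Suc k), - 1, 1, 0)"
    using Suc.prems t by (simp only: map_append transfer_append) simp
  then have e: "a = a' * x (Suc k) + b'" "b = - a'" "c = c' * x (Suc k) + d'" "d = - c'" by auto
  show ?case unfolding e using Suc.IH[OF t] by (simp add: algebra_simps)
qed auto

lemma bloch_solution:
  assumes om: "om ^ q = 1" "om \<noteq> 0" and q: "q > 0" and w: "w \<noteq> 0" and lam: "lam \<noteq> 0"
    and tr: "bloch_trace om q E w = lam + 1 / lam"
  obtains phi :: "int \<Rightarrow> complex" where "\<exists>n. phi n \<noteq> 0" "\<And>n. phi (n + int q) = lam * phi n"
    "\<And>n. phi (n + 1) + phi (n - 1) + (w * om powi n + 1 / (w * om powi n)) * phi n = E * phi n"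
proof -
  define x where "x j = E - (w * om ^ j + 1 / (w * om ^ j))" for j
  obtain a b c d where M: "transfer (map (\<lambda>j. (x j, 1)) [1..<Suc q]) = (a, b, c, d)"
    by (metis prod.exhaust)
  have det: "a * d - b * c = 1" using det2_transfer[of x "[1..<Suc q]"] M by simp
  have ad: "a + d = lam + 1 / lam" using tr M by (simp only: bloch_trace_def x_def [abs_def] trace2.simps)
  \<comment> \<open>As the product runs backwards, growth by \<open>lam\<close> over one period
    corresponds to its eigenvalue \<open>1 / lam\<close>.\<close>
  have "(a - 1 / lam) * (d - 1 / lam) - b * c = 0"
  proof -
    define u where "u = 1 / lam"
    have "lam * u = 1" using lam by (simp add: u_def)
    then show ?thesis using det ad unfolding u_def[symmetric] by algebra
  qed
  then obtain s t where st: "(s, t) \<noteq> (0, 0)" "(a - 1 / lam) * s + b * t = 0" "c * s + (d - 1 / lam) * t = 0"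
    by (rule singular2_kernel)
  define f where "f = forward x s t"
  have fq: "a * f q + b * f (Suc q) = s" "c * f q + d * f (Suc q) = t"
    using transfer_forward[OF M, of s t] by (simp_all add: f_def)
  have st': "a * (lam * s) + b * (lam * t) = s" "c * (lam * s) + d * (lam * t) = t"
    using st(2,3) lam by (simp_all add: field_simps)
  have "f q = (a * d - b * c) * f q" "f (Suc q) = (a * d - b * c) * f (Suc q)" using det by simp_all
  then have "f q = d * (a * f q + b * f (Suc q)) - b * (c * f q + d * f (Suc q))"
    "f (Suc q) = a * (c * f q + d * f (Suc q)) - c * (a * f q + b * f (Suc q))"
    by (simp_all add: algebra_simps)
  moreover have "d * S - b * T = (a * d - b * c) * X" "a * T - c * S = (a * d - b * c) * Y"
    if "a * X + b * Y = S" "c * X + d * Y = T" for X Y S T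
    unfolding that[symmetric] by (simp_all add: algebra_simps)
  note this[OF st']
  ultimately have fq': "f q = lam * f 0" "f (Suc q) = lam * f (Suc 0)"
    using fq det by (simp_all add: f_def)
  have xper: "x (n + q) = x n" for n using om by (simp add: x_def power_add)
  have fper: "f (n + q) = lam * f n \<and> f (Suc n + q) = lam * f (Suc n)" for n
  proof (induction n)
    case (Suc n)
    then show ?case using xper[of "Suc n"] by (simp add: f_def algebra_simps)
  qed (use fq' in auto)
  then have fper: "f (n + q) = lam * f n" for n by blast
  \<comment> \<open>The recursion yields nonnegative indices only; the multiplier \<open>lam\<close>
    extends the solution to all integers.\<close>
  define phi where "phi n = lam powi (n div int q) * f (nat (n mod int q))" for n :: int
  have phi_per: "phi (n + int q) = lam * phi n" for n
  proof -
    have "(n + int q) div int q = n div int q + 1" using q by simp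
    then show ?thesis using lam by (simp add: phi_def power_int_add_1')
  qed
  have fk: "f (r + k * q) = lam ^ k * f r" for r k
  proof (induction k)
    case (Suc k)
    have "r + Suc k * q = (r + k * q) + q" by simp
    then show ?case using fper[of "r + k * q"] Suc by (simp only:) simp
  qed simp
  have phi_nat: "phi (int m) = f m" for m
  proof -
    have "phi (int m) = lam ^ (m div q) * f (m mod q)"
      by (simp only: phi_def zdiv_int[symmetric] zmod_int[symmetric] power_int_of_nat nat_int)
    also have "\<dots> = f m" using fk[of "m mod q" "m div q"] by simp
    finally show ?thesis .
  qed
  have phi_k: "phi (n + int (k * q)) = lam ^ k * phi n" for n k
  proof (induction k)
    case (Suc k)
    have "n + int (Suc k * q) = (n + int (k * q)) + int q" by (simp add: algebra_simps)
    then show ?case using phi_per[of "n + int (k * q)"] Suc by (simp only:) simp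
  qed simp
  have eq_nat: "phi (int m + 1) + phi (int m - 1) + (w * om powi int m + 1 / (w * om powi int m)) * phi (int m) = E * phi (int m)"
    if m: "m > 0" for m
  proof -
    obtain m' where m': "m = Suc m'" using m by (cases m) auto
    have e: "int m + 1 = int (Suc (Suc m'))" "int m - 1 = int m'" using m' by auto
    have p: "phi (int m + 1) = f (Suc (Suc m'))" "phi (int m - 1) = f m'" "phi (int m) = f (Suc m')"
      unfolding e unfolding m' by (rule phi_nat)+
    have "f (Suc (Suc m')) = x (Suc m') * f (Suc m') - f m'" by (simp add: f_def)
    then show ?thesis unfolding p unfolding m' power_int_of_nat x_def by (simp add: algebra_simps)
  qed
  have eq: "phi (n + 1) + phi (n - 1) + (w * om powi n + 1 / (w * om powi n)) * phi n = E * phi n" for n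
  proof -
    define k where "k = nat \<bar>n\<bar> + 1"
    have "n + int (k * q) > 0"
    proof -
      have "int k * 1 \<le> int k * int q" using q by (intro mult_left_mono) auto
      then have "int (k * q) \<ge> int k" by simp
      moreover have "int k > \<bar>n\<bar>" by (simp add: k_def)
      ultimately show ?thesis by linarith
    qed
    then obtain m where m: "n + int (k * q) = int m" "m > 0" by (metis of_nat_0_less_iff zero_less_imp_eq_int)
    have "om powi (n + int (k * q)) = om powi n"
      using om by (simp add: power_int_add power_int_of_nat power_mult mult.commute[of k] del: of_nat_mult)
    then have "lam ^ k * (phi (n + 1) + phi (n - 1) + (w * om powi n + 1 / (w * om powi n)) * phi n) = lam ^ k * (E * phi n)"
      using eq_nat[OF m(2)] phi_k[of "n + 1" k] phi_k[of "n - 1" k] phi_k[of n k] unfolding m(1)[symmetric]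
      by (simp add: algebra_simps)
    then show ?thesis using lam by simp
  qed
  have "\<exists>n. phi n \<noteq> 0"
  proof -
    have "phi (int 0) = s" "phi (int 1) = t" by (simp_all only: phi_nat) (simp_all add: f_def)
    then show ?thesis using st(1) by (metis prod.inject)
  qed
  then show ?thesis using that phi_per eq by blast
qed

lemma unit_add_inverse:
  assumes "cmod u = 1"
  shows "u + 1 / u = of_real (2 * Re u)"
proof -
  have "u * cnj u = 1" using assms by (simp add: complex_norm_square[symmetric])
  then have "1 / u = cnj u" by (metis div_by_1 divide_divide_eq_right mult_zero_left nonzero_mult_div_cancel_left zero_neq_one)
  then show ?thesis by (simp add: complex_add_cnj)
qed

text \<open>Summation over one period: as \<open>cmod lam = 1\<close>, no boundary term arises, and
  the two hopping sums are complex conjugates. Hence \<open>E\<close> times a positive number is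
  real.\<close>

lemma bloch_eigenvalue_real:
  assumes per: "\<And>n. phi (n + int q) = lam * phi n" and nz: "\<exists>n. phi n \<noteq> (0 :: complex)"
    and eq: "\<And>n. phi (n + 1) + phi (n - 1) + of_real (V n) * phi n = E * phi n"
    and lam: "cmod lam = 1" and q: "q > 0"
  shows "E \<in> \<real>"
proof -
  define A where "A = (\<Sum>n<q. cnj (phi (int n)) * phi (int n + 1))"
  define S where "S = (\<Sum>n<q. (cmod (phi (int n)))\<^sup>2)"
  have B: "(\<Sum>n<q. cnj (phi (int n)) * phi (int n - 1)) = cnj A"
  proof -
    define G where "G n = cnj (phi (int n)) * phi (int n - 1)" for n
    have "(\<Sum>n<q. G (Suc n) - G n) = G q - G 0" by (rule sum_lessThan_telescope)
    also have "G q = (cnj lam * lam) * G 0" using per[of 0] per[of "- 1"] by (simp add: G_def)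
    also have "cnj lam * lam = 1" using lam by (metis complex_norm_square mult.commute of_real_1 one_power2)
    finally have "(\<Sum>n<q. G n) = (\<Sum>n<q. G (Suc n))" by (simp add: sum_subtractf)
    then show ?thesis by (simp add: A_def G_def add.commute mult.commute)
  qed
  have "E * of_real S = (\<Sum>n<q. cnj (phi (int n)) * (E * phi (int n)))"
    unfolding S_def of_real_sum sum_distrib_left by (intro sum.cong) (auto simp: complex_norm_square simp del: of_real_power)
  also have "\<dots> = (\<Sum>n<q. cnj (phi (int n)) * phi (int n + 1) + cnj (phi (int n)) * phi (int n - 1)
       + of_real (V (int n) * (cmod (phi (int n)))\<^sup>2))"
    by (intro sum.cong refl, subst eq[symmetric]) (simp add: complex_norm_square algebra_simps del: of_real_power)
  also have "\<dots> = A + cnj A + of_real (\<Sum>n<q. V (int n) * (cmod (phi (int n)))\<^sup>2)"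
    unfolding sum.distrib B A_def by simp
  finally have "E * of_real S \<in> \<real>" by (simp add: complex_add_cnj)
  moreover have Spos: "S > 0"
  proof -
    obtain n where n: "phi n \<noteq> 0" using nz by blast
    have lam0: "lam \<noteq> 0" using lam by auto
    have "phi (m + int (k * q)) = lam ^ k * phi m" for m k
    proof (induction k)
      case (Suc k)
      have "m + int (Suc k * q) = (m + int (k * q)) + int q" by (simp add: algebra_simps)
      then show ?case using per[of "m + int (k * q)"] Suc by (simp only:) simp
    qed simp
    then have k: "phi (m + int (k * q)) = 0 \<longleftrightarrow> phi m = 0" for m k using lam0 by simp
    have "phi (n mod int q) \<noteq> 0"
    proof (cases "n \<ge> 0")
      case True
      then have "n = n mod int q + int (nat (n div int q) * q)"
        using q by (simp add: pos_imp_zdiv_nonneg_iff)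
      then show ?thesis using k n by metis
    next
      case False
      then have "n div int q < 0" using q by (simp add: pos_imp_zdiv_neg_iff)
      then have "n + int (nat (- (n div int q)) * q) = n mod int q"
        by (simp add: minus_div_mult_eq_mod[symmetric] algebra_simps)
      then show ?thesis using k n by metis
    qed
    then have "(cmod (phi (int (nat (n mod int q)))))\<^sup>2 > 0" using q by simp
    moreover have "nat (n mod int q) < q" using q by (simp add: nat_less_iff)
    ultimately show ?thesis unfolding S_def by (intro sum_pos2[of _ "nat (n mod int q)"]) auto
  qed
  have "E = (E * of_real S) / of_real S" using Spos by simp
  ultimately show ?thesis using Reals_divide[of "E * of_real S" "of_real S"] by simp
qed

section \<open>Real-rooted polynomials\<close>

definition cpoly :: "real poly \<Rightarrow> complex poly" where
  "cpoly p = map_poly complex_of_real p"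

lemma coeff_cpoly [simp]: "coeff (cpoly p) n = of_real (coeff p n)"
  by (simp add: cpoly_def coeff_map_poly)

lemma degree_cpoly [simp]: "degree (cpoly p) = degree p"
  by (simp add: cpoly_def degree_map_poly)

lemma cpoly_add: "cpoly (p + q) = cpoly p + cpoly q"
  by (simp add: poly_eq_iff)

lemma cpoly_diff: "cpoly (p - q) = cpoly p - cpoly q"
  by (simp add: poly_eq_iff)

lemma cpoly_minus: "cpoly (- p) = - cpoly p"
  by (simp add: poly_eq_iff)

lemma cpoly_mult: "cpoly (p * q) = cpoly p * cpoly q"
  by (simp add: poly_eq_iff coeff_mult)

lemma cpoly_pCons: "cpoly (pCons a p) = pCons (of_real a) (cpoly p)"
  by (simp add: cpoly_def map_poly_pCons)

lemma cpoly_0 [simp]: "cpoly 0 = 0" and cpoly_1 [simp]: "cpoly 1 = 1"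
  by (simp_all add: cpoly_def)

lemma cpoly_eq_0_iff [simp]: "cpoly p = 0 \<longleftrightarrow> p = 0"
  by (simp add: poly_eq_iff)

lemma poly_cpoly_of_real: "poly (cpoly p) (of_real x) = of_real (poly p x)"
  by (induction p) (simp_all add: cpoly_pCons)

lemma pderiv_cpoly: "pderiv (cpoly p) = cpoly (pderiv p)"
  by (simp add: poly_eq_iff coeff_pderiv)

definition real_rooted :: "real poly \<Rightarrow> bool" where
  "real_rooted p \<longleftrightarrow> (\<forall>z. poly (cpoly p) z = 0 \<longrightarrow> z \<in> \<real>)"

lemma real_rooted_factor:
  assumes "real_rooted ([:- r, 1:] * h)"
  shows "real_rooted h"
  using assms by (auto simp: real_rooted_def cpoly_mult simp del: mult_pCons_left)

lemma real_rooted_root: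
  assumes "real_rooted p" "degree p > 0"
  obtains r where "poly p r = 0"
proof -
  have "\<not> constant (poly (cpoly p))"
    using assms(2) by (simp add: constant_degree)
  then obtain z where z: "poly (cpoly p) z = 0" using fundamental_theorem_of_algebra by blast
  then obtain r where "z = of_real r" using assms(1) by (auto simp: real_rooted_def elim: Reals_cases)
  then show ?thesis using that[of r] z by (simp add: poly_cpoly_of_real)
qed

text \<open>For \<open>p = (x - r) h\<close> one has
  \<open>p'^2 - p p'' = h^2 + (x - r)^2 (h'^2 - h h'')\<close>: the inequality is inherited from
  \<open>h\<close>, and \<open>h^2\<close> makes it strict where \<open>p\<close> does not
  vanish.\<close>

lemma laguerre_inequality:
  assumes "real_rooted p"
  shows "(poly (pderiv p) x)\<^sup>2 - poly p x * poly (pderiv (pderiv p)) x \<ge> 0 \<and>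
    (degree p > 0 \<longrightarrow> poly p x \<noteq> 0 \<longrightarrow> (poly (pderiv p) x)\<^sup>2 - poly p x * poly (pderiv (pderiv p)) x > 0)"
  using assms
proof (induction "degree p" arbitrary: p)
  case 0
  then have "pderiv p = 0" by (simp add: pderiv_eq_0_iff)
  then show ?case using 0 by simp
next
  case (Suc n)
  obtain r where "poly p r = 0" by (rule real_rooted_root[OF Suc.prems]) (use Suc in auto)
  then obtain h where h: "p = [:- r, 1:] * h" by (auto simp: poly_eq_0_iff_dvd)
  have "p \<noteq> 0" using Suc.hyps(2) by auto
  then have "h \<noteq> 0" using h by auto
  then have "degree h = n" using Suc.hyps(2) h by (simp add: degree_mult_eq del: mult_pCons_left)
  then have IH: "(poly (pderiv h) x)\<^sup>2 - poly h x * poly (pderiv (pderiv h)) x \<ge> 0"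
    using Suc.hyps(1)[of h] real_rooted_factor Suc.prems h by blast
  have d: "poly (pderiv p) x = poly h x + (x - r) * poly (pderiv h) x"
    "poly (pderiv (pderiv p)) x = 2 * poly (pderiv h) x + (x - r) * poly (pderiv (pderiv h)) x"
    "poly p x = (x - r) * poly h x"
  proof -
    have d1: "pderiv p = [:- r, 1:] * pderiv h + h"
      unfolding h by (simp add: pderiv_mult pderiv_pCons del: mult_pCons_left)
    have d2: "pderiv (pderiv p) = [:- r, 1:] * pderiv (pderiv h) + pderiv h + pderiv h"
      unfolding d1 by (simp add: pderiv_mult pderiv_pCons pderiv_add del: mult_pCons_left)
    show "poly (pderiv p) x = poly h x + (x - r) * poly (pderiv h) x"
      unfolding d1 by (simp only: poly_add poly_mult) (simp add: algebra_simps)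
    show "poly (pderiv (pderiv p)) x = 2 * poly (pderiv h) x + (x - r) * poly (pderiv (pderiv h)) x"
      unfolding d2 by (simp only: poly_add poly_mult) (simp add: algebra_simps)
    show "poly p x = (x - r) * poly h x" unfolding h by (simp only: poly_mult) simp
  qed
  have "(poly (pderiv p) x)\<^sup>2 - poly p x * poly (pderiv (pderiv p)) x =
      (poly h x)\<^sup>2 + (x - r)\<^sup>2 * ((poly (pderiv h) x)\<^sup>2 - poly h x * poly (pderiv (pderiv h)) x)"
    unfolding d by (simp add: power2_eq_square algebra_simps)
  moreover have "(x - r)\<^sup>2 * ((poly (pderiv h) x)\<^sup>2 - poly h x * poly (pderiv (pderiv h)) x) \<ge> 0"
    using IH by simp
  moreover have "poly p x \<noteq> 0 \<Longrightarrow> (poly h x)\<^sup>2 > 0" using d(3) by simp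
  ultimately show ?case by (metis add_nonneg_nonneg add_pos_nonneg zero_le_power2)
qed

text \<open>At a critical point with value strictly between \<open>- R\<close> and \<open>R\<close>,
  the strict Laguerre inequality for \<open>f - R\<close> and for \<open>f + R\<close> would require
  a second derivative that is both positive and negative.\<close>

lemma critical_value_bound:
  assumes "\<And>v. \<bar>v\<bar> \<le> R \<Longrightarrow> real_rooted (f - [:v:])" "degree f > 0" "R > 0" "poly (pderiv f) c = 0"
  shows "\<bar>poly f c\<bar> \<ge> R"
proof (rule ccontr)
  assume "\<not> \<bar>poly f c\<bar> \<ge> R"
  then have lt: "poly f c - R < 0" "poly f c + R > 0" by auto
  have deg: "degree (f - [:v:]) = degree f" for v
  proof -
    have "degree (- [:v:]) < degree f" using assms(2) by simp
    then show ?thesis by (metis degree_add_eq_left diff_conv_add_uminus)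
  qed
  have *: "0 - (poly f c - v) * poly (pderiv (pderiv f)) c > 0" if "\<bar>v\<bar> \<le> R" "poly f c \<noteq> v" for v
    using laguerre_inequality[OF assms(1)[OF that(1)], of c] deg[of v] assms(2,4) that(2)
    by (simp add: pderiv_diff pderiv_pCons)
  have "(poly f c - R) * poly (pderiv (pderiv f)) c < 0" "(poly f c + R) * poly (pderiv (pderiv f)) c < 0"
    using *[of R] *[of "- R"] lt assms(3) by auto
  then show False using lt by (auto simp: mult_less_0_iff)
qed

text \<open>By the Laguerre inequality \<open>h' / h\<close> decreases, and it vanishes at 0 by
  evenness; so \<open>\<bar>h\<bar>\<close> decreases up to its first zero and
  \<open>\<bar>f\<bar>\<close> stays below its linear part. A zero of \<open>h\<close> before
  \<open>E\<close> would give, by Rolle, a critical value of modulus below \<open>R\<close>.\<close>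

lemma odd_real_rooted_linear_bound:
  fixes f :: "real poly"
  assumes rr: "\<And>v. \<bar>v\<bar> \<le> R \<Longrightarrow> real_rooted (f - [:v:])" and R: "R > 0" and deg: "degree f > 0"
    and f: "f = [:0, 1:] * h" and even: "\<And>x. poly h (- x) = poly h x"
    and E: "0 \<le> E" "E * \<bar>poly (pderiv f) 0\<bar> \<le> R"
  shows "\<bar>poly f E\<bar> \<le> R"
proof -
  have d0: "poly (pderiv f) 0 = poly h 0" unfolding f by (simp add: pderiv_mult pderiv_pCons)
  have hrr: "real_rooted h"
    using rr[of 0] R f real_rooted_factor[of 0 h] by simp
  have crit: "\<bar>poly f c\<bar> \<ge> R" if "poly (pderiv f) c = 0" for c
    using critical_value_bound[OF rr deg R that] by blast
  have h0: "poly h 0 \<noteq> 0" using crit[of 0] d0 R f by auto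
  have bound: "\<bar>poly h x\<bar> \<le> \<bar>poly h 0\<bar>" if x: "0 \<le> x" "\<And>t. 0 \<le> t \<Longrightarrow> t < x \<Longrightarrow> poly h t \<noteq> 0" for x
  proof -
    have dh: "poly (pderiv h) 0 = 0"
    proof -
      have "((\<lambda>x. poly h (- x)) has_real_derivative poly (pderiv h) (- 0) * (- 1)) (at 0)"
        by (rule DERIV_chain2[where g = uminus]) (auto intro!: derivative_eq_intros poly_DERIV)
      then have "(poly h has_real_derivative - poly (pderiv h) 0) (at 0)" by (simp add: even)
      then have "- poly (pderiv h) 0 = poly (pderiv h) 0" by (rule DERIV_unique) (rule poly_DERIV)
      then show ?thesis by simp
    qed
    have quot: "poly (pderiv h) t / poly h t \<le> 0" if t: "0 \<le> t" "t < x" for t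
    proof -
      have "poly (pderiv h) t / poly h t \<le> poly (pderiv h) 0 / poly h 0"
      proof (rule DERIV_nonpos_imp_nonincreasing[OF t(1), where f = "\<lambda>t. poly (pderiv h) t / poly h t"])
        fix s assume s: "0 \<le> s" "s \<le> t"
        have nz: "poly h s \<noteq> 0" using s t x by auto
        have "((\<lambda>t. poly (pderiv h) t / poly h t) has_real_derivative
           (poly (pderiv (pderiv h)) s * poly h s - poly (pderiv h) s * poly (pderiv h) s) / (poly h s * poly h s)) (at s)"
          using nz by (intro DERIV_divide poly_DERIV)
        moreover have "(poly (pderiv (pderiv h)) s * poly h s - poly (pderiv h) s * poly (pderiv h) s) / (poly h s * poly h s) \<le> 0"
          using laguerre_inequality[OF hrr, of s] nz
          by (intro divide_nonpos_nonneg) (auto simp: power2_eq_square mult.commute)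
        ultimately show "\<exists>y. ((\<lambda>t. poly (pderiv h) t / poly h t) has_real_derivative y) (at s) \<and> y \<le> 0" by blast
      qed
      then show ?thesis using dh by simp
    qed
    have "(poly h x)\<^sup>2 \<le> (poly h 0)\<^sup>2"
    proof (cases "x = 0")
      case False
      have "continuous_on {0..x} (\<lambda>t. (poly h t)\<^sup>2)" by (intro continuous_intros)
      moreover have "\<exists>y. ((\<lambda>t. (poly h t)\<^sup>2) has_real_derivative y) (at t) \<and> y \<le> 0" if t: "0 < t" "t < x" for t
      proof -
        have "((\<lambda>t. (poly h t)\<^sup>2) has_real_derivative 2 * poly h t * poly (pderiv h) t) (at t)"
          by (auto intro!: derivative_eq_intros poly_DERIV)
        moreover have "2 * poly h t * poly (pderiv h) t = 2 * (poly h t)\<^sup>2 * (poly (pderiv h) t / poly h t)"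
          using x t by (simp add: power2_eq_square)
        moreover have "2 * (poly h t)\<^sup>2 * (poly (pderiv h) t / poly h t) \<le> 0"
          using quot[of t] t by (intro mult_nonneg_nonpos) auto
        ultimately show ?thesis by metis
      qed
      ultimately show ?thesis using x(1) False by (intro DERIV_nonpos_imp_decreasing_open[of 0 x]) auto
    qed simp
    then show ?thesis by (simp add: abs_le_square_iff)
  qed
  show ?thesis
  proof (cases "\<exists>t. 0 \<le> t \<and> t < E \<and> poly h t = 0")
    case False
    then have "\<bar>poly h E\<bar> \<le> \<bar>poly h 0\<bar>" using bound[of E] E by blast
    then have "E * \<bar>poly h E\<bar> \<le> E * \<bar>poly h 0\<bar>" using E by (intro mult_left_mono)
    then show ?thesis using E d0 by (simp add: f abs_mult)
  next
    case True
    then obtain t where t: "0 \<le> t" "t < E" "poly h t = 0" by blast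
    define Z where "Z = {t \<in> {0..E}. poly h t = 0}"
    have "h \<noteq> 0" using h0 by auto
    then have "finite {x. poly h x = 0}" by (rule poly_roots_finite)
    then have fin: "finite Z" unfolding Z_def by (rule rev_finite_subset) auto
    have "t \<in> Z" using t by (simp add: Z_def)
    then have ne: "Z \<noteq> {}" by blast
    define x1 where "x1 = Min Z"
    have x1: "x1 \<in> Z" "\<And>s. s \<in> Z \<Longrightarrow> x1 \<le> s" using fin ne by (auto simp: x1_def)
    have x1lt: "x1 < E" "x1 > 0" using x1 t h0 by (force simp: Z_def less_le)+
    have nz: "poly h s \<noteq> 0" if "0 \<le> s" "s < x1" for s
      using x1(2)[of s] that x1lt by (auto simp: Z_def)
    have "\<exists>z. 0 < z \<and> z < x1 \<and> (poly f x1 - poly f 0) = (x1 - 0) * poly (pderiv f) z"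
      using MVT2[of 0 x1 "poly f" "poly (pderiv f)"] x1lt by (auto intro: poly_DERIV)
    then obtain c where c: "0 < c" "c < x1" "poly (pderiv f) c = 0"
      using x1 x1lt by (auto simp: f Z_def)
    have "\<bar>poly h c\<bar> \<le> \<bar>poly h 0\<bar>" using bound[of c] nz c by auto
    then have "c * \<bar>poly h c\<bar> \<le> c * \<bar>poly h 0\<bar>" using c by (intro mult_left_mono) auto
    also have "\<dots> < E * \<bar>poly h 0\<bar>" using c x1lt h0 by simp
    also have "\<dots> \<le> R" using E d0 by simp
    finally have "\<bar>poly f c\<bar> < R" using c by (simp add: f abs_mult)
    then show ?thesis using crit[OF c(3)] by simp
  qed
qed

lemma real_rooted_simple_imp_card:
  assumes "real_rooted f" "f \<noteq> 0" "\<And>x. poly f x = 0 \<Longrightarrow> poly (pderiv f) x \<noteq> 0"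
  shows "card {x. poly f x = 0} = degree f"
proof -
  have "rsquarefree (cpoly f)"
    unfolding rsquarefree_roots
  proof (intro allI notI)
    fix z assume z: "poly (cpoly f) z = 0 \<and> poly (pderiv (cpoly f)) z = 0"
    then obtain x where "z = of_real x" using assms(1) by (auto simp: real_rooted_def elim: Reals_cases)
    then show False using z assms(3)[of x] by (simp add: poly_cpoly_of_real pderiv_cpoly)
  qed
  then have e: "smult (lead_coeff (cpoly f)) (\<Prod>z|poly (cpoly f) z = 0. [:- z, 1:]) = cpoly f"
    by (rule complex_poly_decompose_rsquarefree)
  define k where "k = lead_coeff (cpoly f)"
  have k: "k \<noteq> 0" using assms(2) by (simp add: k_def)
  have "degree f = degree (cpoly f)" by simp
  also have "\<dots> = degree (smult k (\<Prod>z|poly (cpoly f) z = 0. [:- z, 1:]))"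
    using e by (simp add: k_def)
  also have "\<dots> = card {z. poly (cpoly f) z = 0}"
    using k by (simp add: degree_prod_sum_eq)
  also have "{z. poly (cpoly f) z = 0} = complex_of_real ` {x. poly f x = 0}"
  proof (intro equalityI subsetI)
    fix z assume z: "z \<in> {z. poly (cpoly f) z = 0}"
    then obtain x where "z = of_real x" using assms(1) by (auto simp: real_rooted_def elim: Reals_cases)
    then show "z \<in> complex_of_real ` {x. poly f x = 0}" using z by (simp add: poly_cpoly_of_real)
  qed (auto simp: poly_cpoly_of_real)
  also have "card \<dots> = card {x. poly f x = 0}" by (rule card_image) (simp add: inj_on_def)
  finally show ?thesis by simp
qed

section \<open>The discriminant in the chiral gauge\<close>

definition disc_poly :: "nat \<Rightarrow> nat \<Rightarrow> real poly" where
  "disc_poly p q = - trace2 (transfer (map (\<lambda>j.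
     ([:- (2 * cos (2 * pi * real j * real p / real q + pi / (2 * real q))), 1:], 1)) [1..<Suc q]))"

lemma poly_disc_poly: "poly (disc_poly p q) E = discriminant p q E"
proof -
  have "poly (disc_poly p q) E = - trace2 (transfer (map (\<lambda>j.
     (poly [:- (2 * cos (2 * pi * real j * real p / real q + pi / (2 * real q))), 1:] E, poly 1 E)) [1..<Suc q]))"
    unfolding disc_poly_def poly_minus
    by (subst trace2_transfer_hom[symmetric, where f = "\<lambda>p. poly p E"]) (simp_all add: o_def case_prod_unfold del: upt_Suc)
  then show ?thesis by (simp add: discriminant_transfer add.commute del: upt_Suc)
qed

lemma degree_transfer_monic:
  assumes "transfer (map (\<lambda>j. ([:v j, 1:], 1 :: real poly)) js) = (a, b, c, d)"
  shows "degree a \<le> length js \<and> coeff a (length js) = 1 \<and> degree b \<le> length js - 1 \<and>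
         degree c \<le> length js - 1 \<and> degree d \<le> length js - 1"
  using assms
proof (induction js arbitrary: a b c d)
  case (Cons j js)
  obtain a' b' c' d' where t: "transfer (map (\<lambda>j. ([:v j, 1:], 1 :: real poly)) js) = (a', b', c', d')"
    by (metis prod.exhaust)
  define n where "n = length js"
  have IH: "degree a' \<le> n" "coeff a' n = 1" "degree b' \<le> n - 1" "degree c' \<le> n - 1" "degree d' \<le> n - 1"
    using Cons.IH[OF t] by (auto simp: n_def)
  have e: "a = [:v j, 1:] * a' - c'" "b = [:v j, 1:] * b' - d'" "c = a'" "d = b'"
    using Cons.prems t by auto
  have len: "length (j # js) = Suc n" by (simp add: n_def)
  have b0: "b' = 0" if "n = 0" using that t by (simp add: n_def)
  have "degree ([:v j, 1:] * a') \<le> Suc n" using degree_mult_le[of "[:v j, 1:]" a'] IH by simp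
  then have 1: "degree a \<le> Suc n" unfolding e using IH by (intro degree_diff_le) auto
  have "degree c' < Suc n" "degree a' < Suc n" using IH by auto
  then have 2: "coeff a (Suc n) = 1" unfolding e using IH by (simp add: coeff_eq_0)
  have 3: "degree b \<le> n"
  proof (cases "n = 0")
    case True
    then show ?thesis unfolding e using b0 IH by simp
  next
    case False
    have "degree ([:v j, 1:] * b') \<le> n" using degree_mult_le[of "[:v j, 1:]" b'] IH False by simp
    then show ?thesis unfolding e using IH by (intro degree_diff_le) auto
  qed
  show ?case unfolding len using 1 2 3 IH by (auto simp: e(3,4))
qed auto

lemma disc_poly_degree:
  assumes "q > 0"
  shows "degree (disc_poly p q) \<le> q" "coeff (disc_poly p q) q = - 1"
proof -
  define js where "js = [1..<Suc q]"
  obtain a b c d where t: "transfer (map (\<lambda>j.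
     ([:- (2 * cos (2 * pi * real j * real p / real q + pi / (2 * real q))), 1:], 1)) js) = (a, b, c, d)"
    by (metis prod.exhaust)
  have len: "length js = q" by (simp add: js_def)
  have deg: "degree a \<le> q" "coeff a q = 1" "degree d \<le> q - 1"
    using degree_transfer_monic[OF t] by (auto simp: len)
  have e: "disc_poly p q = - (a + d)" unfolding disc_poly_def js_def[symmetric] t by simp
  have "degree d < q" using deg assms by linarith
  then show "coeff (disc_poly p q) q = - 1" unfolding e using deg by (simp add: coeff_eq_0)
  have "degree (a + d) \<le> q" using deg by (intro degree_add_le) auto
  then show "degree (disc_poly p q) \<le> q" unfolding e by (simp only: degree_minus)
qed

text \<open>The characteristic polynomial of the \<open>n\<close> by \<open>n\<close> Jacobi matrix
  with zero diagonal and squared off-diagonal entries \<open>b 1, ..., b (n - 1)\<close>.\<close>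

fun chiral :: "(nat \<Rightarrow> real) \<Rightarrow> nat \<Rightarrow> real poly" where
  "chiral b 0 = 1"
| "chiral b (Suc 0) = [:0, 1:]"
| "chiral b (Suc (Suc n)) = [:0, 1:] * chiral b (Suc n) - [:b (Suc n):] * chiral b n"

lemma chiral_degree: "degree (chiral b n) \<le> n \<and> coeff (chiral b n) n = 1"
proof (induction b n rule: chiral.induct)
  case (3 b n)
  have IH: "degree (chiral b n) \<le> n" "degree (chiral b (Suc n)) \<le> Suc n" "coeff (chiral b (Suc n)) (Suc n) = 1"
    using 3 by auto
  have "degree ([:0, 1:] * chiral b (Suc n)) \<le> Suc (Suc n)"
    using degree_mult_le[of "[:0, 1:]" "chiral b (Suc n)"] IH by simp
  moreover have "degree ([:b (Suc n):] * chiral b n) \<le> Suc (Suc n)"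
    using degree_mult_le[of "[:b (Suc n):]" "chiral b n"] IH by simp
  moreover have "degree (chiral b n) < Suc (Suc n)" using IH by simp
  ultimately show ?case using IH by (auto intro!: degree_diff_le simp: coeff_eq_0 simp del: mult_pCons_left)
     (simp add: coeff_eq_0)
qed auto

lemma chiral_parity: "poly (chiral b n) (- x) = (-1) ^ n * poly (chiral b n) x"
  by (induction b n rule: chiral.induct) (simp_all add: algebra_simps)

lemma chiral_even_0: "poly (chiral b (2 * m)) 0 = (-1) ^ m * (\<Prod>i=1..m. b (2 * i - 1))"
  by (induction m) simp_all

text \<open>In terms of matchings of a path with \<open>2 * m + 1\<close> vertices that leave one
  vertex free: this is some vertex \<open>2 * r + 1\<close>, with odd edges used to its left and
  even edges to its right.\<close>

lemma chiral_odd_deriv_0: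
  "poly (pderiv (chiral b (2 * m + 1))) 0 =
     (-1) ^ m * (\<Sum>r=0..m. (\<Prod>i=1..r. b (2 * i - 1)) * (\<Prod>i=Suc r..m. b (2 * i)))"
proof (induction m)
  case (Suc m)
  have "chiral b (2 * Suc m + 1) = [:0, 1:] * chiral b (2 * Suc m) - [:b (2 * Suc m):] * chiral b (2 * m + 1)"
    by simp
  then have "poly (pderiv (chiral b (2 * Suc m + 1))) 0 =
      poly (chiral b (2 * Suc m)) 0 - b (2 * Suc m) * poly (pderiv (chiral b (2 * m + 1))) 0"
    by (simp only: pderiv_diff pderiv_mult) (simp add: pderiv_pCons)
  also have "\<dots> = (-1) ^ Suc m * ((\<Prod>i=1..Suc m. b (2 * i - 1)) + b (2 * Suc m) *
      (\<Sum>r=0..m. (\<Prod>i=1..r. b (2 * i - 1)) * (\<Prod>i=Suc r..m. b (2 * i))))"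
    unfolding Suc.IH chiral_even_0 by (simp add: algebra_simps)
  also have "b (2 * Suc m) * (\<Sum>r=0..m. (\<Prod>i=1..r. b (2 * i - 1)) * (\<Prod>i=Suc r..m. b (2 * i)))
     = (\<Sum>r=0..m. (\<Prod>i=1..r. b (2 * i - 1)) * (\<Prod>i=Suc r..Suc m. b (2 * i)))"
    unfolding sum_distrib_left by (intro sum.cong refl) (simp add: prod.cl_ivl_Suc mult_ac)
  finally show ?case by (simp add: add.commute del: power_Suc chiral.simps)
qed (simp add: pderiv_pCons)

locale frequency =
  fixes p q :: nat
  assumes coprime_pq: "coprime p q" and odd_q: "odd q"
begin

lemma q_pos: "q > 0"
  using odd_q by (rule odd_pos)

definition om :: complex where
  "om = cis (2 * pi * real p / real q)"

lemma om_nz [simp]: "om \<noteq> 0"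
  by (simp add: om_def)

lemma norm_om [simp]: "cmod om = 1"
  by (simp add: om_def)

lemma om_power: "om ^ k = cis (2 * pi * (real p / real q * real k))"
  by (simp add: om_def Complex.DeMoivre mult_ac)

lemma om_power_q: "om ^ q = 1"
  using q_pos by (simp add: om_power)

lemma om_power_ne_1: "0 < k \<Longrightarrow> k < q \<Longrightarrow> om ^ k \<noteq> 1"
proof
  assume k: "0 < k" "k < q" and "om ^ k = 1"
  then have "cos (2 * pi * (real p / real q * real k)) = 1"
    by (metis om_power cis.sel(1) one_complex.sel(1))
  then obtain n :: int where "2 * pi * (real p / real q * real k) = of_int n * 2 * pi"
    using cos_one_2pi_int by blast
  then have "2 * pi * (real p / real q * real k) = 2 * pi * of_int n" by (simp only: mult_ac)
  then have "real p / real q * real k = of_int n" by (rule mult_left_cancel[THEN iffD1, rotated]) simp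
  then show False using not_Ints_below_denominator[OF coprime_pq, of k] k by (metis Ints_of_int One_nat_def Suc_leI)
qed

lemma om_powi_mult_q: "om powi (int q * n) = 1"
  by (simp add: power_int_mult power_int_of_nat om_power_q)

lemma inj_om: "inj_on (\<lambda>t. om ^ t) {1..q}"
proof (rule linorder_inj_onI')
  fix s t assume st: "s \<in> {1..q}" "t \<in> {1..q}" "s < t"
  then have "om ^ t = om ^ s * om ^ (t - s)" by (simp flip: power_add)
  moreover have "om ^ (t - s) \<noteq> 1" using st by (intro om_power_ne_1) auto
  ultimately show "om ^ s \<noteq> om ^ t" by auto
qed

text \<open>The phase built into the discriminant. Its \<open>q\<close>-th power is the imaginary
  unit, at which the oscillating term of the Chambers formula vanishes.\<close>

definition w_ref :: complex where
  "w_ref = cis (pi / (2 * real q))"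

lemma poly_cpoly_disc_poly: "poly (cpoly (disc_poly p q)) z = - bloch_trace om q z w_ref"
proof -
  have "poly (cpoly (disc_poly p q)) z = - trace2 (transfer (map (\<lambda>j.
     (poly (cpoly [:- (2 * cos (2 * pi * real j * real p / real q + pi / (2 * real q))), 1:]) z, poly (cpoly 1) z)) [1..<Suc q]))"
    unfolding disc_poly_def cpoly_minus poly_minus
    by (subst trace2_transfer_hom[symmetric, where f = "\<lambda>p. poly (cpoly p) z"])
       (simp_all add: o_def case_prod_unfold cpoly_add cpoly_mult cpoly_minus del: upt_Suc)
  also have "(\<lambda>j. (poly (cpoly [:- (2 * cos (2 * pi * real j * real p / real q + pi / (2 * real q))), 1:]) z, poly (cpoly 1) z))
     = (\<lambda>j. (z - (w_ref * om ^ j + 1 / (w_ref * om ^ j)), 1))"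
  proof
    fix j
    have "w_ref * om ^ j = cis (2 * pi * real j * real p / real q + pi / (2 * real q))"
      by (simp add: w_ref_def om_power cis_mult mult_ac add.commute)
    then have "w_ref * om ^ j + 1 / (w_ref * om ^ j) = of_real (2 * cos (2 * pi * real j * real p / real q + pi / (2 * real q)))"
      using unit_add_inverse[of "w_ref * om ^ j"] by simp
    then show "(poly (cpoly [:- (2 * cos (2 * pi * real j * real p / real q + pi / (2 * real q))), 1:]) z, poly (cpoly 1) z)
       = (z - (w_ref * om ^ j + 1 / (w_ref * om ^ j)), 1)"
      by (simp add: cpoly_pCons)
  qed
  finally show ?thesis by (simp only: bloch_trace_def)
qed

lemma bloch_trace_disc_poly:
  assumes "w \<noteq> 0"
  shows "bloch_trace om q z w = - poly (cpoly (disc_poly p q)) z - (w ^ q + 1 / w ^ q)"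
proof -
  obtain c where c: "\<And>w. w \<noteq> 0 \<Longrightarrow> bloch_trace om q z w = c - (w ^ q + 1 / w ^ q)"
    using chambers[OF om_power_q om_power_ne_1 odd_q, of z] by blast
  have "w_ref ^ q = cis (pi / 2)" using q_pos by (simp add: w_ref_def Complex.DeMoivre)
  then have "w_ref ^ q + 1 / w_ref ^ q = 0" by simp
  then have "bloch_trace om q z w_ref = c" using c[of w_ref] by (simp add: w_ref_def)
  then show ?thesis using c[OF assms] poly_cpoly_disc_poly[of z] by simp
qed

text \<open>Phase and multiplier are tied by \<open>w ^ q = lam\<close>. The trace condition then
  reads \<open>lam + 1 / lam = - v - (lam + 1 / lam)\<close>, which has a solution on the unit
  circle exactly for \<open>\<bar>v\<bar> \<le> 4\<close>.\<close>

lemma bloch_wave: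
  assumes "poly (cpoly (disc_poly p q)) z = of_real v" "\<bar>v\<bar> \<le> 4"
  obtains th lam phi where "0 < th" "th \<le> 1" "cmod lam = 1" "\<exists>n::int. phi n \<noteq> 0"
    "\<And>n. phi (n + int q) = lam * phi n"
    "\<And>n. phi (n + 1) + phi (n - 1) + of_real (2 * cos (2 * pi * (real p / real q * real_of_int n + th))) * phi n = z * phi n"
proof -
  define ka where "ka = arccos (- v / 4)"
  have ka: "0 \<le> ka" "ka \<le> pi" "cos ka = - v / 4"
    using assms(2) by (auto simp: ka_def abs_le_iff intro: arccos_lbound arccos_ubound)
  \<comment> \<open>The phase 0 is outside the admissible interval and is represented by 1.\<close>
  define th where "th = (if ka = 0 then 1 else ka / (2 * pi * real q))"
  have th: "0 < th" "th \<le> 1"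
  proof -
    have "1 \<le> real q" using q_pos by simp
    then have "ka \<le> 2 * pi * real q" using ka(2) pi_gt_zero by (smt (verit) mult_le_cancel_left1 mult_pos_pos)
    then show "0 < th" "th \<le> 1" using ka q_pos by (auto simp: th_def)
  qed
  define w where "w = cis (2 * pi * th)"
  define lam where "lam = cis ka"
  have wq: "w ^ q = lam"
  proof (cases "ka = 0")
    case True
    then show ?thesis by (simp add: w_def lam_def th_def)
  next
    case False
    then show ?thesis using q_pos by (simp add: w_def lam_def th_def Complex.DeMoivre)
  qed
  have lam1: "lam + 1 / lam = of_real (- v / 2)"
    using unit_add_inverse[of lam] ka by (simp add: lam_def)
  have tr: "bloch_trace om q z w = lam + 1 / lam"
    unfolding bloch_trace_disc_poly[of w z, unfolded w_def, simplified, folded w_def] assms(1) wq lam1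
    by simp
  have nz: "w \<noteq> 0" "lam \<noteq> 0" by (simp_all add: w_def lam_def)
  obtain phi :: "int \<Rightarrow> complex" where phi: "\<exists>n. phi n \<noteq> 0" "\<And>n. phi (n + int q) = lam * phi n"
    "\<And>n. phi (n + 1) + phi (n - 1) + (w * om powi n + 1 / (w * om powi n)) * phi n = z * phi n"
    using bloch_solution[OF om_power_q om_nz q_pos nz tr] by blast
  have V: "w * om powi n + 1 / (w * om powi n) = of_real (2 * cos (2 * pi * (real p / real q * real_of_int n + th)))" for n
  proof -
    have "w * om powi n = cis (2 * pi * (real p / real q * real_of_int n + th))"
      by (simp add: w_def om_def cis_power_int cis_mult algebra_simps)
    then show ?thesis using unit_add_inverse[of "w * om powi n"] by simp
  qed
  show ?thesis
    using that[of th lam phi] th phi unfolding V by (simp add: lam_def)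
qed

lemma real_rooted_disc_poly:
  assumes "\<bar>v\<bar> \<le> 4"
  shows "real_rooted (disc_poly p q - [:v:])"
  unfolding real_rooted_def
proof (intro allI impI)
  fix z assume "poly (cpoly (disc_poly p q - [:v:])) z = 0"
  then have "poly (cpoly (disc_poly p q)) z = of_real v" by (simp add: cpoly_diff cpoly_pCons)
  then obtain th lam phi where *: "cmod lam = 1" "\<exists>n::int. phi n \<noteq> 0"
    "\<And>n. phi (n + int q) = lam * phi n"
    "\<And>n. phi (n + 1) + phi (n - 1) + of_real (2 * cos (2 * pi * (real p / real q * real_of_int n + th))) * phi n = z * phi n"
    using bloch_wave assms by metis
  show "z \<in> \<real>" by (rule bloch_eigenvalue_real[OF *(3) *(2) *(4) *(1) q_pos])
qed

definition hop :: "nat \<Rightarrow> real" where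
  "hop t = 4 * (sin (pi * (real p / real q * real t)))\<^sup>2"

lemma hop_om: "complex_of_real (hop t) = (1 - om ^ t) * (1 - 1 / om ^ t)"
proof -
  have "(1 - om ^ t) * (1 - 1 / om ^ t) = 2 - (om ^ t + 1 / om ^ t)"
    by (simp add: field_simps)
  also have "om ^ t + 1 / om ^ t = of_real (2 * cos (2 * pi * (real p / real q * real t)))"
    using unit_add_inverse[of "om ^ t"] by (simp add: norm_power) (simp add: om_power)
  also have "2 * cos (2 * pi * (real p / real q * real t)) = 2 - hop t"
    using cos_double_sin[of "pi * (real p / real q * real t)"] by (simp add: hop_def mult_ac)
  finally show ?thesis by simp
qed

end

lemma sum_shift_periodic:
  fixes G :: "int \<Rightarrow> 'a::ab_group_add"
  assumes "\<And>n. G (n + int q) = G n"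
  shows "(\<Sum>j<q. G (int j + 1)) = (\<Sum>j<q. G (int j))"
proof -
  have "(\<Sum>j<q. G (int (Suc j)) - G (int j)) = G (int q) - G 0"
    using sum_lessThan_telescope[of "\<lambda>j. G (int j)" q] by simp
  also have "\<dots> = 0" using assms[of 0] by simp
  finally show ?thesis by (simp add: sum_subtractf add.commute)
qed

lemma prod_even_odd:
  fixes f :: "nat \<Rightarrow> 'a::comm_monoid_mult"
  shows "(\<Prod>t=1..2 * m. f t) = (\<Prod>i=1..m. f (2 * i)) * (\<Prod>i=1..m. f (2 * i - 1))"
proof (induction m)
  case (Suc m)
  have "(\<Prod>t=1..2 * Suc m. f t) = (\<Prod>t=1..2 * m. f t) * f (2 * m + 1) * f (2 * m + 2)"
    by (simp add: mult_ac)
  then show ?case unfolding Suc by (simp add: mult_ac)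
qed simp

context frequency
begin

text \<open>
  The phase is antiperiodic because \<open>q\<close> is odd; its products with the antiperiodic Bloch waves
  are therefore functions on the integers modulo \<open>q\<close>, to which a discrete Fourier transform applies.
\<close>

definition kap :: "int \<Rightarrow> complex" where
  "kap j = (- 1) powi j * om powi (j * (j - 1) div 2)"

lemma kap_Suc: "kap (j + 1) = - (om powi j) * kap j"
proof -
  have "(j + 1) * (j + 1 - 1) = j * (j - 1) + j * 2" by (simp add: algebra_simps)
  then have "(j + 1) * (j + 1 - 1) div 2 = j * (j - 1) div 2 + j" by simp
  then show ?thesis by (simp add: kap_def power_int_add)
qed

lemma kap_pred: "kap (j - 1) = - (om powi (1 - j)) * kap j"
proof -
  have "om powi (1 - j) * om powi (j - 1) = 1" by (simp flip: power_int_add)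
  then show ?thesis using kap_Suc[of "j - 1"] by (simp add: algebra_simps)
qed

lemma kap_nz: "kap j \<noteq> 0"
  by (simp add: kap_def)

lemma kap_period: "kap (j + int q) = - kap j"
proof -
  obtain m where m: "q = 2 * m + 1" using odd_q by (auto elim!: oddE)
  have "(j + int q) * (j + int q - 1) = j * (j - 1) + (int q * (j + int m)) * 2"
    unfolding m by (simp add: algebra_simps)
  then have "(j + int q) * (j + int q - 1) div 2 = j * (j - 1) div 2 + int q * (j + int m)" by simp
  moreover have "(- 1 :: complex) powi int q = - 1" using odd_q by (simp add: power_int_of_nat)
  ultimately show ?thesis
    unfolding kap_def by (simp add: power_int_add om_powi_mult_q)
qed

text \<open>A Vandermonde argument: the \<open>c j\<close> are the coefficients of a polynomial of
  degree below \<open>q\<close> that vanishes at all \<open>q\<close> powers of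
  \<open>om\<close>.\<close>

lemma fourier_injective:
  assumes "\<And>t. 1 \<le> t \<Longrightarrow> t \<le> q \<Longrightarrow> (\<Sum>j<q. c j * (om ^ t) ^ j) = 0" "j < q"
  shows "c j = 0"
proof -
  define D where "D = (\<Sum>j<q. monom (c j) j)"
  have degD: "degree D < q" unfolding D_def
    using q_pos by (intro degree_sum_less) (auto intro: le_less_trans[OF degree_monom_le])
  have "poly D (om ^ t) = 0" if "t \<in> {1..q}" for t
    using assms(1)[of t] that by (simp add: D_def poly_sum poly_monom)
  then have sub: "(\<lambda>t. om ^ t) ` {1..q} \<subseteq> {x. poly D x = 0}" by auto
  have "D \<noteq> 0 \<Longrightarrow> card ((\<lambda>t. om ^ t) ` {1..q}) \<le> card {x. poly D x = 0}"
    using sub by (intro card_mono poly_roots_finite)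
  moreover have "card ((\<lambda>t. om ^ t) ` {1..q}) = q" using card_image[OF inj_om] by simp
  ultimately have "D \<noteq> 0 \<Longrightarrow> q \<le> degree D"
    using card_poly_roots_bound[of D] by linarith
  then have "D = 0" using degD by linarith
  then have "coeff D j = 0" by simp
  then show ?thesis using assms(2) by (simp add: D_def coeff_sum)
qed

text \<open>At a zero of the discriminant the phase \<open>w = 1\<close> has trace -2, hence an
  antiperiodic wave. In the recursion for its transform \<open>chi\<close> hopping and potential
  have merged and no diagonal term is left; one coefficient vanishes at \<open>t = 1\<close>, the
  other at \<open>t = q\<close>, which cuts out a finite Jacobi matrix.\<close>

lemma chiral_zero:
  assumes "poly (disc_poly p q) E = 0"
  shows "poly (chiral hop q) E = 0"
proof -
  have tr: "bloch_trace om q (of_real E) 1 = - 1 + 1 / (- 1)"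
    using bloch_trace_disc_poly[of 1 "of_real E"] assms by (simp add: poly_cpoly_of_real)
  obtain phi :: "int \<Rightarrow> complex" where phi: "\<exists>n. phi n \<noteq> 0" "\<And>n. phi (n + int q) = - 1 * phi n"
    "\<And>n. phi (n + 1) + phi (n - 1) + (1 * om powi n + 1 / (1 * om powi n)) * phi n = of_real E * phi n"
    using bloch_solution[OF om_power_q om_nz q_pos _ _ tr] by (metis neg_equal_0_iff_equal zero_neq_one)
  define K where "K t j = kap j * om powi (j * t) * phi j" for t j :: int
  define chi where "chi t = (\<Sum>j<q. K t (int j))" for t
  have per: "om powi ((j + int q) * t) = om powi (j * t)" for j t
    using om_powi_mult_q[of t] by (simp add: distrib_right power_int_add)
  have rec: "of_real E * chi t = (1 - om powi t) * chi (t + 1) + (1 - om powi (1 - t)) * chi (t - 1)" for t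
  proof -
    \<comment> \<open>The quadratic phase converts the shift of the site into a change of frequency
      from \<open>t\<close> to \<open>t - 1\<close>; \<open>s2\<close> does the same towards
      \<open>t + 1\<close>.\<close>
    have s1: "(\<Sum>j<q. kap (int j) * om powi (int j * t) * phi (int j + 1)) = - (om powi (1 - t)) * chi (t - 1)"
    proof -
      define G where "G j = kap (j - 1) * om powi ((j - 1) * t) * phi j" for j
      have "G (n + int q) = G n" for n
        using kap_period[of "n - 1"] phi(2)[of n] per[of "n - 1" t]
        by (simp add: G_def algebra_simps)
      then have sh: "(\<Sum>j<q. G (int j + 1)) = (\<Sum>j<q. G (int j))" by (rule sum_shift_periodic)
      have GK: "G j = - (om powi (1 - t)) * K (t - 1) j" for j
      proof -
        have "om powi (1 - j) * om powi ((j - 1) * t) = om powi (1 - t) * om powi (j * (t - 1))"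
          by (simp add: algebra_simps flip: power_int_add)
        then show ?thesis unfolding G_def K_def kap_pred by (simp add: algebra_simps)
      qed
      have "(\<Sum>j<q. G (int j)) = - (om powi (1 - t)) * chi (t - 1)"
        by (simp only: GK) (simp add: chi_def sum_distrib_left sum_negf)
      then show ?thesis using sh by (simp add: G_def)
    qed
    have s2: "(\<Sum>j<q. kap (int j) * om powi (int j * t) * phi (int j - 1)) = - (om powi t) * chi (t + 1)"
    proof -
      define G where "G j = kap j * om powi (j * t) * phi (j - 1)" for j
      have "G (n + int q) = G n" for n
        using kap_period[of n] phi(2)[of "n - 1"] per[of n t]
        by (simp add: G_def algebra_simps)
      then have sh: "(\<Sum>j<q. G (int j)) = (\<Sum>j<q. G (int j + 1))" by (rule sum_shift_periodic[symmetric])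
      have GK: "G (j + 1) = - (om powi t) * K (t + 1) j" for j
      proof -
        have "om powi j * om powi ((j + 1) * t) = om powi t * om powi (j * (t + 1))"
          by (simp add: algebra_simps flip: power_int_add)
        then show ?thesis unfolding G_def K_def kap_Suc by (simp add: algebra_simps)
      qed
      have "(\<Sum>j<q. G (int j + 1)) = - (om powi t) * chi (t + 1)"
        by (simp only: GK) (simp add: chi_def sum_distrib_left sum_negf)
      then show ?thesis using sh by (simp add: G_def)
    qed
    have "of_real E * chi t = (\<Sum>j<q. kap (int j) * om powi (int j * t) * (of_real E * phi (int j)))"
      by (simp add: chi_def K_def sum_distrib_left mult_ac)
    also have "\<dots> = (\<Sum>j<q. kap (int j) * om powi (int j * t) * phi (int j + 1) +
        kap (int j) * om powi (int j * t) * phi (int j - 1) + K (t + 1) (int j) + K (t - 1) (int j))"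
    proof (intro sum.cong refl)
      fix j
      have f: "om powi (int j * (t + 1)) = om powi (int j * t) * om powi int j"
        "om powi (int j * (t - 1)) = om powi (int j * t) * (1 / om powi int j)"
        by (simp_all add: algebra_simps power_int_add power_int_diff)
      show "kap (int j) * om powi (int j * t) * (of_real E * phi (int j)) =
        kap (int j) * om powi (int j * t) * phi (int j + 1) +
        kap (int j) * om powi (int j * t) * phi (int j - 1) + K (t + 1) (int j) + K (t - 1) (int j)"
        unfolding phi(3)[symmetric] K_def f by (simp only: mult_1_left distrib_left distrib_right) (simp add: algebra_simps)
    qed
    also have "\<dots> = (1 - om powi t) * chi (t + 1) + (1 - om powi (1 - t)) * chi (t - 1)"
      unfolding sum.distrib s1 s2 by (simp add: chi_def[symmetric] algebra_simps)
    finally show ?thesis .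
  qed
  \<comment> \<open>Multiplying by \<open>Pi\<close> avoids the divisions by
    \<open>1 - om ^ s\<close> that solving the recursion upwards would need, and makes
    \<open>t = q\<close> accessible.\<close>
  define Pi where "Pi t = (\<Prod>s=1..t. 1 - om ^ s)" for t
  have main: "chi (int (Suc t)) * Pi t = of_real (poly (chiral hop t) E) * chi 1 \<and>
     chi (int (Suc (Suc t))) * Pi (Suc t) = of_real (poly (chiral hop (Suc t)) E) * chi 1" for t
  proof (induction t)
    case 0
    show ?case using rec[of 1] by (simp add: Pi_def)
  next
    case (Suc t)
    have IH: "chi (int (Suc t)) * Pi t = of_real (poly (chiral hop t) E) * chi 1"
      "chi (int (Suc (Suc t))) * Pi (Suc t) = of_real (poly (chiral hop (Suc t)) E) * chi 1"
      using Suc.IH by auto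
    have e: "om powi int (Suc (Suc t)) = om ^ Suc (Suc t)" "om powi (1 - int (Suc (Suc t))) = 1 / om ^ Suc t"
      by (simp_all only: power_int_of_nat) (simp add: power_int_minus power_int_of_nat field_simps power_int_diff power_int_add)
    have "chi (int (Suc (Suc (Suc t)))) * Pi (Suc (Suc t)) =
        ((1 - om ^ Suc (Suc t)) * chi (int (Suc (Suc t)) + 1)) * Pi (Suc t)"
      by (simp add: Pi_def algebra_simps)
    also have "(1 - om ^ Suc (Suc t)) * chi (int (Suc (Suc t)) + 1) =
        of_real E * chi (int (Suc (Suc t))) - (1 - 1 / om ^ Suc t) * chi (int (Suc t))"
      using rec[of "int (Suc (Suc t))"] unfolding e by simp
    also have "(\<dots>) * Pi (Suc t) = of_real E * (chi (int (Suc (Suc t))) * Pi (Suc t)) -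
        ((1 - om ^ Suc t) * (1 - 1 / om ^ Suc t)) * (chi (int (Suc t)) * Pi t)"
    proof -
      have "Pi (Suc t) = Pi t * (1 - om ^ Suc t)" by (simp add: Pi_def mult.commute)
      moreover have "(a * u - r * v) * (x * y) = a * (u * (x * y)) - (y * r) * (v * x)" for a u r v x y :: complex
        by (simp add: algebra_simps)
      ultimately show ?thesis by (simp only:)
    qed
    also have "\<dots> = of_real (poly (chiral hop (Suc (Suc t))) E) * chi 1"
      unfolding IH hop_om[symmetric] by (simp add: algebra_simps)
    finally show ?case using IH by blast
  qed
  have Piq: "Pi q = 0" using om_power_q q_pos by (auto simp: Pi_def prod_zero_iff intro!: bexI[of _ q])
  \<comment> \<open>If \<open>chi 1\<close> were 0, the recursion would give
    \<open>chi t = 0\<close> for all \<open>t\<close> up to \<open>q\<close>, and Fourier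
    injectivity would annihilate the wave.\<close>
  have nz: "chi 1 \<noteq> 0"
  proof
    assume chi1: "chi 1 = 0"
    have "kap (int j) * phi (int j) = 0" if "j < q" for j
    proof (rule fourier_injective[OF _ that])
      fix t assume t: "1 \<le> t" "t \<le> q"
      then obtain t' where t': "t = Suc t'" by (cases t) auto
      have "Pi t' \<noteq> 0" using om_power_ne_1 t by (auto simp: Pi_def prod_zero_iff t')
      then have "chi (int t) = 0" using main[of t'] chi1 t' by simp
      then show "(\<Sum>j<q. kap (int j) * phi (int j) * (om ^ t) ^ j) = 0"
      proof -
        have "om powi (int j * int t) = (om ^ t) ^ j" for j
          by (simp only: of_nat_mult[symmetric] power_int_of_nat power_mult[symmetric] mult.commute)
        then show ?thesis using \<open>chi (int t) = 0\<close> unfolding chi_def K_def by (simp add: mult_ac)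
      qed
    qed
    then have z: "phi (int j) = 0" if "j < q" for j using that kap_nz by simp
    have step: "phi (n + int q) = 0 \<longleftrightarrow> phi n = 0" for n using phi(2)[of n] by simp
    have stepk: "phi (n + int (k * q)) = 0 \<longleftrightarrow> phi n = 0" for n k
    proof (induction k)
      case (Suc k)
      have "n + int (Suc k * q) = (n + int (k * q)) + int q" by (simp add: algebra_simps)
      then show ?case using step[of "n + int (k * q)"] Suc by (simp only:)
    qed simp
    have z': "phi (int m) = 0" for m
    proof -
      have "int m = int (m mod q) + int ((m div q) * q)" by (metis mod_div_mult_eq of_nat_add)
      then show ?thesis using stepk[of "int (m mod q)" "m div q"] z[of "m mod q"] q_pos by simp
    qed
    have "phi n = 0" for n
    proof -
      have "int (nat \<bar>n\<bar>) * 1 \<le> int (nat \<bar>n\<bar>) * int q" using q_pos by (intro mult_left_mono) auto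
      then have "n + int (nat \<bar>n\<bar> * q) \<ge> 0" by simp
      then obtain m where "n + int (nat \<bar>n\<bar> * q) = int m" by (metis nonneg_int_cases)
      then show ?thesis using stepk[of n "nat \<bar>n\<bar>"] z'[of m] by simp
    qed
    then show False using phi(1) by blast
  qed
  show ?thesis using main[of q] Piq nz by simp
qed

text \<open>Critical values of modulus at least 4 make the \<open>q\<close> real zeros of the
  discriminant simple, and each is a zero of \<open>chiral hop q\<close>. The leading coefficients
  -1 and 1 cancel, so the sum has degree below \<open>q\<close> and yet \<open>q\<close>
  zeros.\<close>

theorem disc_poly_chiral: "disc_poly p q = - chiral hop q"
proof (rule ccontr)
  define f where "f = disc_poly p q"
  assume "\<not> disc_poly p q = - chiral hop q"
  then have nz: "f + chiral hop q \<noteq> 0" unfolding f_def by (metis add_eq_0_iff2)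
  have deg: "degree f \<le> q" "coeff f q = - 1" using disc_poly_degree[OF q_pos] by (auto simp: f_def)
  then have degf: "degree f = q" by (metis le_antisym le_degree neg_equal_0_iff_equal zero_neq_one)
  have rr: "\<And>v. \<bar>v\<bar> \<le> 4 \<Longrightarrow> real_rooted (f - [:v:])" unfolding f_def by (rule real_rooted_disc_poly)
  have f0: "f \<noteq> 0" using deg by auto
  have card: "card {x. poly f x = 0} = q"
    unfolding degf[symmetric]
  proof (rule real_rooted_simple_imp_card)
    show "real_rooted f" using rr[of 0] by simp
    fix x assume "poly f x = 0"
    then show "poly (pderiv f) x \<noteq> 0"
      using critical_value_bound[of 4 f x] rr degf q_pos by auto
  qed (rule f0)
  have d1: "degree (f + chiral hop q) \<le> q" "coeff (f + chiral hop q) q = 0"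
    using deg chiral_degree[of hop q] by (auto intro!: degree_add_le)
  have "degree (f + chiral hop q) < q"
    using d1 nz by (metis le_neq_implies_less leading_coeff_neq_0)
  moreover have "card {x. poly f x = 0} \<le> card {x. poly (f + chiral hop q) x = 0}"
    using chiral_zero poly_roots_finite[OF nz] by (intro card_mono) (auto simp: f_def)
  ultimately show False using card card_poly_roots_bound[OF nz] by linarith
qed

text \<open>Two factorizations of \<open>x ^ q - 1\<close> are compared; the cofactors of
  \<open>x - 1\<close> are evaluated at 1.\<close>

lemma prod_one_minus_om: "(\<Prod>t=1..<q. 1 - om ^ t) = of_nat q"
proof -
  define X where "X = (monom 1 q - 1 :: complex poly)"
  have lead: "degree X = q" "coeff X q = 1"
  proof -
    show c: "coeff X q = 1" using q_pos by (simp add: X_def)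
    have "degree X \<le> q" unfolding X_def by (intro degree_diff_le) (auto simp: degree_monom_le)
    then show "degree X = q" using c by (metis le_antisym le_degree zero_neq_one)
  qed
  define Y where "Y = (\<Prod>t<q. [:- (om ^ t), 1:])"
  have degY: "degree Y = q" unfolding Y_def by (simp add: degree_prod_sum_eq)
  have leadY: "coeff Y q = 1" using lead_coeff_prod[of "\<lambda>t. [:- (om ^ t), 1:]" "{..<q}"] degY
    by (simp add: Y_def)
  have inj: "inj_on (\<lambda>t. om ^ t) {..<q}"
  proof (rule linorder_inj_onI')
    fix s t assume st: "s \<in> {..<q}" "t \<in> {..<q}" "s < t"
    then have "om ^ t = om ^ s * om ^ (t - s)" by (simp flip: power_add)
    moreover have "om ^ (t - s) \<noteq> 1" using st by (intro om_power_ne_1) auto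
    ultimately show "om ^ s \<noteq> om ^ t" by auto
  qed
  have "X = Y"
  proof (rule ccontr)
    assume "X \<noteq> Y"
    then have nz: "X - Y \<noteq> 0" by simp
    have "degree (X - Y) \<le> q" using lead degY by (intro degree_diff_le) auto
    moreover have "coeff (X - Y) q = 0" using lead leadY by simp
    ultimately have "degree (X - Y) < q" using nz by (metis le_neq_implies_less leading_coeff_neq_0)
    moreover have "poly (X - Y) (om ^ t) = 0" if "t < q" for t
    proof -
      have "poly Y (om ^ t) = 0" unfolding Y_def poly_prod using that by (auto simp: prod_zero_iff)
      moreover have "poly X (om ^ t) = 0"
        by (simp add: X_def poly_monom power_mult[symmetric]) (metis mult.commute om_power_q power_mult power_one)
      ultimately show ?thesis by simp
    qed
    then have "card ((\<lambda>t. om ^ t) ` {..<q}) \<le> card {x. poly (X - Y) x = 0}"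
      using poly_roots_finite[OF nz] by (intro card_mono) auto
    ultimately show False using card_poly_roots_bound[OF nz] by (simp add: card_image[OF inj])
  qed
  moreover have "Y = [:- 1, 1:] * (\<Prod>t=1..<q. [:- (om ^ t), 1:])"
    unfolding Y_def lessThan_atLeast0 using q_pos by (simp add: prod.atLeast_Suc_lessThan)
  moreover have "X = [:- 1, 1:] * (\<Sum>k<q. monom 1 k)"
  proof (rule poly_eq_poly_eq_iff[THEN iffD1], rule ext)
    fix x
    show "poly X x = poly ([:- 1, 1:] * (\<Sum>k<q. monom 1 k)) x"
      using power_diff_1_eq[of x q] by (simp add: X_def poly_monom poly_sum left_diff_distrib)
  qed
  ultimately have "(\<Prod>t=1..<q. [:- (om ^ t), 1:]) = (\<Sum>k<q. monom 1 k)" by (metis mult_left_cancel pCons_eq_0_iff zero_neq_one)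
  then have "poly (\<Prod>t=1..<q. [:- (om ^ t), 1:]) 1 = poly (\<Sum>k<q. monom 1 k) 1" by simp
  then show ?thesis by (simp add: poly_prod poly_sum poly_monom)
qed

lemma hop_complement: "t \<le> q \<Longrightarrow> complex_of_real (hop t) = (1 - om ^ t) * (1 - om ^ (q - t))"
  using hop_om[of t] om_power_q by (simp add: power_diff)

text \<open>Each term splits into factors with exponents \<open>2 * i\<close> and
  \<open>q - 2 * i\<close>; as \<open>q\<close> is odd, these run through the even and the odd
  numbers below \<open>q\<close> once each.\<close>

lemma prod_hop_even:
  assumes "q = 2 * m + 1"
  shows "(\<Prod>i=1..m. hop (2 * i)) = real q"
proof -
  have "complex_of_real (\<Prod>i=1..m. hop (2 * i)) =
      (\<Prod>i=1..m. (1 - om ^ (2 * i)) * (1 - om ^ (q - 2 * i)))"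
    unfolding of_real_prod by (intro prod.cong refl hop_complement) (use assms in auto)
  also have "\<dots> = (\<Prod>i=1..m. 1 - om ^ (2 * i)) * (\<Prod>i=1..m. 1 - om ^ (q - 2 * i))"
    by (rule prod.distrib)
  also have "(\<Prod>i=1..m. 1 - om ^ (q - 2 * i)) = (\<Prod>i=1..m. 1 - om ^ (2 * i - 1))"
    by (subst prod.atLeastAtMost_rev) (intro prod.cong, auto simp: assms algebra_simps intro!: arg_cong[of _ _ "\<lambda>k. om ^ k"])
  also have "(\<Prod>i=1..m. 1 - om ^ (2 * i)) * (\<Prod>i=1..m. 1 - om ^ (2 * i - 1)) = (\<Prod>t=1..2 * m. 1 - om ^ t)"
    by (rule prod_even_odd[symmetric])
  also have "{1..2 * m} = {1..<q}" using assms by auto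
  also have "(\<Prod>t=1..<q. 1 - om ^ t) = complex_of_real (real q)" using prod_one_minus_om by simp
  finally show ?thesis using of_real_eq_iff by blast
qed

end

section \<open>Spectra on the square-summable sequences\<close>

text \<open>Testing on finite sets expresses membership in \<open>l2Z\<close> and a norm bound at
  once, and makes Minkowski's inequality for finite sums applicable.\<close>

definition l2_bound :: "(int \<Rightarrow> complex) \<Rightarrow> real \<Rightarrow> bool" where
  "l2_bound phi c \<longleftrightarrow> (\<forall>F. finite F \<longrightarrow> L2_set (\<lambda>n. cmod (phi n)) F \<le> c)"

lemma l2_bound_nonneg: "l2_bound phi c \<Longrightarrow> c \<ge> 0"
  unfolding l2_bound_def by (metis L2_set_empty finite.emptyI)

lemma l2_bound_pointwise: "l2_bound phi c \<Longrightarrow> cmod (phi n) \<le> c"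
  unfolding l2_bound_def by (drule spec[of _ "{n}"]) simp

lemma l2_bound_sum: "l2_bound phi c \<longleftrightarrow> c \<ge> 0 \<and> (\<forall>F. finite F \<longrightarrow> (\<Sum>n\<in>F. (cmod (phi n))\<^sup>2) \<le> c\<^sup>2)"
proof (cases "c \<ge> 0")
  case True
  have "sqrt x \<le> c \<longleftrightarrow> x \<le> c\<^sup>2" if "x \<ge> 0" for x
    using True that by (metis real_le_lsqrt sqrt_le_D)
  then show ?thesis using True by (simp add: l2_bound_def L2_set_def sum_nonneg)
next
  case False
  then show ?thesis using l2_bound_nonneg[of phi c] by blast
qed

lemma l2_bound_imp_l2Z:
  assumes "l2_bound phi c"
  shows "phi \<in> l2Z" "norm_l2Z phi \<le> c"
proof -
  have c: "c \<ge> 0" "\<And>F. finite F \<Longrightarrow> (\<Sum>n\<in>F. (cmod (phi n))\<^sup>2) \<le> c\<^sup>2"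
    using assms by (auto simp: l2_bound_sum)
  have s: "(\<lambda>n. (cmod (phi n))\<^sup>2) summable_on UNIV"
    by (rule nonneg_bdd_above_summable_on) (use c in \<open>auto intro!: bdd_aboveI2[where M = "c\<^sup>2"]\<close>)
  then show "phi \<in> l2Z" by (simp add: l2Z_def)
  have "(\<Sum>\<^sub>\<infinity>n. (cmod (phi n))\<^sup>2) \<le> c\<^sup>2"
    by (rule infsum_le_finite_sums[OF s]) (use c in auto)
  then show "norm_l2Z phi \<le> c" unfolding norm_l2Z_def using c(1) by (intro real_le_lsqrt)
      (auto intro: infsum_nonneg)
qed

lemma l2Z_imp_l2_bound:
  assumes "phi \<in> l2Z"
  shows "l2_bound phi (norm_l2Z phi)"
proof -
  have "0 \<le> (\<Sum>\<^sub>\<infinity>n. (cmod (phi n))\<^sup>2)" by (rule infsum_nonneg) simp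
  moreover have "(\<Sum>n\<in>F. (cmod (phi n))\<^sup>2) \<le> (\<Sum>\<^sub>\<infinity>n. (cmod (phi n))\<^sup>2)" if "finite F" for F
    using assms that by (intro finite_sum_le_infsum) (auto simp: l2Z_def)
  ultimately show ?thesis by (simp add: l2_bound_sum norm_l2Z_def)
qed

lemma l2_bound_add:
  assumes "l2_bound phi c" "l2_bound psi d"
  shows "l2_bound (\<lambda>n. phi n + psi n) (c + d)"
  unfolding l2_bound_def
proof (intro allI impI)
  fix F :: "int set" assume F: "finite F"
  have "L2_set (\<lambda>n. cmod (phi n + psi n)) F \<le> L2_set (\<lambda>n. cmod (phi n) + cmod (psi n)) F"
    by (rule L2_set_mono) (auto simp: norm_triangle_ineq)
  also have "\<dots> \<le> L2_set (\<lambda>n. cmod (phi n)) F + L2_set (\<lambda>n. cmod (psi n)) F"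
    by (rule L2_set_triangle_ineq)
  also have "\<dots> \<le> c + d" using assms F unfolding l2_bound_def by (intro add_mono) auto
  finally show "L2_set (\<lambda>n. cmod (phi n + psi n)) F \<le> c + d" .
qed

lemma l2_bound_mult:
  assumes "l2_bound phi c" "\<And>n. cmod (g n) \<le> k"
  shows "l2_bound (\<lambda>n. g n * phi n) (k * c)"
  unfolding l2_bound_def
proof (intro allI impI)
  fix F :: "int set" assume F: "finite F"
  have k: "k \<ge> 0" using assms(2)[of 0] norm_ge_zero order_trans by blast
  have "L2_set (\<lambda>n. cmod (g n * phi n)) F \<le> L2_set (\<lambda>n. k * cmod (phi n)) F"
    using assms(2) by (intro L2_set_mono) (auto simp: norm_mult mult_right_mono)
  also have "\<dots> = k * L2_set (\<lambda>n. cmod (phi n)) F"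
    using k by (simp add: L2_set_right_distrib)
  also have "\<dots> \<le> k * c" using assms(1) F k unfolding l2_bound_def by (intro mult_left_mono) auto
  finally show "L2_set (\<lambda>n. cmod (g n * phi n)) F \<le> k * c" .
qed

lemma l2_bound_shift:
  assumes "l2_bound phi c"
  shows "l2_bound (\<lambda>n. phi (n + s)) c"
  unfolding l2_bound_def
proof (intro allI impI)
  fix F :: "int set" assume F: "finite F"
  have "L2_set (\<lambda>n. cmod (phi (n + s))) F = L2_set (\<lambda>n. cmod (phi n)) ((\<lambda>n. n + s) ` F)"
    unfolding L2_set_def by (simp add: sum.reindex[of "\<lambda>n. n + s" F] inj_on_def o_def)
  also have "\<dots> \<le> c" using assms F by (simp add: l2_bound_def)
  finally show "L2_set (\<lambda>n. cmod (phi (n + s))) F \<le> c" .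
qed

lemma H_op_l2_bound:
  assumes "l2_bound phi c"
  shows "l2_bound (H_op al th phi) (4 * c)"
proof -
  define V where "V n = complex_of_real (2 * cos (2 * pi * (al * real_of_int n + th)))" for n
  have 1: "l2_bound (\<lambda>n. phi (n + (- 1)) + phi (n + 1)) (c + c)"
    by (rule l2_bound_add[OF l2_bound_shift[OF assms, of "- 1"] l2_bound_shift[OF assms, of 1]])
  have V: "cmod (V n) \<le> 2" for n
    unfolding V_def norm_of_real by (simp add: abs_mult)
  have 2: "l2_bound (\<lambda>n. V n * phi n) (2 * c)"
    by (rule l2_bound_mult[where g = V, OF assms V])
  have "H_op al th phi = (\<lambda>n. (phi (n + (- 1)) + phi (n + 1)) + V n * phi n)"
    by (simp add: H_op_def V_def)
  moreover have "l2_bound (\<lambda>n. (phi (n + (- 1)) + phi (n + 1)) + V n * phi n) ((c + c) + 2 * c)"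
    by (rule l2_bound_add[OF 1 2])
  moreover have "(c + c) + 2 * c = 4 * c" by simp
  ultimately show ?thesis by metis
qed

lemma H_op_add: "H_op al th (\<lambda>n. phi n + psi n) = (\<lambda>n. H_op al th phi n + H_op al th psi n)"
  by (simp add: H_op_def fun_eq_iff algebra_simps)

lemma H_op_scale: "H_op al th (\<lambda>n. c * phi n) = (\<lambda>n. c * H_op al th phi n)"
  by (simp add: H_op_def fun_eq_iff algebra_simps)

lemma H_op_pow_add: "(H_op al th ^^ k) (\<lambda>n. phi n + psi n) = (\<lambda>n. (H_op al th ^^ k) phi n + (H_op al th ^^ k) psi n)"
  by (induction k) (simp_all add: H_op_add)

lemma H_op_pow_scale: "(H_op al th ^^ k) (\<lambda>n. c * phi n) = (\<lambda>n. c * (H_op al th ^^ k) phi n)"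
  by (induction k) (simp_all add: H_op_scale)

lemma H_op_pow_l2_bound:
  assumes "l2_bound phi c"
  shows "l2_bound ((H_op al th ^^ k) phi) (4 ^ k * c)"
proof (induction k)
  case (Suc k)
  show ?case using H_op_l2_bound[OF Suc, of al th] by (simp add: mult_ac)
qed (use assms in simp)

text \<open>Neumann series: the operator norm is at most 4, so the geometric series of powers,
  summed pointwise, gives the resolvent with bound \<open>1 / (E - 4)\<close>. It serves to bound
  the spectral set above, so that the supremum in \<open>w0\<close> dominates every point of the
  band.\<close>

lemma not_in_spectrum_above_4:
  assumes E: "E > 4"
  shows "complex_of_real E \<notin> spectrum_l2Z (H_op al th)"
proof -
  define T where "T = H_op al th"
  define z where "z = complex_of_real E"
  have z0: "z \<noteq> 0" using E by (simp add: z_def)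
  define R where "R phi n = - (\<Sum>k. (T ^^ k) phi n / z ^ Suc k)" for phi n
  have bnd: "cmod ((T ^^ k) phi n / z ^ k) \<le> (4 / E) ^ k * c" if "l2_bound phi c" for phi c k n
  proof -
    have "cmod ((T ^^ k) phi n) \<le> 4 ^ k * c"
      using l2_bound_pointwise[OF H_op_pow_l2_bound[OF that]] by (simp add: T_def)
    then show ?thesis using E
      by (simp add: norm_divide norm_power z_def power_divide divide_right_mono)
  qed
  have geo: "summable (\<lambda>k. (4 / E) ^ k * c)" for c
    using E by (intro summable_mult2 summable_geometric) auto
  have summ: "summable (\<lambda>k. (T ^^ k) phi n / z ^ k)" if "phi \<in> l2Z" for phi n
    using bnd[OF l2Z_imp_l2_bound[OF that]] by (intro summable_comparison_test'[OF geo]) blast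
  have summ': "summable (\<lambda>k. (T ^^ k) phi n / z ^ Suc k)" if "phi \<in> l2Z" for phi n
    using summable_divide[OF summ[OF that, of n], of z] by (simp add: mult.commute)
  have lim: "(\<lambda>k. (T ^^ k) phi n / z ^ k) \<longlonglongrightarrow> 0" if "phi \<in> l2Z" for phi n
    by (rule summable_LIMSEQ_zero[OF summ[OF that]])
  have R_sums: "(\<lambda>k. (T ^^ k) phi n / z ^ Suc k) sums (- R phi n)" if "phi \<in> l2Z" for phi n
    using summ'[OF that] by (simp add: R_def summable_sums)
  have tele: "(\<lambda>k. (T ^^ Suc k) phi n / z ^ Suc k - (T ^^ k) phi n / z ^ k) sums (- phi n)" if "phi \<in> l2Z" for phi n
    using telescope_sums[OF lim[OF that, of n]] by simp
  have R_bound: "l2_bound (R phi) (c / (E - 4))" if l: "l2_bound phi c" for phi c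
    unfolding l2_bound_def
  proof (intro allI impI)
    fix F :: "int set" assume F: "finite F"
    have phi: "phi \<in> l2Z" using l2_bound_imp_l2Z l by blast
    have c0: "c \<ge> 0" using l2_bound_nonneg[OF l] .
    have part: "L2_set (\<lambda>n. cmod (\<Sum>k<K. (T ^^ k) phi n / z ^ Suc k)) F \<le> (\<Sum>k<K. (4 / E) ^ k * (c / E))" for K
    proof (induction K)
      case (Suc K)
      have "L2_set (\<lambda>n. cmod (\<Sum>k<Suc K. (T ^^ k) phi n / z ^ Suc k)) F \<le>
         L2_set (\<lambda>n. cmod (\<Sum>k<K. (T ^^ k) phi n / z ^ Suc k) + cmod ((T ^^ K) phi n / z ^ Suc K)) F"
        by (intro L2_set_mono) (simp_all add: norm_triangle_ineq del: power_Suc)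
      also have "\<dots> \<le> L2_set (\<lambda>n. cmod (\<Sum>k<K. (T ^^ k) phi n / z ^ Suc k)) F + L2_set (\<lambda>n. cmod ((T ^^ K) phi n / z ^ Suc K)) F"
        by (rule L2_set_triangle_ineq)
      also have "L2_set (\<lambda>n. cmod ((T ^^ K) phi n / z ^ Suc K)) F \<le> (4 / E) ^ K * (c / E)"
      proof -
        have "L2_set (\<lambda>n. cmod ((1 / z ^ Suc K) * (T ^^ K) phi n)) F \<le> (1 / E ^ Suc K) * (4 ^ K * c)"
          using l2_bound_mult[OF H_op_pow_l2_bound[OF l, of K al th], of "\<lambda>_. 1 / z ^ Suc K" "1 / E ^ Suc K"] F E
          unfolding l2_bound_def T_def[symmetric] by (auto simp: norm_divide norm_mult norm_power z_def)
        then show ?thesis by (simp add: power_divide mult.commute)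
      qed
      finally show ?case using Suc by simp
    qed (simp add: L2_set_def)
    have "(\<Sum>k<K. (4 / E) ^ k * (c / E)) \<le> c / (E - 4)" for K
    proof -
      have "(\<Sum>k<K. (4 / E) ^ k * (c / E)) \<le> (\<Sum>k. (4 / E) ^ k * (c / E))"
        using E c0 by (intro sum_le_suminf geo) auto
      also have "\<dots> = (\<Sum>k. (4 / E) ^ k) * (c / E)"
        using E by (intro suminf_mult2[symmetric] summable_geometric) auto
      also have "\<dots> = c / (E - 4)" using E by (subst suminf_geometric) (auto simp: field_simps)
      finally show ?thesis .
    qed
    then have "L2_set (\<lambda>n. cmod (\<Sum>k<K. (T ^^ k) phi n / z ^ Suc k)) F \<le> c / (E - 4)" for K
      using part order_trans by blast
    moreover have "(\<lambda>K. L2_set (\<lambda>n. cmod (\<Sum>k<K. (T ^^ k) phi n / z ^ Suc k)) F) \<longlonglongrightarrow> L2_set (\<lambda>n. cmod (- R phi n)) F"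
      unfolding L2_set_def using R_sums[OF phi] by (intro tendsto_intros) (simp add: sums_def)
    ultimately show "L2_set (\<lambda>n. cmod (R phi n)) F \<le> c / (E - 4)"
      by (simp add: LIMSEQ_le_const2)
  qed
  have l2_add: "(\<lambda>n. phi n + psi n) \<in> l2Z" if "phi \<in> l2Z" "psi \<in> l2Z" for phi psi
    using l2_bound_add[OF l2Z_imp_l2_bound[OF that(1)] l2Z_imp_l2_bound[OF that(2)]] l2_bound_imp_l2Z by blast
  have l2_scale: "(\<lambda>n. c * phi n) \<in> l2Z" if "phi \<in> l2Z" for phi c
    using l2_bound_mult[OF l2Z_imp_l2_bound[OF that], of "\<lambda>_. c" "cmod c"] l2_bound_imp_l2Z by auto
  have bdd: "bounded_op_l2Z R"
    unfolding bounded_op_l2Z_def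
  proof (intro conjI ballI allI)
    fix phi assume phi: "phi \<in> l2Z"
    show "R phi \<in> l2Z" using R_bound[OF l2Z_imp_l2_bound[OF phi]] l2_bound_imp_l2Z by blast
    show "R (\<lambda>n. c * phi n) = (\<lambda>n. c * R phi n)" for c
    proof
      fix n
      have "(\<lambda>k. c * ((T ^^ k) phi n / z ^ Suc k)) sums (c * - R phi n)" by (intro sums_mult R_sums phi)
      moreover have "(\<lambda>k. c * ((T ^^ k) phi n / z ^ Suc k)) sums (- R (\<lambda>n. c * phi n) n)"
        using R_sums[OF l2_scale[OF phi, of c], of n] unfolding T_def H_op_pow_scale by simp
      ultimately show "R (\<lambda>n. c * phi n) n = c * R phi n" using sums_unique2 by fastforce
    qed
    fix psi assume psi: "psi \<in> l2Z"
    show "R (\<lambda>n. phi n + psi n) = (\<lambda>n. R phi n + R psi n)"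
    proof
      fix n
      have "(\<lambda>k. (T ^^ k) phi n / z ^ Suc k + (T ^^ k) psi n / z ^ Suc k) sums (- R phi n + - R psi n)"
        by (intro sums_add R_sums phi psi)
      moreover have "(\<lambda>k. (T ^^ k) phi n / z ^ Suc k + (T ^^ k) psi n / z ^ Suc k) sums (- R (\<lambda>n. phi n + psi n) n)"
        using R_sums[OF l2_add[OF phi psi], of n] unfolding T_def H_op_pow_add by (simp add: add_divide_distrib)
      ultimately have "- R phi n + - R psi n = - R (\<lambda>n. phi n + psi n) n" by (rule sums_unique2)
      then show "R (\<lambda>n. phi n + psi n) n = R phi n + R psi n" by (simp add: algebra_simps)
    qed
  next
    have "norm_l2Z (R phi) \<le> 1 / (E - 4) * norm_l2Z phi" if "phi \<in> l2Z" for phi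
      using l2_bound_imp_l2Z(2)[OF R_bound[OF l2Z_imp_l2_bound[OF that]]] by simp
    then show "\<exists>C. \<forall>phi\<in>l2Z. norm_l2Z (R phi) \<le> C * norm_l2Z phi" by blast
  qed
  moreover have "R (\<lambda>n. T phi n - z * phi n) = phi" if phi: "phi \<in> l2Z" for phi
  proof
    fix n
    have Tphi: "T phi \<in> l2Z"
      using H_op_l2_bound[OF l2Z_imp_l2_bound[OF phi], of al th] l2_bound_imp_l2Z unfolding T_def by blast
    have e: "(\<lambda>n. T phi n - z * phi n) = (\<lambda>n. T phi n + (- z) * phi n)" by simp
    have l: "(\<lambda>n. T phi n - z * phi n) \<in> l2Z" unfolding e by (intro l2_add l2_scale Tphi phi)
    have "(T ^^ k) (\<lambda>n. T phi n - z * phi n) n / z ^ Suc k = (T ^^ Suc k) phi n / z ^ Suc k - (T ^^ k) phi n / z ^ k" for k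
    proof -
      have "(T ^^ k) (\<lambda>n. T phi n - z * phi n) n = (T ^^ k) (T phi) n - z * (T ^^ k) phi n"
        unfolding e unfolding T_def H_op_pow_add H_op_pow_scale by simp
      also have "(T ^^ k) (T phi) = (T ^^ Suc k) phi" by (simp add: funpow_swap1)
      finally show ?thesis using z0 by (simp add: field_simps)
    qed
    then have "(\<lambda>k. (T ^^ Suc k) phi n / z ^ Suc k - (T ^^ k) phi n / z ^ k) sums (- R (\<lambda>n. T phi n - z * phi n) n)"
      using R_sums[OF l, of n] by simp
    then show "R (\<lambda>n. T phi n - z * phi n) n = phi n" using tele[OF phi, of n] sums_unique2 by fastforce
  qed
  moreover have "(\<lambda>n. T (R phi) n - z * R phi n) = phi" if phi: "phi \<in> l2Z" for phi
  proof
    fix n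
    define V where "V = complex_of_real (2 * cos (2 * pi * (al * real_of_int n + th)))"
    have Tn: "T psi n = psi (n - 1) + psi (n + 1) + V * psi n" for psi by (simp add: T_def H_op_def V_def)
    have "(\<lambda>k. ((T ^^ k) phi (n - 1) / z ^ Suc k + (T ^^ k) phi (n + 1) / z ^ Suc k + V * ((T ^^ k) phi n / z ^ Suc k))
        - z * ((T ^^ k) phi n / z ^ Suc k))
      sums ((- R phi (n - 1) + - R phi (n + 1) + V * - R phi n) - z * - R phi n)"
      by (intro sums_add sums_diff sums_mult R_sums phi)
    moreover have "((T ^^ k) phi (n - 1) / z ^ Suc k + (T ^^ k) phi (n + 1) / z ^ Suc k + V * ((T ^^ k) phi n / z ^ Suc k))
        - z * ((T ^^ k) phi n / z ^ Suc k) = (T ^^ Suc k) phi n / z ^ Suc k - (T ^^ k) phi n / z ^ k" for k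
    proof -
      have "(T ^^ Suc k) phi n = (T ^^ k) phi (n - 1) + (T ^^ k) phi (n + 1) + V * (T ^^ k) phi n"
        by (simp add: Tn)
      then show ?thesis using z0 by (simp add: add_divide_distrib)
    qed
    ultimately have "(- R phi (n - 1) + - R phi (n + 1) + V * - R phi n) - z * - R phi n = - phi n"
      using tele[OF phi, of n] sums_unique2 by fastforce
    then show "T (R phi) n - z * R phi n = phi n" unfolding Tn by (simp add: algebra_simps)
  qed
  ultimately show ?thesis unfolding spectrum_l2Z_def T_def[symmetric] z_def[symmetric] by blast
qed

text \<open>Weyl's argument: a bounded solution cut off outside \<open>0, ..., N - 1\<close>
  violates the equation only near the two cuts, with an error bounded independently of
  \<open>N\<close>, while its norm grows without bound. No bounded inverse allows this.\<close>

lemma generalized_eigenfunction_in_spectrum: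
  assumes eig: "\<And>n. H_op al th phi n = z * phi n" and B: "\<And>n. cmod (phi n) \<le> B"
    and unb: "\<And>x. \<exists>N. x < (\<Sum>n<N. (cmod (phi (int n)))\<^sup>2)"
  shows "z \<in> spectrum_l2Z (H_op al th)"
proof (rule ccontr)
  assume "z \<notin> spectrum_l2Z (H_op al th)"
  then obtain R where R: "bounded_op_l2Z R" "\<And>psi. psi \<in> l2Z \<Longrightarrow> R (\<lambda>n. H_op al th psi n - z * psi n) = psi"
    unfolding spectrum_l2Z_def by blast
  then obtain C where C: "\<And>psi. psi \<in> l2Z \<Longrightarrow> norm_l2Z (R psi) \<le> C * norm_l2Z psi"
    unfolding bounded_op_l2Z_def by blast
  have B0: "B \<ge> 0" using B[of 0] norm_ge_zero order_trans by blast
  \<comment> \<open>\<open>4 * B\<close> bounds the norm of the cut-off error: at most four entries,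
    each of modulus at most \<open>2 * B\<close>.\<close>
  obtain N where N: "(\<bar>C\<bar> * (4 * B))\<^sup>2 < (\<Sum>n<N. (cmod (phi (int n)))\<^sup>2)" using unb by blast
  define psi where "psi n = (if 0 \<le> n \<and> n < int N then phi n else 0)" for n
  define eta where "eta n = H_op al th psi n - z * psi n" for n
  have psi_l2: "l2_bound psi (sqrt (\<Sum>n<N. (cmod (phi (int n)))\<^sup>2))"
    unfolding l2_bound_sum
  proof (intro conjI allI impI)
    fix F :: "int set" assume "finite F"
    then have "(\<Sum>n\<in>F. (cmod (psi n))\<^sup>2) \<le> (\<Sum>n\<in>F \<union> int ` {..<N}. (cmod (psi n))\<^sup>2)"
      by (intro sum_mono2) auto
    also have "\<dots> = (\<Sum>n\<in>int ` {..<N}. (cmod (psi n))\<^sup>2)"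
    proof (rule sum.mono_neutral_right)
      show "\<forall>i\<in>(F \<union> int ` {..<N}) - int ` {..<N}. (cmod (psi i))\<^sup>2 = 0"
      proof
        fix i assume "i \<in> (F \<union> int ` {..<N}) - int ` {..<N}"
        then have "\<not> (0 \<le> i \<and> i < int N)" by (metis DiffD2 image_eqI lessThan_iff nonneg_int_cases of_nat_less_iff)
        then show "(cmod (psi i))\<^sup>2 = 0" by (auto simp: psi_def)
      qed
    qed (use \<open>finite F\<close> in auto)
    also have "\<dots> = (\<Sum>n<N. (cmod (phi (int n)))\<^sup>2)"
      by (subst sum.reindex) (auto simp: psi_def)
    finally show "(\<Sum>n\<in>F. (cmod (psi n))\<^sup>2) \<le> (sqrt (\<Sum>n<N. (cmod (phi (int n)))\<^sup>2))\<^sup>2"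
      by (simp add: sum_nonneg)
  qed (simp add: sum_nonneg)
  then have psi: "psi \<in> l2Z" by (rule l2_bound_imp_l2Z)
  have eta_supp: "eta n = 0" if "n \<notin> {- 1, 0, int N - 1, int N}" for n
  proof -
    have "n < - 1 \<or> (0 < n \<and> n < int N - 1) \<or> n > int N" using that by simp presburger
    then consider "n < - 1" | "0 < n \<and> n < int N - 1" | "n > int N" by blast
    then show ?thesis
    proof cases
      case 2
      then show ?thesis using eig[of n] by (simp add: eta_def psi_def H_op_def)
    qed (simp_all add: eta_def psi_def H_op_def)
  qed
  have eta_bound: "cmod (eta n) \<le> 2 * B" for n
  proof (cases "0 \<le> n \<and> n < int N")
    case True
    then have "psi n = phi n" by (simp add: psi_def)
    then have "eta n = (psi (n - 1) - phi (n - 1)) + (psi (n + 1) - phi (n + 1))"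
      using eig[of n] by (simp add: eta_def H_op_def algebra_simps)
    moreover have "cmod (psi m - phi m) \<le> B" for m using B[of m] B0 by (simp add: psi_def)
    ultimately show ?thesis by (metis add_mono mult_2 norm_triangle_le)
  next
    case False
    then have "eta n = psi (n - 1) + psi (n + 1)" by (auto simp: eta_def H_op_def psi_def)
    moreover have "cmod (psi m) \<le> B" for m using B[of m] B0 by (simp add: psi_def)
    ultimately show ?thesis by (metis add_mono mult_2 norm_triangle_le)
  qed
  have eta_l2: "l2_bound eta (4 * B)"
    unfolding l2_bound_sum
  proof (intro conjI allI impI)
    fix F :: "int set" assume "finite F"
    then have "(\<Sum>n\<in>F. (cmod (eta n))\<^sup>2) \<le> (\<Sum>n\<in>F \<union> {- 1, 0, int N - 1, int N}. (cmod (eta n))\<^sup>2)"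
      by (intro sum_mono2) auto
    also have "\<dots> = (\<Sum>n\<in>{- 1, 0, int N - 1, int N}. (cmod (eta n))\<^sup>2)"
      by (rule sum.mono_neutral_right) (use \<open>finite F\<close> eta_supp in auto)
    also have "\<dots> \<le> of_nat (card {- 1, 0, int N - 1, int N}) * (2 * B)\<^sup>2"
      by (rule sum_bounded_above) (rule power_mono[OF eta_bound], simp)
    also have "\<dots> \<le> 4 * (2 * B)\<^sup>2"
    proof -
      have "card {- 1, 0, int N - 1, int N} \<le> 4" using card_length[of "[- 1, 0, int N - 1, int N]"] by simp
      then have "real (card {- 1, 0, int N - 1, int N}) \<le> 4" by linarith
      then show ?thesis by (intro mult_right_mono) auto
    qed
    finally show "(\<Sum>n\<in>F. (cmod (eta n))\<^sup>2) \<le> (4 * B)\<^sup>2" by (simp add: power_mult_distrib)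
  qed (use B0 in simp)
  have "(\<Sum>n<N. (cmod (phi (int n)))\<^sup>2) = (\<Sum>n\<in>int ` {..<N}. (cmod (psi n))\<^sup>2)"
    by (subst sum.reindex) (auto simp: psi_def)
  also have "\<dots> \<le> (norm_l2Z psi)\<^sup>2" using l2Z_imp_l2_bound[OF psi] by (auto simp: l2_bound_sum)
  also have "\<dots> \<le> (\<bar>C\<bar> * (4 * B))\<^sup>2"
  proof (rule power_mono)
    have "norm_l2Z psi = norm_l2Z (R eta)" using R(2)[OF psi] by (simp add: eta_def [abs_def])
    also have "\<dots> \<le> C * norm_l2Z eta" by (rule C[OF l2_bound_imp_l2Z(1)[OF eta_l2]])
    also have "\<dots> \<le> \<bar>C\<bar> * norm_l2Z eta"
      by (intro mult_right_mono) (auto simp: norm_l2Z_def intro: infsum_nonneg)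
    also have "\<dots> \<le> \<bar>C\<bar> * (4 * B)" using l2_bound_imp_l2Z(2)[OF eta_l2] by (intro mult_left_mono) auto
    finally show "norm_l2Z psi \<le> \<bar>C\<bar> * (4 * B)" .
    show "0 \<le> norm_l2Z psi" by (auto simp: norm_l2Z_def intro: infsum_nonneg)
  qed
  finally show False using N by simp
qed

section \<open>The central band\<close>

lemma S_set_le_4: "E \<in> S_set al \<Longrightarrow> E \<le> 4"
  unfolding S_set_def using not_in_spectrum_above_4 by (force simp: not_le[symmetric])

context frequency
begin

text \<open>A Bloch wave with unimodular multiplier has periodic modulus: it is bounded, and one
  nonzero value recurring in every period makes its square sums diverge.\<close>

lemma discriminant_in_S_set:
  assumes "\<bar>discriminant p q E\<bar> \<le> 4"
  shows "E \<in> S_set (real p / real q)"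
proof -
  have "poly (cpoly (disc_poly p q)) (of_real E) = of_real (discriminant p q E)"
    by (simp add: poly_cpoly_of_real poly_disc_poly)
  then obtain th lam phi where th: "0 < th" "th \<le> 1" and lam: "cmod lam = 1" and nz: "\<exists>n::int. phi n \<noteq> 0"
    and per: "\<And>n. phi (n + int q) = lam * phi n"
    and eq: "\<And>n. phi (n + 1) + phi (n - 1) + of_real (2 * cos (2 * pi * (real p / real q * real_of_int n + th))) * phi n = of_real E * phi n"
    using bloch_wave[OF _ assms] by metis
  have perk: "cmod (phi (n + int (k * q))) = cmod (phi n)" for n k
  proof (induction k)
    case (Suc k)
    have "n + int (Suc k * q) = (n + int (k * q)) + int q" by (simp add: algebra_simps)
    then show ?case using per[of "n + int (k * q)"] Suc lam by (simp only: norm_mult mult_1_left)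
  qed simp
  have shift: "\<exists>m k. n + int (k * q) = int m" for n
  proof -
    have "int (nat \<bar>n\<bar>) * 1 \<le> int (nat \<bar>n\<bar>) * int q" using q_pos by (intro mult_left_mono) auto
    then have "n + int (nat \<bar>n\<bar> * q) \<ge> 0" by simp
    then show ?thesis by (metis nonneg_int_cases)
  qed
  have "of_real E \<in> spectrum_l2Z (H_op (real p / real q) th)"
  proof (rule generalized_eigenfunction_in_spectrum)
    show "H_op (real p / real q) th phi n = of_real E * phi n" for n
      using eq[of n] by (simp add: H_op_def algebra_simps)
    show "cmod (phi n) \<le> (\<Sum>j<q. cmod (phi (int j)))" for n
    proof -
      obtain m k where m: "n + int (k * q) = int m" using shift by blast
      have "int m = int (m mod q) + int ((m div q) * q)" by (metis mod_div_mult_eq of_nat_add)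
      then have "cmod (phi n) = cmod (phi (int (m mod q)))" using perk[of n k] perk[of "int (m mod q)" "m div q"] m by simp
      also have "\<dots> \<le> (\<Sum>j<q. cmod (phi (int j)))" using q_pos by (intro member_le_sum) auto
      finally show ?thesis .
    qed
    show "\<exists>N. x < (\<Sum>n<N. (cmod (phi (int n)))\<^sup>2)" for x
    proof -
      obtain n where n: "phi n \<noteq> 0" using nz by blast
      obtain m k where m: "n + int (k * q) = int m" using shift by blast
      define d where "d = (cmod (phi (int m)))\<^sup>2"
      have d: "d > 0" using n perk[of n k] m by (simp add: d_def)
      obtain K :: nat where K: "x / d < real K" using reals_Archimedean2 by blast
      have "x < real K * d" using K d by (simp add: field_simps)
      also have "\<dots> = (\<Sum>k<K. (cmod (phi (int (m + k * q))))\<^sup>2)" using perk[of "int m"] by (simp add: d_def)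
      also have "\<dots> = (\<Sum>n\<in>(\<lambda>k. m + k * q) ` {..<K}. (cmod (phi (int n)))\<^sup>2)"
        using q_pos by (subst sum.reindex) (auto simp: inj_on_def)
      also have "\<dots> \<le> (\<Sum>n<m + K * q. (cmod (phi (int n)))\<^sup>2)"
        by (intro sum_mono2) (use q_pos in auto)
      finally show ?thesis by blast
    qed
  qed
  then show ?thesis using th unfolding S_set_def by force
qed

lemma deriv_discriminant: "deriv (discriminant p q) 0 = poly (pderiv (disc_poly p q)) 0"
proof -
  have "discriminant p q = poly (disc_poly p q)" by (simp add: fun_eq_iff poly_disc_poly)
  then show ?thesis by (simp add: DERIV_imp_deriv poly_DERIV)
qed

text \<open>The linear bound puts the whole interval from 0 to \<open>4 / D\<close> into the
  spectral set; being connected, it lies in the component of 0.\<close>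

lemma w0_ge:
  assumes "deriv (discriminant p q) 0 \<noteq> 0"
  shows "w0 p q \<ge> 4 / \<bar>deriv (discriminant p q) 0\<bar>"
proof -
  define f where "f = disc_poly p q"
  define D where "D = \<bar>poly (pderiv f) 0\<bar>"
  have D: "D > 0" using assms by (simp add: D_def f_def deriv_discriminant)
  have odd: "poly f (- x) = - poly f x" for x
    using chiral_parity[of hop q x] odd_q by (simp add: f_def disc_poly_chiral)
  then have "poly f 0 = 0" using odd[of 0] by simp
  then obtain h where h: "f = [:0, 1:] * h" by (auto simp: poly_eq_0_iff_dvd)
  have even: "poly h (- x) = poly h x" for x
    using odd[of x] by (cases "x = 0") (auto simp: h)
  have deg: "degree f > 0" using disc_poly_degree[OF q_pos, of p] q_pos
    by (metis f_def gr0I le_degree le_zero_eq neg_equal_0_iff_equal zero_neq_one not_gr_zero)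
  have bound: "\<bar>discriminant p q E\<bar> \<le> 4" if "0 \<le> E" "E * D \<le> 4" for E
    unfolding poly_disc_poly[symmetric] f_def[symmetric]
    by (rule odd_real_rooted_linear_bound[where R = 4, OF _ _ deg h even])
       (use that real_rooted_disc_poly in \<open>auto simp: f_def D_def\<close>)
  have "{0..4 / D} \<subseteq> central_band p q"
    unfolding central_band_def
  proof (rule connected_component_maximal)
    show "{0..4 / D} \<subseteq> S_set (real p / real q)"
      using D by (auto intro!: discriminant_in_S_set bound simp: field_simps)
  qed (use D in auto)
  then have "4 / D \<in> central_band p q" using D by (auto simp: less_imp_le)
  moreover have "bdd_above (central_band p q)"
    unfolding central_band_def
    by (rule bdd_above_mono[OF bdd_aboveI[of "S_set (real p / real q)" 4] connected_component_subset])
       (rule S_set_le_4)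
  ultimately have "4 / D \<le> w0 p q" unfolding w0_def by (rule cSup_upper)
  then show ?thesis by (simp add: D_def f_def deriv_discriminant)
qed

section \<open>The derivative at zero as a sum of exponentials\<close>

definition log_sine_sum :: "nat \<Rightarrow> real" where
  "log_sine_sum N = (\<Sum>j=1..N. (-1) ^ j * ln \<bar>2 * sin (pi * (real p / real q * real j))\<bar>)"

lemma hop_exp:
  assumes "1 \<le> t" "t < q"
  shows "hop t = exp (2 * ln \<bar>2 * sin (pi * (real p / real q * real t))\<bar>)"
proof -
  have "1 - om ^ t \<noteq> 0" using om_power_ne_1[of t] assms by auto
  moreover from this have "1 - 1 / om ^ t \<noteq> 0" by (simp add: field_simps)
  ultimately have "complex_of_real (hop t) \<noteq> 0" unfolding hop_om by (rule no_zero_divisors)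
  then have "hop t \<noteq> 0" by simp
  then have "\<bar>2 * sin (pi * (real p / real q * real t))\<bar> > 0" by (auto simp: hop_def)
  then have "exp (2 * ln \<bar>2 * sin (pi * (real p / real q * real t))\<bar>) = \<bar>2 * sin (pi * (real p / real q * real t))\<bar>\<^sup>2"
    by (simp only: exp_double exp_ln)
  then show ?thesis by (simp add: hop_def power_mult_distrib)
qed

text \<open>The quotient of odd and even products is the exponential of an alternating log-sine sum.
  In the matching formula it turns every mixed product into a multiple of the full even product,
  whose value is \<open>q\<close>.\<close>

lemma prod_hop_odd:
  assumes "2 * r < q"
  shows "(\<Prod>i=1..r. hop (2 * i - 1)) = exp (- 2 * log_sine_sum (2 * r)) * (\<Prod>i=1..r. hop (2 * i))"
  using assms
proof (induction r)
  case (Suc r)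
  define s where "s t = ln \<bar>2 * sin (pi * (real p / real q * real t))\<bar>" for t
  have h1: "hop (Suc (2 * r)) = exp (2 * s (Suc (2 * r)))" unfolding s_def
    by (rule hop_exp) (use Suc.prems in auto)
  have h2: "hop (Suc (Suc (2 * r))) = exp (2 * s (Suc (Suc (2 * r))))" unfolding s_def
    by (rule hop_exp) (use Suc.prems in auto)
  have "log_sine_sum (2 * Suc r) = log_sine_sum (2 * r) - s (Suc (2 * r)) + s (Suc (Suc (2 * r)))"
    unfolding log_sine_sum_def s_def[symmetric] by simp
  then have "exp (- 2 * log_sine_sum (2 * Suc r)) * hop (Suc (Suc (2 * r))) = exp (- 2 * log_sine_sum (2 * r)) * hop (Suc (2 * r))"
    unfolding h1 h2 by (simp add: exp_add[symmetric] algebra_simps)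
  then show ?case using Suc by (simp add: mult_ac)
qed (simp add: log_sine_sum_def)

lemma abs_deriv_discriminant:
  assumes "q = 2 * m + 1"
  shows "\<bar>deriv (discriminant p q) 0\<bar> = (\<Sum>r=0..m. real q * exp (- 2 * log_sine_sum (2 * r)))"
proof -
  have "(\<Prod>i=1..r. hop (2 * i - 1)) * (\<Prod>i=Suc r..m. hop (2 * i)) = real q * exp (- 2 * log_sine_sum (2 * r))"
    if "r \<le> m" for r
  proof -
    have "(\<Prod>i=1..r. hop (2 * i)) * (\<Prod>i=Suc r..m. hop (2 * i)) = (\<Prod>i=1..m. hop (2 * i))"
      using prod.ub_add_nat[of 1 r "\<lambda>i. hop (2 * i)" "m - r"] that by simp
    then show ?thesis using prod_hop_even[OF assms] prod_hop_odd[of r] that assms by (simp add: mult_ac)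
  qed
  then have e: "(\<Sum>r=0..m. (\<Prod>i=1..r. hop (2 * i - 1)) * (\<Prod>i=Suc r..m. hop (2 * i))) =
      (\<Sum>r=0..m. real q * exp (- 2 * log_sine_sum (2 * r)))"
    by (intro sum.cong) auto
  have "deriv (discriminant p q) 0 = - poly (pderiv (chiral hop (2 * m + 1))) 0"
    unfolding deriv_discriminant disc_poly_chiral assms[symmetric] by (simp add: pderiv_minus)
  then have "\<bar>deriv (discriminant p q) 0\<bar> = \<bar>\<Sum>r=0..m. real q * exp (- 2 * log_sine_sum (2 * r))\<bar>"
    unfolding chiral_odd_deriv_0 e by (simp add: abs_mult)
  then show ?thesis by (simp add: sum_nonneg)
qed

end

section \<open>Explicit bounds for the derivative and the band width\<close>

lemma parity_cf: "(\<And>a. a \<in> set as \<Longrightarrow> even a) \<Longrightarrow> odd (cf_num as + cf_den as)"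
  by (induction as) auto

lemma central_band_estimate:
  assumes par: "parity_quotients n a" and low: "lowest_terms p q (cfrac (map a [1..<Suc n]))"
  shows "0 < \<bar>deriv (discriminant p q) 0\<bar>"
    "\<bar>deriv (discriminant p q) 0\<bar> \<le> 6 * real q ^ 4 * 64 ^ (n - 1)"
    "\<bar>deriv (discriminant p q) 0\<bar> \<le> 6 * real q ^ 10"
    "w0 p q \<ge> 4 / \<bar>deriv (discriminant p q) 0\<bar>"
proof -
  define as where "as = map a [2..<Suc n]"
  have n: "n \<ge> 1" and a1: "odd (a 1)" using par by (auto simp: parity_quotients_def)
  have list: "map a [1..<Suc n] = a 1 # as"
    using n by (simp add: as_def upt_conv_Cons numeral_2_eq_2 del: upt_Suc)
  have as: "b > 0" "even b" if "b \<in> set as" for b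
    using that par by (auto simp: as_def parity_quotients_def)
  have pos: "b > 0" if "b \<in> set (a 1 # as)" for b using that as a1 odd_pos by auto
  have pq: "p = cf_num (a 1 # as)" "q = cf_den (a 1 # as)"
    using lowest_terms_cf[OF low] pos unfolding list by blast+
  \<comment> \<open>\<open>q\<close> is \<open>a 1\<close> times the denominator of the tail plus
    its numerator; for odd \<open>a 1\<close> this has the parity of their sum.\<close>
  have "odd q" using parity_cf[of as] as a1 by (auto simp: pq)
  moreover have "coprime p q" using low by (simp add: lowest_terms_def)
  ultimately interpret frequency p q by unfold_locales
  have al: "cfrac (a 1 # as) = real p / real q" using low unfolding list lowest_terms_def by blast
  have len: "length as = n - 1" by (simp add: as_def del: upt_Suc)
  have p: "p \<ge> 2 ^ (n - 1)" "p > 0" "p \<le> q"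
  proof -
    have "b \<ge> 2" if "b \<in> set as" for b using as[OF that] by (auto elim!: evenE)
    then show "p \<ge> 2 ^ (n - 1)" using cf_den_ge_power[of as] by (simp add: pq len)
    show "p > 0" using cf_pos[of as] as by (simp add: pq)
    show "p \<le> q" unfolding pq by (rule cf_num_le_den) (rule pos)
  qed
  obtain m where m: "q = 2 * m + 1" using odd_q by (auto elim!: oddE)
  \<comment> \<open>6 bounds the square of the loss \<open>1 + sqrt 2\<close> of the sine step; 64
    is the square of the loss 8 of each tangent step.\<close>
  define B where "B = 6 * 64 ^ (n - 1) * (real p)\<^sup>2"
  have summand: "exp (- 2 * log_sine_sum (2 * r)) \<le> B" if "r \<le> m" for r
  proof -
    have "log_sine_sum (2 * r) \<ge> - (ln (1 + sqrt 2) + real (n - 1) * ln 8 + ln (real p))"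
      using sin_sum_lower_bound[OF a1, of as "2 * r"] as that m
      unfolding log_sine_sum_def al len pq(2)[symmetric] by (simp add: pq(1))
    then have "exp (- 2 * log_sine_sum (2 * r)) \<le> exp (2 * (ln (1 + sqrt 2) + real (n - 1) * ln 8 + ln (real p)))"
      by simp
    also have "\<dots> = (exp (ln (1 + sqrt 2)) * exp (real (n - 1) * ln 8) * exp (ln (real p)))\<^sup>2"
      by (simp only: exp_add exp_double power_mult_distrib)
    also have "exp (ln (1 + sqrt 2)) = 1 + sqrt 2" by (simp add: add_pos_nonneg)
    also have "exp (ln (real p)) = real p" using p by simp
    also have "exp (real (n - 1) * ln 8) = 8 ^ (n - 1)" by (simp add: exp_of_nat_mult)
    also have "((1 + sqrt 2) * 8 ^ (n - 1) * real p)\<^sup>2 = (1 + sqrt 2)\<^sup>2 * (8\<^sup>2) ^ (n - 1) * (real p)\<^sup>2"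
      by (simp only: power_mult_distrib power_mult[symmetric] mult.commute)
    also have "\<dots> \<le> 6 * 64 ^ (n - 1) * (real p)\<^sup>2"
    proof -
      have "sqrt 2 \<le> 3 / 2" by (rule real_le_lsqrt) (auto simp: power2_eq_square)
      then have "(1 + sqrt 2)\<^sup>2 \<le> 6" by (simp add: power2_sum)
      then show ?thesis by (intro mult_right_mono) auto
    qed
    finally show ?thesis by (simp add: B_def)
  qed
  \<comment> \<open>One factor \<open>q\<close> comes from the formula for the derivative, the other
    from the \<open>m + 1 \<le> q\<close> summands.\<close>
  have D: "\<bar>deriv (discriminant p q) 0\<bar> \<le> real q * (real q * B)"
  proof -
    have "\<bar>deriv (discriminant p q) 0\<bar> \<le> (\<Sum>r=0..m. real q * B)"
      unfolding abs_deriv_discriminant[OF m] using summand by (intro sum_mono mult_left_mono) auto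
    also have "\<dots> = (real m + 1) * (real q * B)" by simp
    also have "\<dots> \<le> real q * (real q * B)" using m by (intro mult_right_mono) (auto simp: B_def)
    finally show ?thesis .
  qed
  have "(\<Sum>r=0..m. real q * exp (- 2 * log_sine_sum (2 * r))) > 0"
    using q_pos by (intro sum_pos) auto
  then show D0: "0 < \<bar>deriv (discriminant p q) 0\<bar>" unfolding abs_deriv_discriminant[OF m] .
  then show "w0 p q \<ge> 4 / \<bar>deriv (discriminant p q) 0\<bar>" using w0_ge by simp
  have pq': "real p \<le> real q" using p by simp
  have "real q * (real q * B) = 6 * 64 ^ (n - 1) * (real q)\<^sup>2 * (real p)\<^sup>2"
    by (simp add: B_def power2_eq_square)
  also have "\<dots> \<le> 6 * 64 ^ (n - 1) * (real q)\<^sup>2 * (real q)\<^sup>2"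
    using pq' by (intro mult_left_mono power_mono) auto
  also have "\<dots> = 6 * real q ^ 4 * 64 ^ (n - 1)" by (simp add: power4_eq_xxxx power2_eq_square)
  finally show D4: "\<bar>deriv (discriminant p q) 0\<bar> \<le> 6 * real q ^ 4 * 64 ^ (n - 1)" using D by simp
  \<comment> \<open>Each of the \<open>n - 1\<close> even quotients at least doubles the
    denominator, so \<open>2 ^ (n - 1) \<le> p \<le> q\<close>.\<close>
  have "(64 :: real) ^ (n - 1) = (2 ^ (n - 1)) ^ 6" 
  proof -
    have "(64 :: real) ^ (n - 1) = (2 ^ 6) ^ (n - 1)" by simp
    also have "\<dots> = (2 ^ (n - 1)) ^ 6" by (simp only: power_mult[symmetric] mult.commute)
    finally show ?thesis .
  qed
  also have "\<dots> \<le> real q ^ 6"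
  proof (rule power_mono)
    have "real (2 ^ (n - 1)) \<le> real q" using p(1,3) by (intro of_nat_mono) auto
    then show "(2 :: real) ^ (n - 1) \<le> real q" by simp
  qed simp
  finally have "6 * real q ^ 4 * 64 ^ (n - 1) \<le> 6 * real q ^ 4 * real q ^ 6" by (intro mult_left_mono) auto
  then show "\<bar>deriv (discriminant p q) 0\<bar> \<le> 6 * real q ^ 10" using D4 by (simp flip: power_add)
qed

text \<open>The iteration starts at the second denominator: \<open>q 1 = a 1\<close> may be 1, whose
  powers do not grow, whereas \<open>q 2 = a 1 * a 2 + 1 \<ge> 3\<close>.\<close>

lemma superexponential_denominators:
  fixes nu :: real and q :: "nat \<Rightarrow> nat"
  assumes par: "parity_quotients n a" and n: "n \<ge> 2" and nu: "nu > 1"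
    and low: "\<forall>k\<in>{1..n}. lowest_terms (p k) (q k) (cfrac (map a [1..<Suc k]))"
    and gr: "\<forall>k. 1 \<le> k \<and> k \<le> n - 1 \<longrightarrow> real (q (k + 1)) \<ge> real (q k) powr nu"
  shows "real (q n) \<ge> 3 powr (nu ^ (n - 2))"
proof -
  have "real (q (Suc (Suc k))) \<ge> 3 powr (nu ^ k)" if "Suc (Suc k) \<le> n" for k
    using that
  proof (induction k)
    case 0
    have a: "a 1 > 0" "a 2 > 0" "even (a 2)" using par n by (auto simp: parity_quotients_def)
    have l: "map a [1..<Suc 2] = [a 1, a 2]" by (simp add: numeral_2_eq_2)
    have "q 2 = cf_den [a 1, a 2]"
    proof (rule lowest_terms_cf(2))
      show "lowest_terms (p 2) (q 2) (cfrac [a 1, a 2])" unfolding l[symmetric] by (rule low[rule_format]) (use n in simp)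
    qed (use a in auto)
    moreover have "1 * 2 \<le> a 1 * a 2" using a by (intro mult_mono) (auto elim!: evenE)
    ultimately have "q 2 \<ge> 3" by simp
    then show ?case by (simp add: numeral_2_eq_2)
  next
    case (Suc k)
    have "3 powr (nu ^ Suc k) = (3 powr (nu ^ k)) powr nu" by (simp add: powr_powr mult.commute)
    also have "\<dots> \<le> real (q (Suc (Suc k))) powr nu"
      using Suc nu by (intro powr_mono2) auto
    also have "\<dots> \<le> real (q (Suc (Suc (Suc k))))" using gr[rule_format, of "Suc (Suc k)"] Suc.prems by simp
    finally show ?case .
  qed
  from this[of "n - 2"] show ?thesis using n by (simp add: Suc_diff_Suc numeral_2_eq_2)
qed

theorem lemma2:
  "(\<exists>C1 C2 :: real. 1 < C1 \<and> C1 < 14 \<and> 1 < C2 \<and> C2 < exp 10 \<and>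
      (\<forall>(n::nat) (a :: nat \<Rightarrow> nat) (p::nat) (q::nat).
         parity_quotients n a \<and> lowest_terms p q (cfrac (map a [1..<Suc n])) \<longrightarrow>
           \<bar>deriv (discriminant p q) 0\<bar> < C2 * real q powr C1 \<and>
           w0 p q \<ge> 4 / \<bar>deriv (discriminant p q) 0\<bar> \<and>
           4 / \<bar>deriv (discriminant p q) 0\<bar> > 4 * inverse C2 * real q powr (- C1))) \<and>
   (\<forall>\<nu> \<epsilon> :: real. \<nu> > 1 \<and> \<epsilon> > 0 \<longrightarrow>
      (\<exists>Q::real. \<forall>(n::nat) (a :: nat \<Rightarrow> nat) (p :: nat \<Rightarrow> nat) (q :: nat \<Rightarrow> nat).
         parity_quotients n a \<and>
         (\<forall>k\<in>{1..n}. lowest_terms (p k) (q k) (cfrac (map a [1..<Suc k]))) \<and>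
         (\<forall>k. 1 \<le> k \<and> k \<le> n - 1 \<longrightarrow> real (q (k + 1)) \<ge> real (q k) powr \<nu>) \<and>
         real (q n) > Q \<longrightarrow>
           \<bar>deriv (discriminant (p n) (q n)) 0\<bar> < real (q n) powr (5 + euler_mascheroni + \<epsilon>) \<and>
           w0 (p n) (q n) > 4 * real (q n) powr (- (5 + euler_mascheroni + \<epsilon>))))"
proof (intro conjI allI impI)
  \<comment> \<open>The witnesses are 10 and 7: the estimate gives \<open>6 * q ^ 10\<close>, and 7
    instead of 6 makes the inequality strict.\<close>
  have "(7 :: real) < exp 10" using exp_ge_add_one_self[of "10 :: real"] by simp
  moreover have "\<bar>deriv (discriminant p q) 0\<bar> < 7 * real q powr 10 \<and>
           w0 p q \<ge> 4 / \<bar>deriv (discriminant p q) 0\<bar> \<and>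
           4 / \<bar>deriv (discriminant p q) 0\<bar> > 4 * inverse 7 * real q powr (- 10)"
    if "parity_quotients n a" "lowest_terms p q (cfrac (map a [1..<Suc n]))" for n a p q
  proof -
    note est = central_band_estimate[OF that]
    have q: "real q > 0" using that(2) by (simp add: lowest_terms_def)
    have "6 * real q ^ 10 < 7 * real q powr 10" using q by (simp add: powr_numeral)
    then have lt: "\<bar>deriv (discriminant p q) 0\<bar> < 7 * real q powr 10" using est(3) by linarith
    have "4 * inverse 7 * real q powr (- 10) = 4 / (7 * real q powr 10)"
      by (simp only: powr_minus divide_inverse inverse_mult_distrib mult.assoc)
    also have "\<dots> < 4 / \<bar>deriv (discriminant p q) 0\<bar>"
      using lt est(1) q by (intro divide_strict_left_mono) auto
    finally show ?thesis using lt est(4) by blast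
  qed
  ultimately show "\<exists>C1 C2 :: real. 1 < C1 \<and> C1 < 14 \<and> 1 < C2 \<and> C2 < exp 10 \<and>
      (\<forall>(n::nat) (a :: nat \<Rightarrow> nat) (p::nat) (q::nat).
         parity_quotients n a \<and> lowest_terms p q (cfrac (map a [1..<Suc n])) \<longrightarrow>
           \<bar>deriv (discriminant p q) 0\<bar> < C2 * real q powr C1 \<and>
           w0 p q \<ge> 4 / \<bar>deriv (discriminant p q) 0\<bar> \<and>
           4 / \<bar>deriv (discriminant p q) 0\<bar> > 4 * inverse C2 * real q powr (- C1))"
    by (intro exI[of _ 10] exI[of _ 7] conjI allI impI; (elim conjE)?) (simp, simp, simp, assumption, blast+)
next
  fix nu eps :: real
  assume "nu > 1 \<and> eps > 0"
  then have nu: "nu > 1" and eps: "eps > 0" by auto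
  \<comment> \<open>The factor from the tangent steps is exponential in \<open>n\<close>, the lower
    bound for the denominator doubly exponential.\<close>
  have "eventually (\<lambda>n::nat. 6 * 64 ^ n < 3 powr (nu powr (real n - 2))) at_top"
    using nu by real_asymp
  then obtain n0 where n0: "\<And>n. n \<ge> n0 \<Longrightarrow> 6 * 64 ^ n < 3 powr (nu powr (real n - 2))"
    by (auto simp: eventually_at_top_linorder)
  show "\<exists>Q::real. \<forall>(n::nat) (a :: nat \<Rightarrow> nat) (p :: nat \<Rightarrow> nat) (q :: nat \<Rightarrow> nat).
         parity_quotients n a \<and>
         (\<forall>k\<in>{1..n}. lowest_terms (p k) (q k) (cfrac (map a [1..<Suc k]))) \<and>
         (\<forall>k. 1 \<le> k \<and> k \<le> n - 1 \<longrightarrow> real (q (k + 1)) \<ge> real (q k) powr nu) \<and>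
         real (q n) > Q \<longrightarrow>
           \<bar>deriv (discriminant (p n) (q n)) 0\<bar> < real (q n) powr (5 + euler_mascheroni + eps) \<and>
           w0 (p n) (q n) > 4 * real (q n) powr (- (5 + euler_mascheroni + eps))"
  proof (intro exI[of _ "6 * 64 ^ (n0 + 2)"] allI impI, elim conjE)
    fix n :: nat and a p q :: "nat \<Rightarrow> nat"
    assume par: "parity_quotients n a"
      and low: "\<forall>k\<in>{1..n}. lowest_terms (p k) (q k) (cfrac (map a [1..<Suc k]))"
      and gr: "\<forall>k. 1 \<le> k \<and> k \<le> n - 1 \<longrightarrow> real (q (k + 1)) \<ge> real (q k) powr nu"
      and big: "real (q n) > 6 * 64 ^ (n0 + 2)"
    have n: "n \<ge> 1" using par by (simp add: parity_quotients_def)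
    have low_n: "lowest_terms (p n) (q n) (cfrac (map a [1..<Suc n]))" using low n by auto
    note est = central_band_estimate[OF par low_n]
    define D where "D = \<bar>deriv (discriminant (p n) (q n)) 0\<bar>"
    have q1: "real (q n) \<ge> 1" using low_n by (simp add: lowest_terms_def)
    \<comment> \<open>Long expansions are covered by the growth of the denominators, the finitely
      many short lengths by the choice of \<open>Q\<close>.\<close>
    have "6 * 64 ^ (n - 1) < real (q n)"
    proof (cases "n \<ge> n0 + 2")
      case True
      have "6 * 64 ^ (n - 1) \<le> (6 * 64 ^ n :: real)" by (intro mult_left_mono power_increasing) auto
      also have "\<dots> < 3 powr (nu powr (real n - 2))" using n0[of n] True by simp
      also have "nu powr (real n - 2) = nu ^ (n - 2)"
        using nu True by (simp add: powr_realpow[symmetric] of_nat_diff)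
      also have "3 powr (nu ^ (n - 2)) \<le> real (q n)"
        by (rule superexponential_denominators[OF par _ nu low gr]) (use True in simp)
      finally show ?thesis .
    next
      case False
      then have "(64 :: real) ^ (n - 1) \<le> 64 ^ (n0 + 2)" by (intro power_increasing) auto
      then show ?thesis using big by linarith
    qed
    \<comment> \<open>Exponent 5: four powers from the general estimate, one for the absorbed
      factor.\<close>
    then have "real (q n) ^ 4 * (6 * 64 ^ (n - 1)) < real (q n) ^ 4 * real (q n)"
      using q1 by (intro mult_strict_left_mono) auto
    then have "D < real (q n) ^ 5" using est(2) by (simp add: D_def mult_ac numeral_eq_Suc)
    also have "\<dots> = real (q n) powr 5" using q1 by (simp add: powr_numeral)
    also have "\<dots> \<le> real (q n) powr (5 + euler_mascheroni + eps)"
      using q1 eps euler_mascheroni_pos by (intro powr_mono) auto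
    finally have lt: "D < real (q n) powr (5 + euler_mascheroni + eps)" .
    have "4 * real (q n) powr (- (5 + euler_mascheroni + eps)) = 4 / real (q n) powr (5 + euler_mascheroni + eps)"
      by (simp only: powr_minus divide_inverse)
    also have "\<dots> < 4 / D" using lt est(1) q1 by (intro divide_strict_left_mono mult_pos_pos) (auto simp: D_def)
    also have "\<dots> \<le> w0 (p n) (q n)" using est(4) by (simp add: D_def)
    finally show "\<bar>deriv (discriminant (p n) (q n)) 0\<bar> < real (q n) powr (5 + euler_mascheroni + eps) \<and>
           w0 (p n) (q n) > 4 * real (q n) powr (- (5 + euler_mascheroni + eps))"
      using lt by (simp add: D_def)
  qed
qed

end
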